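(* Let $\lambda,\mu\in\mathbb C$. The operator $B^{(1)}_{0;\lambda,\mu}=\widetilde\Psi^{(0)}\circ E_{\lambda,\mu}\colon C^\infty(\mathbb R^n\times\mathbb R^n,\mathbb S\otimes\mathbb S')\to C^\infty(\mathbb R^n)$ is given, for $v\in C^\infty(\mathbb R^n,\mathbb S)$ and $w'\in C^\infty(\mathbb R^n,\mathbb S')$, by $$\begin{aligned}B^{(1)}_{0;\lambda,\mu}\big(v(\cdot)\otimes w'(\cdot)\big)(x)={}&(2\mu-n+1)(2\mu+1)\big(\Delta v(x),w'(x)\big)+(2\lambda-n+1)(2\lambda+1)\big(v(x),\Delta w'(x)\big)\\&-2(2\lambda-n+1)(2\mu-n+1)\sum_{j=1}^n\Big(\tfrac{\partial v}{\partial x_j}(x),\tfrac{\partial w'}{\partial x_j}(x)\Big)-2(2\lambda+2\mu-n+2)\big(\mathbf Dv(x),\mathbf D'w'(x)\big).\end{aligned}$$ Moreover, for every $g\in\mathbf G$, $$B^{(1)}_{0;\lambda,\mu}\circ\big(\pi_\lambda(g)\otimes\pi'_\mu(g)\big)=\pi_{0;\lambda+\mu+2}(g)\circ B^{(1)}_{0;\lambda,\mu}$$ (when applied to smooth compactly supported $F$ such that the diagonal action of $g$ is defined on $\mathrm{supp}\,F$).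
   Context: Let $n\ge 1$, $e_1,\dots,e_n$ the standard basis of Euclidean $\mathbb R^n$, and $C\ell(\mathbb R^n)$ the real unital algebra generated by $\mathbb R^n$ with $xy+yx=-2\langle x,y\rangle$. Let $\mathbb S$ be a finite-dimensional complex vector space with a unital algebra homomorphism $\rho\colon C\ell(\mathbb R^n)\otimes\mathbb C\to\mathrm{End}(\mathbb S)$. On the dual $\mathbb S'$ (bilinear pairing $(s,t')$), $\rho'(x)t'=-t'\circ\rho(x)$ for $x\in\mathbb R^n$, extended to an algebra homomorphism. $\mathbf D=\sum_j\rho(e_j)\partial_j$, $\mathbf D'=\sum_j\rho'(e_j)\partial_j$, $\Delta=\sum_j\partial_j^2$; subscripts $x,y$ indicate the variable. $v(\cdot)\otimes w'(\cdot)$ is the function $(x,y)\mapsto v(x)\otimes w'(y)$. $(\widetilde\Psi^{(0)}F)(x)=\Psi^{(0)}(F(x,x))$ with $\Psi^{(0)}(s\otimes t')=(s,t')$. In $P\otimes P'$, $P$ acts in $x$ and on $\mathbb S$, $P'$ in $y$ and on $\mathbb S'$; coefficients depending on $x,y$ act by multiplication after the derivatives. The source operator is (sums over $1\le j\le n$) $$\begin{aligned}E_{\lambda,\mu}={}&|x-y|^2\Delta_x\otimes\Delta_y+2(2\lambda-n+1)\sum_{j}(x_j-y_j)\tfrac{\partial}{\partial x_j}\otimes\Delta_y+2(2\mu-n+1)\sum_{j}(y_j-x_j)\Delta_x\otimes\tfrac{\partial}{\partial y_j}\\&-2\rho(x-y)\mathbf D_x\otimes\Delta_y-2\Delta_x\otimes\rho'(y-x)\mathbf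 D'_y+(2\mu-n+1)(2\mu+1)\Delta_x\otimes\mathrm{id}+(2\lambda-n+1)(2\lambda+1)\,\mathrm{id}\otimes\Delta_y\\&-2(2\lambda-n+1)(2\mu-n+1)\sum_{j}\tfrac{\partial}{\partial x_j}\otimes\tfrac{\partial}{\partial y_j}+2(2\lambda-n+1)\sum_{j}\tfrac{\partial}{\partial x_j}\otimes\rho'(e_j)\mathbf D'_y\\&+2(2\mu-n+1)\sum_{j}\rho(e_j)\mathbf D_x\otimes\tfrac{\partial}{\partial y_j}-2\sum_{j}\rho(e_j)\mathbf D_x\otimes\rho'(e_j)\mathbf D'_y.\end{aligned}$$ On $\mathbb R^{1,n+1}$ with basis $e_0,\dots,e_{n+1}$ let $\mathbf Q(\mathbf x,\mathbf y)=x_0y_0-x_1y_1-\dots-x_{n+1}y_{n+1}$, $\mathbf Q(\mathbf x)=\mathbf Q(\mathbf x,\mathbf x)$, with Clifford algebra generated by $\mathbb R^{1,n+1}$ and $\mathbf x\mathbf y+\mathbf y\mathbf x=2\mathbf Q(\mathbf x,\mathbf y)$; it contains $C\ell(\mathbb R^n)$, $\mathbb R^n=\mathrm{span}(e_1,\dots,e_n)$. $\mathbf G=\mathrm{Spin}_0(1,n+1)$ is the group of products $\mathbf v_1\cdots\mathbf v_{2r}$ with $\mathbf v_j\in\mathbb R^{1,n+1}$, $\mathbf Q(\mathbf v_j)=\pm1$, the number of $j$ with $\mathbf Q(\mathbf v_j)=-1$ being even. $\mathbf M=\mathrm{Spin}(n)$ is the group of products of an even number of unit vectors of $\mathbb R^n$,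 $A=\{a_t=\cosh t+\sinh t\,e_0e_{n+1}\}$, $N=\{1+\tfrac12 y(e_0-e_{n+1}):y\in\mathbb R^n\}$, $\overline N=\{\overline n_x=1+\tfrac12x(e_0+e_{n+1}):x\in\mathbb R^n\}$. The map $(\overline n,m,a,n)\mapsto\overline nman$ from $\overline N\times\mathbf M\times A\times N$ to $\mathbf G$ is injective with dense open image. The action of $g$ is defined at $x$ if $g\overline n_x$ lies in this image; then $g\overline n_x=\overline n_{g(x)}m(g,x)a(g,x)n$. $\chi_\lambda(a_t)=e^{2t\lambda}$. Define $$\big((\pi_\lambda(g)\otimes\pi'_\mu(g))F\big)(x,y)=\chi_\lambda(a(g^{-1},x))^{-1}\chi_\mu(a(g^{-1},y))^{-1}\big(\rho(m(g^{-1},x))^{-1}\otimes\rho'(m(g^{-1},y))^{-1}\big)F(g^{-1}(x),g^{-1}(y)),$$ $$(\pi_{0;\nu}(g)\varphi)(x)=\chi_\nu(a(g^{-1},x))^{-1}\varphi(g^{-1}(x)).$$ These are applied to smooth compactly supported functions on whose support $g$ is defined (for two variables: $g$ defined at $x$ and at $y$ for all $(x,y)$ in the support), and are extended by $0$ at points where $g^{-1}$ is not defined. *)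

theory Defs
  imports "HOL-Analysis.Analysis"
begin

section \<open>Clifford algebras\<close>

text \<open>
  The Clifford algebra of a quadratic space with an ordered orthogonal basis $(e_i)$, $e_i^2 = q_i$,
  is realised on its standard basis $e_I = e_{i_1} \cdots e_{i_k}$, $I = \{i_1 < \dots < i_k\}$.
  The index type carries both the order and the numbers $q_i$.  Real coefficients give the real
  Clifford algebra, complex coefficients its complexification.  That this is the unital algebra
  generated by the vectors subject to $xy + yx = 2 Q(x, y)$ is recorded in the lemmas
  \<open>blade_eq_prod_list\<close>, \<open>gen_anticommute\<close>, \<open>euclid_vec_anticommute\<close> and
  \<open>lorentz_vec_anticommute\<close>.
\<close>

class clifford_index = finite + linorder +
  fixes qform :: "'a \<Rightarrow> int"

text \<open>$e_I e_J = \pm q \, e_{I \mathbin{\triangle} J}$: a factor $-1$ for every pair of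
  generators that is out of order, and a factor $q_i$ for every common index.\<close>

definition blade_sign :: "'i::clifford_index set \<Rightarrow> 'i set \<Rightarrow> int" where
  "blade_sign I J = (\<Prod>i\<in>I. \<Prod>j\<in>J. if j < i then -1 else 1) * (\<Prod>i\<in>I \<inter> J. qform i)"

typedef ('i, 'k) clifford = "UNIV :: ('i set \<Rightarrow> 'k) set"
  morphisms coef Abs_clifford
  by simp

lemmas coef_Abs [simp] = Abs_clifford_inverse [OF UNIV_I]

lemma clifford_eqI: "(\<And>I. coef a I = coef b I) \<Longrightarrow> a = b"
  by (metis coef_inject ext)

lemma blade_sign_UNIV:
  "blade_sign (I :: 'i::clifford_index set) J =
    (\<Prod>i\<in>UNIV. \<Prod>j\<in>UNIV. if i \<in> I \<and> j \<in> J \<and> j < i then -1 else 1)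
    * (\<Prod>i\<in>UNIV. if i \<in> I \<and> i \<in> J then qform i else 1)"
proof -
  have *: "(\<Prod>i\<in>A. f i) = (\<Prod>i\<in>UNIV. if i \<in> A then f i else 1)" for A :: "'i set" and f :: "'i \<Rightarrow> int"
    using prod.inter_restrict [of UNIV f A] by simp
  have "(\<Prod>i\<in>I. \<Prod>j\<in>J. if j < i then -1 else (1::int))
      = (\<Prod>i\<in>UNIV. \<Prod>j\<in>UNIV. if i \<in> I \<and> j \<in> J \<and> j < i then -1 else 1)"
    unfolding * [of _ I] * [of _ J] by (intro prod.cong refl) (auto intro!: prod.cong)
  moreover have "(\<Prod>i\<in>I \<inter> J. qform i) = (\<Prod>i\<in>UNIV. if i \<in> I \<and> i \<in> J then qform i else 1)"
    unfolding * [of _ "I \<inter> J"] by simp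
  ultimately show ?thesis
    by (simp add: blade_sign_def)
qed

lemma blade_sign_cocycle:
  "blade_sign (I :: 'i::clifford_index set) J * blade_sign (sym_diff I J) K
    = blade_sign I (sym_diff J K) * blade_sign J K"
proof -
  have 1: "(\<Prod>i\<in>UNIV. \<Prod>j\<in>UNIV. (if i \<in> I \<and> j \<in> J \<and> j < i then -1 else 1)
        * (if i \<in> sym_diff I J \<and> j \<in> K \<and> j < i then -1 else (1::int)))
      = (\<Prod>i\<in>UNIV. \<Prod>j\<in>UNIV. (if i \<in> I \<and> j \<in> sym_diff J K \<and> j < i then -1 else 1)
        * (if i \<in> J \<and> j \<in> K \<and> j < i then -1 else 1))"
    apply (intro prod.cong refl)
    subgoal for i j
      by (cases "i \<in> I"; cases "i \<in> J"; cases "j \<in> J"; cases "j \<in> K"; cases "j < i"; simp)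
    done
  have 2: "(\<Prod>i\<in>UNIV. (if i \<in> I \<and> i \<in> J then qform i else 1)
        * (if i \<in> sym_diff I J \<and> i \<in> K then qform i else 1))
      = (\<Prod>i\<in>UNIV. (if i \<in> I \<and> i \<in> sym_diff J K then qform i else 1)
        * (if i \<in> J \<and> i \<in> K then qform i else 1))"
    apply (intro prod.cong refl)
    subgoal for i
      by (cases "i \<in> I"; cases "i \<in> J"; cases "i \<in> K"; simp)
    done
  show ?thesis
    using arg_cong2 [OF 1 2, of "(*)"] unfolding blade_sign_UNIV prod.distrib by (simp only: mult_ac)
qed

lemma blade_sign_empty [simp]: "blade_sign {} J = 1" "blade_sign I {} = 1"
  by (simp_all add: blade_sign_def)

lemma if_distrib_sum:
  "(if P then sum f A else 0) = (\<Sum>x\<in>A. if P then f x else 0)"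
  by simp

lemma sum_rotate3:
  "(\<Sum>J\<in>A. \<Sum>K\<in>B. \<Sum>L\<in>C. f J K L) = (\<Sum>L\<in>C. \<Sum>J\<in>A. \<Sum>K\<in>B. (f J K L :: 'b::comm_monoid_add))"
proof -
  have "(\<Sum>J\<in>A. \<Sum>K\<in>B. \<Sum>L\<in>C. f J K L) = (\<Sum>J\<in>A. \<Sum>L\<in>C. \<Sum>K\<in>B. f J K L)"
    by (intro sum.cong refl sum.swap)
  also have "\<dots> = (\<Sum>L\<in>C. \<Sum>J\<in>A. \<Sum>K\<in>B. f J K L)"
    by (rule sum.swap)
  finally show ?thesis .
qed

lemma sum_rotate4:
  "(\<Sum>L\<in>A. \<Sum>K\<in>B. \<Sum>I\<in>C. \<Sum>J\<in>D. f L K I J)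
    = (\<Sum>I\<in>C. \<Sum>J\<in>D. \<Sum>K\<in>B. \<Sum>L\<in>A. (f L K I J :: 'b::comm_monoid_add))"
proof -
  have "(\<Sum>L\<in>A. \<Sum>K\<in>B. \<Sum>I\<in>C. \<Sum>J\<in>D. f L K I J)
      = (\<Sum>I\<in>C. \<Sum>L\<in>A. \<Sum>K\<in>B. \<Sum>J\<in>D. f L K I J)"
    by (rule sum_rotate3)
  also have "\<dots> = (\<Sum>I\<in>C. \<Sum>J\<in>D. \<Sum>L\<in>A. \<Sum>K\<in>B. f L K I J)"
    by (intro sum.cong refl sum_rotate3)
  also have "\<dots> = (\<Sum>I\<in>C. \<Sum>J\<in>D. \<Sum>K\<in>B. \<Sum>L\<in>A. f L K I J)"
    by (intro sum.cong refl sum.swap)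
  finally show ?thesis .
qed

instantiation clifford :: (clifford_index, comm_ring_1) ring_1
begin

definition zero_clifford :: "('a, 'b) clifford" where
  "zero_clifford = Abs_clifford (\<lambda>_. 0)"
definition one_clifford :: "('a, 'b) clifford" where
  "one_clifford = Abs_clifford (\<lambda>I. if I = {} then 1 else 0)"
definition plus_clifford :: "('a, 'b) clifford \<Rightarrow> ('a, 'b) clifford \<Rightarrow> ('a, 'b) clifford" where
  "plus_clifford a b = Abs_clifford (\<lambda>I. coef a I + coef b I)"
definition uminus_clifford :: "('a, 'b) clifford \<Rightarrow> ('a, 'b) clifford" where
  "uminus_clifford a = Abs_clifford (\<lambda>I. - coef a I)"
definition minus_clifford :: "('a, 'b) clifford \<Rightarrow> ('a, 'b) clifford \<Rightarrow> ('a, 'b) clifford" where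
  "minus_clifford a b = Abs_clifford (\<lambda>I. coef a I - coef b I)"
definition times_clifford :: "('a, 'b) clifford \<Rightarrow> ('a, 'b) clifford \<Rightarrow> ('a, 'b) clifford" where
  "times_clifford a b = Abs_clifford (\<lambda>K. \<Sum>I\<in>UNIV. \<Sum>J\<in>UNIV.
     if sym_diff I J = K then of_int (blade_sign I J) * coef a I * coef b J else 0)"

lemma coef_simps [simp]:
  fixes a b :: "('a, 'b) clifford"
  shows "coef (0 :: ('a, 'b) clifford) I = 0"
    and "coef (1 :: ('a, 'b) clifford) I = (if I = {} then 1 else 0)"
    and "coef (a + b) I = coef a I + coef b I"
    and "coef (- a) I = - coef a I"
    and "coef (a - b) I = coef a I - coef b I"
  by (simp_all add: zero_clifford_def one_clifford_def plus_clifford_def uminus_clifford_def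
      minus_clifford_def)

lemma coef_times:
  fixes a b :: "('a, 'b) clifford"
  shows "coef (a * b) K = (\<Sum>I\<in>UNIV. \<Sum>J\<in>UNIV.
    if sym_diff I J = K then of_int (blade_sign I J) * coef a I * coef b J else 0)"
  by (simp add: times_clifford_def)

instance
proof
  fix a b c :: "('a, 'b) clifford"
  let ?s = "\<lambda>I J. of_int (blade_sign I J) :: 'b"
  show "a * b * c = a * (b * c)"
  proof (rule clifford_eqI)
    fix M
    have "coef (a * b * c) M = (\<Sum>L\<in>UNIV. \<Sum>K\<in>UNIV. \<Sum>I\<in>UNIV. \<Sum>J\<in>UNIV.
        if sym_diff I J = L \<and> sym_diff L K = M
        then ?s L K * ?s I J * coef a I * coef b J * coef c K else 0)"
      unfolding coef_times sum_distrib_left sum_distrib_right if_distrib_sum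
      by (intro sum.cong refl) simp
    also have "\<dots> = (\<Sum>I\<in>UNIV. \<Sum>J\<in>UNIV. \<Sum>K\<in>UNIV. \<Sum>L\<in>UNIV.
        if L = sym_diff I J then (if sym_diff L K = M
        then ?s L K * ?s I J * coef a I * coef b J * coef c K else 0) else 0)"
      by (subst sum_rotate4) (intro sum.cong refl, auto)
    also have "\<dots> = (\<Sum>I\<in>UNIV. \<Sum>J\<in>UNIV. \<Sum>K\<in>UNIV. if sym_diff (sym_diff I J) K = M
        then ?s I J * ?s (sym_diff I J) K * coef a I * coef b J * coef c K else 0)"
      by (intro sum.cong refl) (simp only: sum.delta' sum.delta finite UNIV_I if_True mult_ac)
    also have "\<dots> = (\<Sum>I\<in>UNIV. \<Sum>J\<in>UNIV. \<Sum>K\<in>UNIV. if sym_diff I (sym_diff J K) = M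
        then ?s I (sym_diff J K) * ?s J K * coef a I * coef b J * coef c K else 0)"
    proof (intro sum.cong refl)
      fix I J K :: "'a set"
      have "sym_diff (sym_diff I J) K = sym_diff I (sym_diff J K)" by auto
      moreover have "?s I J * ?s (sym_diff I J) K = ?s I (sym_diff J K) * ?s J K"
        unfolding of_int_mult [symmetric] blade_sign_cocycle ..
      ultimately show "(if sym_diff (sym_diff I J) K = M
        then ?s I J * ?s (sym_diff I J) K * coef a I * coef b J * coef c K else 0) =
        (if sym_diff I (sym_diff J K) = M
        then ?s I (sym_diff J K) * ?s J K * coef a I * coef b J * coef c K else 0)"
        by simp
    qed
    also have "\<dots> = (\<Sum>I\<in>UNIV. \<Sum>J\<in>UNIV. \<Sum>K\<in>UNIV. \<Sum>L\<in>UNIV.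
        if L = sym_diff J K then (if sym_diff I L = M
        then ?s I L * ?s J K * coef a I * coef b J * coef c K else 0) else 0)"
      by (intro sum.cong refl) (simp only: sum.delta' sum.delta finite UNIV_I if_True mult_ac)
    also have "\<dots> = (\<Sum>I\<in>UNIV. \<Sum>L\<in>UNIV. \<Sum>J\<in>UNIV. \<Sum>K\<in>UNIV.
        if sym_diff J K = L \<and> sym_diff I L = M
        then ?s I L * ?s J K * coef a I * coef b J * coef c K else 0)"
      by (rule sum.cong [OF refl], subst sum_rotate3) (intro sum.cong refl, auto)
    also have "\<dots> = coef (a * (b * c)) M"
      unfolding coef_times sum_distrib_left sum_distrib_right if_distrib_sum
      by (intro sum.cong refl) (simp add: mult_ac)
    finally show "coef (a * b * c) M = coef (a * (b * c)) M" .
  qed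
  show "1 * a = a"
  proof (rule clifford_eqI)
    fix K
    have "coef (1 * a) K = (\<Sum>I\<in>(UNIV::'a set set). if I = {} then (\<Sum>J\<in>UNIV. if J = K then coef a J else 0) else 0)"
      unfolding coef_times if_distrib_sum by (intro sum.cong refl) auto
    then show "coef (1 * a) K = coef a K" by simp
  qed
  show "a * 1 = a"
  proof (rule clifford_eqI)
    fix K
    have "coef (a * 1) K = (\<Sum>I\<in>UNIV. \<Sum>J\<in>(UNIV::'a set set). if J = {} then (if I = K then coef a I else 0) else 0)"
      unfolding coef_times by (intro sum.cong refl) auto
    then show "coef (a * 1) K = coef a K" by simp
  qed
  show "(a + b) * c = a * c + b * c"
    by (rule clifford_eqI, unfold coef_times coef_simps sum.distrib [symmetric])
      (intro sum.cong refl, simp add: distrib_left distrib_right)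
  show "a * (b + c) = a * b + a * c"
    by (rule clifford_eqI, unfold coef_times coef_simps sum.distrib [symmetric])
      (intro sum.cong refl, simp add: distrib_left distrib_right)
  show "(0 :: ('a, 'b) clifford) \<noteq> 1"
    by (metis coef_simps(1,2) zero_neq_one)
  show "a + b + c = a + (b + c)" "a + b = b + a" "0 + a = a" "- a + a = 0" "a - b = a + - b"
    by (simp_all add: clifford_eqI add.assoc add.commute)
qed

end


definition cl_scale :: "'k::comm_ring_1 \<Rightarrow> ('i, 'k) clifford \<Rightarrow> ('i, 'k) clifford" where
  "cl_scale c a = Abs_clifford (\<lambda>I. c * coef a I)"

instantiation clifford :: (clifford_index, "{real_algebra_1, comm_ring_1}") real_algebra_1
begin

definition scaleR_clifford :: "real \<Rightarrow> ('a, 'b) clifford \<Rightarrow> ('a, 'b) clifford" where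
  "scaleR_clifford r a = cl_scale (of_real r) a"

lemma coef_scaleR [simp]: "coef (r *\<^sub>R a :: ('a, 'b) clifford) I = r *\<^sub>R coef a I"
  by (simp add: scaleR_clifford_def cl_scale_def scaleR_conv_of_real)

instance
proof
  fix r s :: real and a b :: "('a, 'b) clifford"
  show "r *\<^sub>R a * b = r *\<^sub>R (a * b)"
    by (rule clifford_eqI, simp only: coef_times coef_scaleR scaleR_sum_right)
      (intro sum.cong refl, simp)
  show "a * r *\<^sub>R b = r *\<^sub>R (a * b)"
    by (rule clifford_eqI, simp only: coef_times coef_scaleR scaleR_sum_right)
      (intro sum.cong refl, simp)
qed (rule clifford_eqI, simp add: scaleR_add_left scaleR_add_right)+

end

definition blade :: "'i::clifford_index set \<Rightarrow> ('i, 'k::comm_ring_1) clifford" where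
  "blade I = Abs_clifford (\<lambda>J. if J = I then 1 else 0)"

definition gen :: "'i::clifford_index \<Rightarrow> ('i, 'k::comm_ring_1) clifford" where
  "gen i = blade {i}"

lemma coef_blade [simp]: "coef (blade I) J = (if J = I then 1 else 0)"
  by (simp add: blade_def)

lemma blade_times_blade:
  "blade I * blade J = of_int (blade_sign I J) * (blade (sym_diff I J) :: ('i::clifford_index, 'k::comm_ring_1) clifford)"
proof -
  have scale: "coef (of_int z * a) K = of_int z * coef a K" for z and a :: "('i, 'k) clifford" and K
  proof -
    have nat: "coef (of_nat m * a) K = of_nat m * coef a K" for m
      by (induction m) (simp_all add: distrib_right)
    show ?thesis
      by (cases z) (simp_all only: of_int_of_nat_eq of_int_minus nat coef_simps mult_minus_left)
  qed
  show ?thesis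
  proof (rule clifford_eqI)
    fix K
    have "coef (blade I * blade J :: ('i, 'k) clifford) K = (\<Sum>I'\<in>UNIV. \<Sum>J'\<in>UNIV. if J' = J then
        (if I' = I then (if sym_diff I J = K then of_int (blade_sign I J) else 0) else 0) else 0)"
      unfolding coef_times by (intro sum.cong refl) auto
    then show "coef (blade I * blade J) K
        = coef (of_int (blade_sign I J) * (blade (sym_diff I J) :: ('i, 'k) clifford)) K"
      by (simp add: scale)
  qed
qed

lemma blade_eq_prod_list:
  "sorted_wrt (<) is \<Longrightarrow> (blade (set is) :: ('i::clifford_index, 'k::comm_ring_1) clifford) = prod_list (map gen is)"
proof (induction "is")
  case Nil
  show ?case by (rule clifford_eqI) simp
next
  case (Cons i js)
  have "blade_sign {i} (set js) = 1"
  proof -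
    have "{i} \<inter> set js = {}" "(\<Prod>j\<in>set js. if j < i then -1 else (1::int)) = 1"
      using Cons.prems by (auto intro!: prod.neutral dest: less_asym)
    then show ?thesis by (simp add: blade_sign_def)
  qed
  moreover have "sym_diff {i} (set js) = insert i (set js)"
    using Cons.prems by auto
  ultimately have "blade (set (i # js)) = gen i * (blade (set js) :: ('i, 'k) clifford)"
    by (simp add: gen_def blade_times_blade)
  then show ?case
    using Cons by simp
qed

lemma gen_anticommute:
  "gen i * gen j + gen j * gen i
    = (if i = j then of_int (2 * qform i) else 0 :: ('i::clifford_index, 'k::comm_ring_1) clifford)"
proof -
  have 1: "blade {} = (1 :: ('i, 'k) clifford)"
    by (rule clifford_eqI) simp
  show ?thesis
  proof (cases "i = j")
    case True
    then show ?thesis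
      by (simp add: gen_def blade_times_blade blade_sign_def 1 flip: mult_2)
  next
    case False
    then have "blade_sign {i} {j} = - blade_sign {j} {i}" "{j} - {i} = {j}" "{i} - {j} = {i}"
      by (auto simp: blade_sign_def)
    with False show ?thesis
      by (simp add: gen_def blade_times_blade insert_commute)
  qed
qed

section \<open>The Clifford algebras of Euclidean space and of Minkowski space\<close>

datatype 'n euclid = Euclid 'n

text \<open>Indices $0$ (\<open>Time\<close>), $1, \dots, n$ (\<open>Space\<close>) and $n + 1$ (\<open>Last\<close>) of
  $\mathbb R^{1,n+1}$.\<close>

datatype 'n lorentz = Time | Space 'n | Last

instantiation euclid :: ("{finite, linorder}") clifford_index
begin

definition less_eq_euclid :: "'a euclid \<Rightarrow> 'a euclid \<Rightarrow> bool" where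
  "less_eq_euclid i j = (case (i, j) of (Euclid a, Euclid b) \<Rightarrow> a \<le> b)"
definition less_euclid :: "'a euclid \<Rightarrow> 'a euclid \<Rightarrow> bool" where
  "less_euclid i j = (case (i, j) of (Euclid a, Euclid b) \<Rightarrow> a < b)"
definition qform_euclid :: "'a euclid \<Rightarrow> int" where
  "qform_euclid i = -1"

instance
proof
  have "(UNIV :: 'a euclid set) = range Euclid"
    by (auto intro: euclid.exhaust)
  then show "finite (UNIV :: 'a euclid set)"
    by (metis finite finite_imageI)
qed (auto simp: less_eq_euclid_def less_euclid_def split: euclid.splits)

end

instantiation lorentz :: ("{finite, linorder}") clifford_index
begin

definition less_eq_lorentz :: "'a lorentz \<Rightarrow> 'a lorentz \<Rightarrow> bool" where
  "less_eq_lorentz i j = (case (i, j) of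
     (Time, _) \<Rightarrow> True | (_, Last) \<Rightarrow> True | (Space a, Space b) \<Rightarrow> a \<le> b | _ \<Rightarrow> False)"
definition less_lorentz :: "'a lorentz \<Rightarrow> 'a lorentz \<Rightarrow> bool" where
  "less_lorentz i j = (i \<le> j \<and> i \<noteq> j)"
definition qform_lorentz :: "'a lorentz \<Rightarrow> int" where
  "qform_lorentz i = (if i = Time then 1 else -1)"

instance
proof
  have "(UNIV :: 'a lorentz set) = insert Time (insert Last (range Space))"
    by (auto intro: lorentz.exhaust)
  then show "finite (UNIV :: 'a lorentz set)"
    by (metis finite finite_imageI finite_insert)
qed (auto simp: less_eq_lorentz_def less_lorentz_def split: lorentz.splits)

end

definition euclid_vec :: "real^('n::{finite,linorder}) \<Rightarrow> ('n euclid, real) clifford" where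
  "euclid_vec x = (\<Sum>j\<in>UNIV. (x $ j) *\<^sub>R gen (Euclid j))"

definition lorentz_vec :: "real^('n lorentz) \<Rightarrow> ('n::{finite,linorder} lorentz, real) clifford" where
  "lorentz_vec v = (\<Sum>i\<in>UNIV. (v $ i) *\<^sub>R gen i)"

definition lorentz_form :: "real^('n::{finite,linorder} lorentz) \<Rightarrow> real^('n lorentz) \<Rightarrow> real" where
  "lorentz_form v w = v $ Time * w $ Time - (\<Sum>j\<in>UNIV. v $ Space j * w $ Space j) - v $ Last * w $ Last"

lemma sum_gen_anticommute:
  fixes f :: "'a::finite \<Rightarrow> 'i::clifford_index"
  assumes "inj f"
  shows "(\<Sum>i\<in>UNIV. a i *\<^sub>R gen (f i)) * (\<Sum>j\<in>UNIV. b j *\<^sub>R gen (f j))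
     + (\<Sum>j\<in>UNIV. b j *\<^sub>R gen (f j)) * (\<Sum>i\<in>UNIV. a i *\<^sub>R gen (f i))
     = (2 * (\<Sum>i\<in>UNIV. of_int (qform (f i)) * a i * b i)) *\<^sub>R (1 :: ('i, real) clifford)"
proof -
  have c: "(of_int z :: ('i, real) clifford) = of_int z *\<^sub>R 1" for z
    by (simp flip: of_real_def)
  have "(\<Sum>i\<in>UNIV. a i *\<^sub>R gen (f i)) * (\<Sum>j\<in>UNIV. b j *\<^sub>R gen (f j))
     + (\<Sum>j\<in>UNIV. b j *\<^sub>R gen (f j)) * (\<Sum>i\<in>UNIV. a i *\<^sub>R gen (f i))
     = (\<Sum>i\<in>UNIV. \<Sum>j\<in>UNIV. (a i * b j) *\<^sub>R
          (gen (f i) * gen (f j) + gen (f j) * gen (f i) :: ('i, real) clifford))"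
    unfolding sum_product
    by (subst (2) sum.swap) (simp add: scaleR_add_right mult.commute flip: sum.distrib)
  also have "\<dots> = (\<Sum>i\<in>UNIV. \<Sum>j\<in>UNIV. if i = j then (2 * (of_int (qform (f i)) * a i * b i)) *\<^sub>R 1 else 0)"
    unfolding gen_anticommute c using assms
    by (intro sum.cong refl) (auto simp: inj_eq mult_ac)
  finally show ?thesis
    by (simp add: sum_distrib_left scaleR_sum_left)
qed

lemma euclid_vec_anticommute:
  "euclid_vec x * euclid_vec y + euclid_vec y * euclid_vec x = (- 2 * (x \<bullet> y)) *\<^sub>R 1"
  unfolding euclid_vec_def
  by (subst sum_gen_anticommute) (auto simp: inj_def qform_euclid_def inner_vec_def sum_negf)

lemma lorentz_vec_anticommute:
  "lorentz_vec v * lorentz_vec w + lorentz_vec w * lorentz_vec v = (2 * lorentz_form v w) *\<^sub>R 1"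
proof -
  have U: "(UNIV :: 'n lorentz set) = insert Time (insert Last (range Space))"
    by (auto intro: lorentz.exhaust)
  have "(\<Sum>i\<in>UNIV. of_int (qform i) * v $ i * w $ i) = lorentz_form v w"
    unfolding U by (subst sum.insert; auto simp: sum.reindex inj_def qform_lorentz_def lorentz_form_def sum_negf)+
  then show ?thesis
    unfolding lorentz_vec_def by (subst sum_gen_anticommute [where f = "\<lambda>i. i"]) auto
qed

text \<open>The inclusion $C\ell(\mathbb R^n) \subseteq C\ell(\mathbb R^{1,n+1})$.\<close>

definition space_index :: "'n euclid \<Rightarrow> 'n lorentz" where
  "space_index i = (case i of Euclid j \<Rightarrow> Space j)"

definition cl_incl :: "('n::{finite,linorder} euclid, real) clifford \<Rightarrow> ('n lorentz, real) clifford" where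
  "cl_incl a = (\<Sum>I\<in>UNIV. coef a I *\<^sub>R blade (space_index ` I))"

lemma inj_space_index: "inj space_index"
  by (auto simp: inj_def space_index_def split: euclid.splits)

lemma blade_sign_space_index:
  "blade_sign (space_index ` I) (space_index ` J) = blade_sign I J"
proof -
  have "space_index i < space_index j \<longleftrightarrow> i < j" and "qform (space_index i) = qform i"
    for i j :: "'a euclid"
    by (cases i; cases j; auto simp: space_index_def less_lorentz_def less_eq_lorentz_def
        less_euclid_def qform_lorentz_def qform_euclid_def)+
  then show ?thesis
    by (simp add: blade_sign_def prod.reindex inj_on_subset [OF inj_space_index]
        flip: image_Int [OF inj_space_index])
qed

lemma cl_incl_mult: "cl_incl (a * b) = cl_incl a * cl_incl b"
proof -
  let ?\<sigma> = "\<lambda>I. space_index ` I"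
  have of_int_scale: "of_int z * x = of_int z *\<^sub>R x" for z and x :: "('a lorentz, real) clifford"
    by (metis of_real_of_int_eq scaleR_conv_of_real)
  have "cl_incl a * cl_incl b = (\<Sum>I\<in>UNIV. \<Sum>J\<in>UNIV.
      (of_int (blade_sign I J) * coef a I * coef b J) *\<^sub>R blade (?\<sigma> (sym_diff I J)))"
    unfolding cl_incl_def sum_product
    by (intro sum.cong refl)
      (simp add: blade_times_blade of_int_scale blade_sign_space_index image_Un mult_ac
        image_set_diff [OF inj_space_index])
  also have "\<dots> = (\<Sum>I\<in>UNIV. \<Sum>J\<in>UNIV. \<Sum>K\<in>UNIV. if K = sym_diff I J then
      (of_int (blade_sign I J) * coef a I * coef b J) *\<^sub>R blade (?\<sigma> K) else 0)"
    by simp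
  also have "\<dots> = (\<Sum>K\<in>UNIV. \<Sum>I\<in>UNIV. \<Sum>J\<in>UNIV. if K = sym_diff I J then
      (of_int (blade_sign I J) * coef a I * coef b J) *\<^sub>R blade (?\<sigma> K) else 0)"
    by (rule sum_rotate3)
  also have "\<dots> = cl_incl (a * b)"
    unfolding cl_incl_def coef_times scaleR_sum_left by (intro sum.cong refl) auto
  finally show ?thesis ..
qed

lemma cl_incl_euclid_vec: "cl_incl (euclid_vec x) = (\<Sum>j\<in>UNIV. (x $ j) *\<^sub>R gen (Space j))"
proof -
  have coef_sum: "coef (sum f A) I = (\<Sum>j\<in>A. coef (f j) I)"
    for f :: "'a \<Rightarrow> ('a euclid, real) clifford" and A I
    by (induction A rule: infinite_finite_induct) auto
  have "cl_incl (euclid_vec x) = (\<Sum>I\<in>UNIV. \<Sum>j\<in>UNIV.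
      if I = {Euclid j} then (x $ j) *\<^sub>R blade (space_index ` I) else 0)"
    unfolding cl_incl_def euclid_vec_def coef_sum scaleR_sum_left
    by (intro sum.cong refl) (auto simp: gen_def)
  also have "\<dots> = (\<Sum>j\<in>UNIV. \<Sum>I\<in>UNIV.
      if I = {Euclid j} then (x $ j) *\<^sub>R blade (space_index ` I) else 0)"
    by (rule sum.swap)
  finally show ?thesis
    by (simp add: gen_def space_index_def)
qed

text \<open>The inclusion $C\ell(\mathbb R^n) \subseteq C\ell(\mathbb R^n) \otimes \mathbb C$.\<close>

definition complexify :: "('i, real) clifford \<Rightarrow> ('i, complex) clifford" where
  "complexify a = Abs_clifford (\<lambda>I. complex_of_real (coef a I))"

section \<open>Clifford modules and the dual module\<close>

text \<open>
  A finite-dimensional complex vector space $\mathbb S$ is written in a basis as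
  \<open>complex^'s\<close>, its dual $\mathbb S'$ in the dual basis, again as \<open>complex^'s\<close>, and
  $\mathbb S \otimes \mathbb S'$ as \<open>complex^'s^'s\<close>, the entry at \<open>$ i $ j\<close> being the coefficient
  of the tensor product of the \<open>i\<close>-th and the \<open>j\<close>-th basis vector.
\<close>

definition pairing :: "complex^'s \<Rightarrow> complex^'s \<Rightarrow> complex" where
  "pairing s t = (\<Sum>i\<in>UNIV. s $ i * t $ i)"

definition tensor :: "complex^'s \<Rightarrow> complex^'s \<Rightarrow> complex^'s^'s" where
  "tensor s t = (\<chi> i j. s $ i * t $ j)"

definition cmul :: "complex \<Rightarrow> complex^'a^'b \<Rightarrow> complex^'a^'b" (infixr "*\<^sub>C" 75) where
  "c *\<^sub>C T = map_matrix ((*) c) T"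

text \<open>$A \otimes \mathrm{id}$ and $\mathrm{id} \otimes B$ on $\mathbb S \otimes \mathbb S'$.\<close>

definition act_left :: "complex^'s^'s \<Rightarrow> complex^'s^'s \<Rightarrow> complex^'s^'s" where
  "act_left A T = A ** T"

definition act_right :: "complex^'s^'s \<Rightarrow> complex^'s^'s \<Rightarrow> complex^'s^'s" where
  "act_right B T = T ** transpose B"

lemma act_left_tensor: "act_left A (tensor s t) = tensor (A *v s) t"
  by (simp add: act_left_def tensor_def matrix_matrix_mult_def matrix_vector_mult_def vec_eq_iff
      sum_distrib_left sum_distrib_right mult_ac)

lemma act_right_tensor: "act_right B (tensor s t) = tensor s (B *v t)"
  by (simp add: act_right_def tensor_def matrix_matrix_mult_def matrix_vector_mult_def transpose_def
      vec_eq_iff sum_distrib_left sum_distrib_right mult_ac)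

definition complex_algebra_hom :: "(('i::clifford_index, complex) clifford \<Rightarrow> complex^'s^'s) \<Rightarrow> bool" where
  "complex_algebra_hom \<rho> \<longleftrightarrow>
     \<rho> 1 = mat 1 \<and>
     (\<forall>a b. \<rho> (a + b) = \<rho> a + \<rho> b) \<and>
     (\<forall>c a. \<rho> (cl_scale c a) = c *\<^sub>C \<rho> a) \<and>
     (\<forall>a b. \<rho> (a * b) = \<rho> a ** \<rho> b)"

type_synonym ('n, 's) clifford_rep = "('n euclid, complex) clifford \<Rightarrow> complex^'s^'s"

definition rep_vec :: "('n::{finite,linorder}, 's::finite) clifford_rep \<Rightarrow> real^('n::{finite,linorder}) \<Rightarrow> complex^'s^'s" where
  "rep_vec \<rho> x = \<rho> (complexify (euclid_vec x))"

text \<open>$\rho'(x) t' = - t' \circ \rho(x)$ for vectors $x$, extended to an algebra homomorphism.\<close>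

definition dual_rep :: "('n::{finite,linorder}, 's::finite) clifford_rep \<Rightarrow> ('n, 's) clifford_rep \<Rightarrow> bool" where
  "dual_rep \<rho> \<rho>' \<longleftrightarrow>
     complex_algebra_hom \<rho>' \<and>
     (\<forall>x s t. pairing s (rep_vec \<rho>' x *v t) = - pairing (rep_vec \<rho> x *v s) t)"

section \<open>Differential operators\<close>

text \<open>$C^k$ and $C^\infty$ on a whole space.\<close>

primrec C_k :: "nat \<Rightarrow> ('a::real_normed_vector \<Rightarrow> 'b::real_normed_vector) \<Rightarrow> bool" where
  "C_k 0 f \<longleftrightarrow> continuous_on UNIV f"
| "C_k (Suc k) f \<longleftrightarrow>
     (\<forall>x. f differentiable (at x)) \<and> (\<forall>v. C_k k (\<lambda>x. frechet_derivative f (at x) v))"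

definition smooth :: "('a::real_normed_vector \<Rightarrow> 'b::real_normed_vector) \<Rightarrow> bool" where
  "smooth f \<longleftrightarrow> (\<forall>k. C_k k f)"

definition supp :: "('a::topological_space \<Rightarrow> 'b::zero) \<Rightarrow> 'a set" where
  "supp f = closure {x. f x \<noteq> 0}"

definition partial :: "'n \<Rightarrow> (real^'n \<Rightarrow> 'b::real_normed_vector) \<Rightarrow> real^'n \<Rightarrow> 'b" where
  "partial j f x = vector_derivative (\<lambda>t. f (x + t *\<^sub>R axis j 1)) (at 0)"

definition laplace :: "(real^'n \<Rightarrow> 'b::real_normed_vector) \<Rightarrow> real^'n \<Rightarrow> 'b" where
  "laplace f x = (\<Sum>j\<in>UNIV. partial j (partial j f) x)"

definition dirac :: "('n::{finite,linorder}, 's::finite) clifford_rep \<Rightarrow>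
    (real^('n::{finite,linorder}) \<Rightarrow> complex^'s) \<Rightarrow> real^('n::{finite,linorder}) \<Rightarrow> complex^'s" where
  "dirac \<rho> f x = (\<Sum>j\<in>UNIV. rep_vec \<rho> (axis j 1) *v partial j f x)"

text \<open>The same operators acting in the variable $x$ or in the variable $y$ of a function of
  $(x, y)$; the Dirac operators act on $\mathbb S$ and on $\mathbb S'$ respectively.\<close>

definition partial_x :: "'n \<Rightarrow> ((real^'n) \<times> (real^'n) \<Rightarrow> 'b::real_normed_vector) \<Rightarrow> (real^'n) \<times> (real^'n) \<Rightarrow> 'b" where
  "partial_x j F = (\<lambda>(x, y). partial j (\<lambda>x. F (x, y)) x)"

definition partial_y :: "'n \<Rightarrow> ((real^'n) \<times> (real^'n) \<Rightarrow> 'b::real_normed_vector) \<Rightarrow> (real^'n) \<times> (real^'n) \<Rightarrow> 'b" where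
  "partial_y j F = (\<lambda>(x, y). partial j (\<lambda>y. F (x, y)) y)"

definition laplace_x :: "((real^'n) \<times> (real^'n) \<Rightarrow> 'b::real_normed_vector) \<Rightarrow> (real^'n) \<times> (real^'n) \<Rightarrow> 'b" where
  "laplace_x F p = (\<Sum>j\<in>UNIV. partial_x j (partial_x j F) p)"

definition laplace_y :: "((real^'n) \<times> (real^'n) \<Rightarrow> 'b::real_normed_vector) \<Rightarrow> (real^'n) \<times> (real^'n) \<Rightarrow> 'b" where
  "laplace_y F p = (\<Sum>j\<in>UNIV. partial_y j (partial_y j F) p)"

type_synonym ('n, 's) two_var = "(real, 'n) vec \<times> (real, 'n) vec \<Rightarrow> ((complex, 's) vec, 's) vec"

definition dirac_x :: "('n::{finite,linorder}, 's::finite) clifford_rep \<Rightarrow> ('n, 's) two_var \<Rightarrow> ('n, 's) two_var" where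
  "dirac_x \<rho> F p = (\<Sum>j\<in>UNIV. act_left (rep_vec \<rho> (axis j 1)) (partial_x j F p))"

definition dirac_y :: "('n::{finite,linorder}, 's::finite) clifford_rep \<Rightarrow> ('n, 's) two_var \<Rightarrow> ('n, 's) two_var" where
  "dirac_y \<rho>' F p = (\<Sum>j\<in>UNIV. act_right (rep_vec \<rho>' (axis j 1)) (partial_y j F p))"

definition source_operator :: "complex \<Rightarrow> complex \<Rightarrow> ('n::{finite,linorder}, 's::finite) clifford_rep \<Rightarrow>
    ('n, 's) clifford_rep \<Rightarrow> ('n, 's) two_var \<Rightarrow> ('n, 's) two_var" where
  "source_operator lam mu \<rho> \<rho>' F = (\<lambda>(x, y).
     let n = of_nat CARD('n) :: complex;
         e = (\<lambda>j. axis j 1 :: real^('n::{finite,linorder}))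
     in
       complex_of_real ((norm (x - y))\<^sup>2) *\<^sub>C laplace_x (laplace_y F) (x, y)
     + (2 * (2 * lam - n + 1)) *\<^sub>C (\<Sum>j\<in>UNIV. (x $ j - y $ j) *\<^sub>R partial_x j (laplace_y F) (x, y))
     + (2 * (2 * mu - n + 1)) *\<^sub>C (\<Sum>j\<in>UNIV. (y $ j - x $ j) *\<^sub>R laplace_x (partial_y j F) (x, y))
     - 2 *\<^sub>C act_left (rep_vec \<rho> (x - y)) (dirac_x \<rho> (laplace_y F) (x, y))
     - 2 *\<^sub>C act_right (rep_vec \<rho>' (y - x)) (laplace_x (dirac_y \<rho>' F) (x, y))
     + ((2 * mu - n + 1) * (2 * mu + 1)) *\<^sub>C laplace_x F (x, y)
     + ((2 * lam - n + 1) * (2 * lam + 1)) *\<^sub>C laplace_y F (x, y)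
     - (2 * (2 * lam - n + 1) * (2 * mu - n + 1)) *\<^sub>C (\<Sum>j\<in>UNIV. partial_x j (partial_y j F) (x, y))
     + (2 * (2 * lam - n + 1)) *\<^sub>C
         (\<Sum>j\<in>UNIV. act_right (rep_vec \<rho>' (e j)) (partial_x j (dirac_y \<rho>' F) (x, y)))
     + (2 * (2 * mu - n + 1)) *\<^sub>C
         (\<Sum>j\<in>UNIV. act_left (rep_vec \<rho> (e j)) (dirac_x \<rho> (partial_y j F) (x, y)))
     - 2 *\<^sub>C (\<Sum>j\<in>UNIV. act_left (rep_vec \<rho> (e j)) (act_right (rep_vec \<rho>' (e j))
         (dirac_x \<rho> (dirac_y \<rho>' F) (x, y)))))"

text \<open>The linear map with $s \otimes t' \mapsto (s, t')$.\<close>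

definition Psi0 :: "complex^'s^'s \<Rightarrow> complex" where
  "Psi0 T = (\<Sum>i\<in>UNIV. T $ i $ i)"

lemma Psi0_tensor: "Psi0 (tensor s t) = pairing s t"
  by (simp add: Psi0_def tensor_def pairing_def)

definition Psi0_diag :: "('n::finite, 's::finite) two_var \<Rightarrow> real^'n \<Rightarrow> complex" where
  "Psi0_diag F x = Psi0 (F (x, x))"

definition B1 :: "complex \<Rightarrow> complex \<Rightarrow> ('n::{finite,linorder}, 's::finite) clifford_rep \<Rightarrow>
    ('n, 's) clifford_rep \<Rightarrow> ('n, 's) two_var \<Rightarrow> real^('n::{finite,linorder}) \<Rightarrow> complex" where
  "B1 lam mu \<rho> \<rho>' = Psi0_diag \<circ> source_operator lam mu \<rho> \<rho>'"

section \<open>The conformal spin group and its action\<close>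

definition Spin0 :: "('n::{finite,linorder} lorentz, real) clifford set" where
  "Spin0 = {prod_list (map lorentz_vec vs) | vs.
     even (length vs) \<and>
     (\<forall>v\<in>set vs. lorentz_form v v = 1 \<or> lorentz_form v v = -1) \<and>
     even (length (filter (\<lambda>v. lorentz_form v v = -1) vs))}"

definition Spin_n :: "('n::{finite,linorder} euclid, real) clifford set" where
  "Spin_n = {prod_list (map euclid_vec us) | us. even (length us) \<and> (\<forall>u\<in>set us. norm u = 1)}"

definition a_elem :: "real \<Rightarrow> ('n::{finite,linorder} lorentz, real) clifford" where
  "a_elem t = cosh t *\<^sub>R 1 + sinh t *\<^sub>R (gen Time * gen Last)"

definition n_elem :: "real^('n::{finite,linorder}) \<Rightarrow> ('n lorentz, real) clifford" where
  "n_elem y = 1 + (1/2) *\<^sub>R (cl_incl (euclid_vec y) * (gen Time - gen Last))"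

definition nbar_elem :: "real^('n::{finite,linorder}) \<Rightarrow> ('n lorentz, real) clifford" where
  "nbar_elem x = 1 + (1/2) *\<^sub>R (cl_incl (euclid_vec x) * (gen Time + gen Last))"

definition A_group :: "('n::{finite,linorder} lorentz, real) clifford set" where
  "A_group = range a_elem"

definition N_group :: "('n::{finite,linorder} lorentz, real) clifford set" where
  "N_group = range n_elem"

definition chi :: "complex \<Rightarrow> ('n::{finite,linorder} lorentz, real) clifford \<Rightarrow> complex" where
  "chi lam a = exp (2 * complex_of_real (THE t. a = a_elem t) * lam)"

text \<open>$g \overline n_x = \overline n_{x'} m a n$ with $m \in \mathbf M$, $a \in A$, $n \in N$; the
  factors are unique, and \<open>act_point\<close>, \<open>act_m\<close>, \<open>act_a\<close> pick them out.\<close>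

definition factorization :: "('n::{finite,linorder} lorentz, real) clifford \<Rightarrow> real^('n::{finite,linorder}) \<Rightarrow>
    real^('n::{finite,linorder}) \<Rightarrow> ('n euclid, real) clifford \<Rightarrow> ('n lorentz, real) clifford \<Rightarrow> bool" where
  "factorization g x x' m a \<longleftrightarrow>
     m \<in> Spin_n \<and> a \<in> A_group \<and> (\<exists>n\<in>N_group. g * nbar_elem x = nbar_elem x' * cl_incl m * a * n)"

definition act_defined :: "('n::{finite,linorder} lorentz, real) clifford \<Rightarrow> real^('n::{finite,linorder}) \<Rightarrow> bool" where
  "act_defined g x \<longleftrightarrow> (\<exists>x' m a. factorization g x x' m a)"

definition act_point :: "('n::{finite,linorder} lorentz, real) clifford \<Rightarrow> real^('n::{finite,linorder}) \<Rightarrow> real^('n::{finite,linorder})" where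
  "act_point g x = (THE x'. \<exists>m a. factorization g x x' m a)"

definition act_m :: "('n::{finite,linorder} lorentz, real) clifford \<Rightarrow> real^('n::{finite,linorder}) \<Rightarrow> ('n euclid, real) clifford" where
  "act_m g x = (THE m. \<exists>x' a. factorization g x x' m a)"

definition act_a :: "('n::{finite,linorder} lorentz, real) clifford \<Rightarrow> real^('n::{finite,linorder}) \<Rightarrow> ('n lorentz, real) clifford" where
  "act_a g x = (THE a. \<exists>x' m. factorization g x x' m a)"

definition cl_inverse :: "('i::clifford_index, real) clifford \<Rightarrow> ('i, real) clifford" where
  "cl_inverse g = (THE h. g * h = 1 \<and> h * g = 1)"

definition pi_tensor :: "complex \<Rightarrow> complex \<Rightarrow> ('n::{finite,linorder}, 's::finite) clifford_rep \<Rightarrow>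
    ('n, 's) clifford_rep \<Rightarrow> ('n lorentz, real) clifford \<Rightarrow> ('n, 's) two_var \<Rightarrow> ('n, 's) two_var" where
  "pi_tensor lam mu \<rho> \<rho>' g F = (\<lambda>(x, y).
     let h = cl_inverse g in
     if act_defined h x \<and> act_defined h y then
       (inverse (chi lam (act_a h x)) * inverse (chi mu (act_a h y))) *\<^sub>C
         act_left (matrix_inv (\<rho> (complexify (act_m h x))))
           (act_right (matrix_inv (\<rho>' (complexify (act_m h y))))
             (F (act_point h x, act_point h y)))
     else 0)"

definition pi_scalar :: "complex \<Rightarrow> ('n::{finite,linorder} lorentz, real) clifford \<Rightarrow>
    (real^('n::{finite,linorder}) \<Rightarrow> complex) \<Rightarrow> real^('n::{finite,linorder}) \<Rightarrow> complex" where
  "pi_scalar nu g \<phi> x =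
     (let h = cl_inverse g in
      if act_defined h x then inverse (chi nu (act_a h x)) * \<phi> (act_point h x) else 0)"

end

theory Submission
  imports Defs
begin

text \<open>
  On the diagonal the coefficients \<open>x - y\<close> of the source operator vanish.  Hence the value at \<open>x\<close> of
  the operator applied to \<open>F\<close> is a linear form, \<open>jet_form\<close>, in the second derivative of \<open>F\<close> at
  \<open>(x, x)\<close> (lemma \<open>B1_eq_jet_form\<close>).  Smoothness of the result and the formula for \<open>v \<otimes> w'\<close> are read
  off from it.  As \<open>\<rho>'(x)\<close> is minus the transpose of \<open>\<rho>(x)\<close>, the three terms with Dirac operators
  coincide under the pairing up to scalars, and their coefficients add up.

  Covariance is then a statement about germs at one point \<open>x\<^sub>0\<close>.  If \<open>h = g\<inverse>\<close> is defined there,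
  \<open>h nbar(x\<^sub>0) = nbar(b) m a n(y)\<close>, and so \<open>h nbar(x\<^sub>0 + \<xi>) = nbar(b) m a (n(y) nbar(\<xi>))\<close>.  The product in parentheses
  has an explicit factorization (lemma \<open>n_elem_nbar_elem\<close>): with \<open>P = 1 + 2\<langle>\<xi>, y\<rangle> + |\<xi>|\<^sup>2|y|\<^sup>2\<close>, its
  parts are \<open>(\<xi> + |\<xi>|\<^sup>2 y)/P\<close> in \<open>\<real>\<^sup>n\<close>, \<open>(1 - y\<xi>)/\<surd>P\<close> in \<open>Spin(n)\<close> and \<open>a\<^sub>t\<close> with \<open>e\<^bsup>2t\<^esup> = P\<close>.
  Near \<open>x\<^sub>0\<close> every group element thus acts as the composite of a special conformal transformation that
  fixes the origin with derivative \<open>1\<close>, a similarity and translations.  Uniqueness of the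
  factorization (lemma \<open>factorization_unique\<close>) identifies these explicit parts with the ones that
  define the representations.

  Under the similarity \<open>jet_form\<close> is multiplied by the square of the scaling factor, because it is
  built from traces of bilinear forms and conjugation by \<open>\<rho>(m)\<close> rotates the Clifford generators
  (lemma \<open>jet_form_similarity\<close>); this square is the shift by \<open>2\<close> in the weight \<open>\<lambda> + \<mu> + 2\<close>.  The
  special conformal transformation, with its factor of automorphy, changes the second derivative by terms in
  \<open>F\<close> and its first derivative, and the coefficients of the operator are such that these cancel
  in \<open>jet_form\<close> (lemma \<open>jet_form_twist\<close>).

  If \<open>g\<inverse>\<close> is not defined at \<open>x\<^sub>0\<close>, both sides vanish: \<open>g\<close> is continuous where it is defined and maps the
  compact projection of the support to a compact set that does not contain \<open>x\<^sub>0\<close>.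
\<close>

section \<open>Second order jets\<close>

text \<open>
  The first derivative is required on a whole neighbourhood, so that it can be differentiated once
  more; the second derivative \<open>f2 u v\<close> differentiates first along \<open>v\<close> and then along \<open>u\<close>.
  The first derivative is differentiated only pointwise in \<open>v\<close>, the
  form in which \<^const>\<open>smooth\<close> provides it; on finite-dimensional spaces that is enough for a
  chain rule.
\<close>

definition has_jet2 :: "('a::real_normed_vector \<Rightarrow> 'b::real_normed_vector) \<Rightarrow> 'a \<Rightarrow>
    ('a \<Rightarrow> 'b) \<Rightarrow> ('a \<Rightarrow> 'a \<Rightarrow> 'b) \<Rightarrow> bool" where
  "has_jet2 f p f1 f2 \<longleftrightarrow> (\<exists>f'. (\<forall>\<^sub>F q in nhds p. (f has_derivative f' q) (at q)) \<and> f' p = f1 \<and>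
     (\<forall>v. ((\<lambda>q. f' q v) has_derivative (\<lambda>u. f2 u v)) (at p)))"

lemma has_jet2_has_derivative: "has_jet2 f p f1 f2 \<Longrightarrow> (f has_derivative f1) (at p)"
  unfolding has_jet2_def by (auto dest: eventually_nhds_x_imp_x)

lemma has_jet2_bounded_linear:
  "has_jet2 f p f1 f2 \<Longrightarrow> bounded_linear f1"
  "has_jet2 f p f1 f2 \<Longrightarrow> bounded_linear (\<lambda>u. f2 u v)"
  using has_jet2_has_derivative has_derivative_bounded_linear has_jet2_def by metis+

text \<open>
  Linearity in the direction that is differentiated first: near \<open>p\<close> the first derivative is linear,
  and equal functions have equal derivatives.
\<close>

lemma has_jet2_second_linear:
  assumes "has_jet2 f p f1 f2"
  shows "f2 u (a *\<^sub>R v + b *\<^sub>R w) = a *\<^sub>R f2 u v + b *\<^sub>R f2 u w"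
proof -
  obtain f' where f': "\<forall>\<^sub>F q in nhds p. (f has_derivative f' q) (at q)"
    and D: "\<And>v. ((\<lambda>q. f' q v) has_derivative (\<lambda>u. f2 u v)) (at p)"
    using assms unfolding has_jet2_def by blast
  have lin: "f' q (a *\<^sub>R v + b *\<^sub>R w) = a *\<^sub>R f' q v + b *\<^sub>R f' q w"
    if "(f has_derivative f' q) (at q)" for q
    using has_derivative_linear [OF that] by (simp add: linear_add linear_scale)
  have "((\<lambda>q. a *\<^sub>R f' q v + b *\<^sub>R f' q w) has_derivative (\<lambda>u. f2 u (a *\<^sub>R v + b *\<^sub>R w))) (at p)"
    by (rule has_derivative_transform_eventually [OF D])
      (use f' eventually_nhds_x_imp_x [OF f'] in \<open>auto simp: eventually_at_filter lin elim: eventually_mono\<close>)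
  moreover have "((\<lambda>q. a *\<^sub>R f' q v + b *\<^sub>R f' q w) has_derivative
      (\<lambda>u. a *\<^sub>R f2 u v + b *\<^sub>R f2 u w)) (at p)"
    by (intro has_derivative_add has_derivative_scaleR_right D)
  ultimately show ?thesis
    using has_derivative_unique by (metis (no_types, lifting))
qed

lemma has_jet2_bilinear_second:
  assumes "has_jet2 f p f1 f2"
  shows "bilinear f2"
proof -
  have "f2 u (v + w) = f2 u v + f2 u w" "f2 u (c *\<^sub>R v) = c *\<^sub>R f2 u v" for u v w c
    using has_jet2_second_linear [OF assms, of u 1 v 1 w] has_jet2_second_linear [OF assms, of u c v 0 v]
    by simp_all
  then have "linear (f2 u)" for u
    by (intro linearI) auto
  moreover have "linear (\<lambda>u. f2 u v)" for v
    using has_jet2_bounded_linear(2) [OF assms] by (simp add: bounded_linear.linear)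
  ultimately show ?thesis
    by (simp add: bilinear_def)
qed

text \<open>
  A jet depends on the germ of the function only, which is all that is known about a transformed
  function near a point.
\<close>

lemma has_jet2_cong:
  assumes "has_jet2 f p f1 f2" and "\<forall>\<^sub>F q in nhds p. f q = g q"
  shows "has_jet2 g p f1 f2"
proof -
  obtain f' where f': "\<forall>\<^sub>F q in nhds p. (f has_derivative f' q) (at q)" "f' p = f1"
    and D: "\<And>v. ((\<lambda>q. f' q v) has_derivative (\<lambda>u. f2 u v)) (at p)"
    using assms unfolding has_jet2_def by blast
  have "\<forall>\<^sub>F q in nhds p. \<forall>\<^sub>F r in nhds q. f r = g r"
    using assms(2) by (simp add: eventually_eventually)
  then have "\<forall>\<^sub>F q in nhds p. (g has_derivative f' q) (at q)"
    using f'(1)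
  proof eventually_elim
    case (elim q)
    show ?case
      by (rule has_derivative_transform_eventually [OF elim(2)])
        (use elim(1) eventually_nhds_x_imp_x [OF elim(1)] in \<open>auto simp: eventually_at_filter elim: eventually_mono\<close>)
  qed
  with f'(2) D show ?thesis
    unfolding has_jet2_def by blast
qed

lemma has_jet2_affine:
  assumes "bounded_linear L"
  shows "has_jet2 (\<lambda>x. c + L x) p L (\<lambda>u v. 0)"
  unfolding has_jet2_def
  by (rule exI [where x = "\<lambda>_. L"])
    (auto intro!: derivative_eq_intros bounded_linear.has_derivative [OF assms] always_eventually)

lemma has_jet2_linear: "bounded_linear L \<Longrightarrow> has_jet2 L p L (\<lambda>u v. 0)"
  using has_jet2_affine [of L 0] by simp

lemma has_jet2_const: "has_jet2 (\<lambda>x. c) p (\<lambda>v. 0) (\<lambda>u v. 0)"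
  using has_jet2_affine [OF bounded_linear_zero] by simp

lemma has_jet2_add:
  assumes "has_jet2 f p f1 f2" and "has_jet2 g p g1 g2"
  shows "has_jet2 (\<lambda>q. f q + g q) p (\<lambda>v. f1 v + g1 v) (\<lambda>u v. f2 u v + g2 u v)"
proof -
  obtain f' g' where "\<forall>\<^sub>F q in nhds p. (f has_derivative f' q) (at q)" "f' p = f1"
    "\<And>v. ((\<lambda>q. f' q v) has_derivative (\<lambda>u. f2 u v)) (at p)"
    "\<forall>\<^sub>F q in nhds p. (g has_derivative g' q) (at q)" "g' p = g1"
    "\<And>v. ((\<lambda>q. g' q v) has_derivative (\<lambda>u. g2 u v)) (at p)"
    using assms unfolding has_jet2_def by blast
  then show ?thesis
    unfolding has_jet2_def
    by (intro exI [where x = "\<lambda>q v. f' q v + g' q v"])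
      (auto intro!: has_derivative_add elim: eventually_elim2)
qed

lemma has_jet2_bilinear:
  assumes B: "bounded_bilinear B" and f: "has_jet2 f p f1 f2" and g: "has_jet2 g p g1 g2"
  shows "has_jet2 (\<lambda>q. B (f q) (g q)) p (\<lambda>v. B (f1 v) (g p) + B (f p) (g1 v))
    (\<lambda>u v. B (f2 u v) (g p) + B (f1 v) (g1 u) + B (f1 u) (g1 v) + B (f p) (g2 u v))"
proof -
  obtain f' g' where *: "\<forall>\<^sub>F q in nhds p. (f has_derivative f' q) (at q)" "f' p = f1"
    "\<And>v. ((\<lambda>q. f' q v) has_derivative (\<lambda>u. f2 u v)) (at p)"
    "\<forall>\<^sub>F q in nhds p. (g has_derivative g' q) (at q)" "g' p = g1"
    "\<And>v. ((\<lambda>q. g' q v) has_derivative (\<lambda>u. g2 u v)) (at p)"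
    using f g unfolding has_jet2_def by blast
  note f1 = has_jet2_has_derivative [OF f] and g1 = has_jet2_has_derivative [OF g]
  have "\<forall>\<^sub>F q in nhds p. ((\<lambda>q. B (f q) (g q)) has_derivative
      (\<lambda>v. B (f' q v) (g q) + B (f q) (g' q v))) (at q)"
    using *(1,4)
  proof eventually_elim
    case (elim q)
    show ?case
      using bounded_bilinear.FDERIV [OF B elim] by (simp add: add.commute)
  qed
  moreover have "((\<lambda>q. B (f' q v) (g q) + B (f q) (g' q v)) has_derivative
      (\<lambda>u. B (f2 u v) (g p) + B (f1 v) (g1 u) + B (f1 u) (g1 v) + B (f p) (g2 u v))) (at p)" for v
    using has_derivative_add [OF bounded_bilinear.FDERIV [OF B *(3) g1] bounded_bilinear.FDERIV [OF B f1 *(6)], of v v]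
      *(2,5) by (simp add: add_ac)
  ultimately show ?thesis
    unfolding has_jet2_def using *(2,5)
    by (intro exI [where x = "\<lambda>q v. B (f' q v) (g q) + B (f q) (g' q v)"]) auto
qed

text \<open>
  The derivative of the composite is \<open>g'(f q)(f' q v)\<close>, where the point and the direction both move.
  Expanding the direction in a basis reduces this to products of functions whose derivatives are
  known.
\<close>

lemma has_jet2_compose:
  fixes f :: "'a::real_normed_vector \<Rightarrow> 'b::euclidean_space" and g :: "'b \<Rightarrow> 'c::real_normed_vector"
  assumes f: "has_jet2 f p f1 f2" and g: "has_jet2 g (f p) g1 g2"
  shows "has_jet2 (\<lambda>q. g (f q)) p (\<lambda>v. g1 (f1 v)) (\<lambda>u v. g2 (f1 u) (f1 v) + g1 (f2 u v))"
proof -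
  obtain f' g' where *: "\<forall>\<^sub>F q in nhds p. (f has_derivative f' q) (at q)" "f' p = f1"
    "\<And>v. ((\<lambda>q. f' q v) has_derivative (\<lambda>u. f2 u v)) (at p)"
    "\<forall>\<^sub>F q in nhds (f p). (g has_derivative g' q) (at q)" "g' (f p) = g1"
    "\<And>v. ((\<lambda>q. g' q v) has_derivative (\<lambda>u. g2 u v)) (at (f p))"
    using f g unfolding has_jet2_def by blast
  note f1 = has_jet2_has_derivative [OF f] and g1 = has_jet2_has_derivative [OF g]
  have "filterlim f (nhds (f p)) (nhds p)"
    using has_derivative_continuous [OF f1] by (simp add: continuous_at tendsto_at_iff_tendsto_nhds)
  then have near: "\<forall>\<^sub>F q in nhds p. (g has_derivative g' (f q)) (at (f q))"
    using *(4) by (rule eventually_compose_filterlim [rotated])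
  have expand: "L w = (\<Sum>b\<in>Basis. (w \<bullet> b) *\<^sub>R L b)" if "linear L" for L :: "'b \<Rightarrow> 'c" and w
    using linear_sum [OF that, of "\<lambda>b. (w \<bullet> b) *\<^sub>R b" Basis]
    by (simp add: linear_scale [OF that] euclidean_representation)
  have "\<forall>\<^sub>F q in nhds p. ((\<lambda>q. g (f q)) has_derivative (\<lambda>v. g' (f q) (f' q v))) (at q)"
    using *(1) near by eventually_elim (rule has_derivative_compose)
  moreover have "((\<lambda>q. g' (f q) (f' q v)) has_derivative (\<lambda>u. g2 (f1 u) (f1 v) + g1 (f2 u v))) (at p)" for v
  proof (rule has_derivative_transform_eventually)
    have "((\<lambda>q. \<Sum>b\<in>Basis. (f' q v \<bullet> b) *\<^sub>R g' (f q) b) has_derivative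
       (\<lambda>u. \<Sum>b\<in>Basis. (f1 v \<bullet> b) *\<^sub>R g2 (f1 u) b + (f2 u v \<bullet> b) *\<^sub>R g1 b)) (at p)"
      using has_derivative_scaleR [OF has_derivative_inner_left [OF *(3)] has_derivative_compose [OF f1 *(6)]] *(2,5)
      by (intro has_derivative_sum) simp
    moreover have "linear (g2 w)" for w
      using has_jet2_bilinear_second [OF g] by (simp add: bilinear_def)
    moreover have "linear g1"
      using has_jet2_bounded_linear(1) [OF g] by (simp add: bounded_linear.linear)
    ultimately show "((\<lambda>q. \<Sum>b\<in>Basis. (f' q v \<bullet> b) *\<^sub>R g' (f q) b) has_derivative
       (\<lambda>u. g2 (f1 u) (f1 v) + g1 (f2 u v))) (at p)"
      by (simp add: sum.distrib expand [symmetric])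
    have "\<forall>\<^sub>F q in nhds p. (\<Sum>b\<in>Basis. (f' q v \<bullet> b) *\<^sub>R g' (f q) b) = g' (f q) (f' q v)"
      using near by eventually_elim (simp add: expand [symmetric] has_derivative_linear)
    then show "\<forall>\<^sub>F q in at p. (\<Sum>b\<in>Basis. (f' q v \<bullet> b) *\<^sub>R g' (f q) b) = g' (f q) (f' q v)"
      and "(\<Sum>b\<in>Basis. (f' p v \<bullet> b) *\<^sub>R g' (f p) b) = g' (f p) (f' p v)"
      by (auto simp: eventually_at_filter elim: eventually_mono dest: eventually_nhds_x_imp_x)
  qed auto
  ultimately show ?thesis
    unfolding has_jet2_def using *(2,5) by (intro exI [where x = "\<lambda>q v. g' (f q) (f' q v)"]) auto
qed

section \<open>Smooth functions\<close>

lemma smooth_differentiable: "smooth f \<Longrightarrow> f differentiable (at x)"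
  unfolding smooth_def by (metis C_k.simps(2))

lemma smooth_frechet_derivative: "smooth f \<Longrightarrow> smooth (\<lambda>x. frechet_derivative f (at x) v)"
  unfolding smooth_def by (metis C_k.simps(2))

lemma has_jet2_smooth:
  assumes "smooth f"
  shows "has_jet2 f p (frechet_derivative f (at p))
    (\<lambda>u v. frechet_derivative (\<lambda>q. frechet_derivative f (at q) v) (at p) u)"
proof -
  have "(f has_derivative frechet_derivative f (at q)) (at q)" for q
    using smooth_differentiable [OF assms] by (simp add: frechet_derivative_works)
  moreover have "((\<lambda>q. frechet_derivative f (at q) v) has_derivative
      frechet_derivative (\<lambda>q. frechet_derivative f (at q) v) (at p)) (at p)" for v
    using smooth_differentiable [OF smooth_frechet_derivative [OF assms]]
    by (simp add: frechet_derivative_works)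
  ultimately show ?thesis
    unfolding has_jet2_def by (intro exI [where x = "\<lambda>q. frechet_derivative f (at q)"]) auto
qed

lemma C_k_compose_linear:
  assumes "bounded_linear L"
  shows "C_k k f \<Longrightarrow> C_k k (\<lambda>x. f (L x))"
proof (induction k arbitrary: f)
  case 0
  then show ?case
    using bounded_linear.continuous_on [OF assms continuous_on_id] continuous_on_compose2 by fastforce
next
  case (Suc k)
  have D: "((\<lambda>x. f (L x)) has_derivative (\<lambda>v. frechet_derivative f (at (L x)) (L v))) (at x)" for x
    using Suc.prems bounded_linear_imp_has_derivative [OF assms]
    by (auto intro: has_derivative_compose simp: frechet_derivative_works)
  then have "frechet_derivative (\<lambda>x. f (L x)) (at x) v = frechet_derivative f (at (L x)) (L v)" for x v
    by (metis frechet_derivative_at)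
  moreover have "C_k k (\<lambda>x. frechet_derivative f (at (L x)) (L v))" for v
    using Suc.IH [of "\<lambda>x. frechet_derivative f (at x) (L v)"] Suc.prems by simp
  ultimately show ?case
    using differentiableI [OF D] by simp
qed

lemma C_k_linear_compose:
  assumes "bounded_linear L"
  shows "C_k k f \<Longrightarrow> C_k k (\<lambda>x. L (f x))"
proof (induction k arbitrary: f)
  case 0
  then show ?case
    by (simp add: bounded_linear.continuous_on [OF assms])
next
  case (Suc k)
  have D: "((\<lambda>x. L (f x)) has_derivative (\<lambda>v. L (frechet_derivative f (at x) v))) (at x)" for x
    using Suc.prems by (auto intro: bounded_linear.has_derivative [OF assms] simp: frechet_derivative_works)
  then have "frechet_derivative (\<lambda>x. L (f x)) (at x) v = L (frechet_derivative f (at x) v)" for x v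
    by (metis frechet_derivative_at)
  with Suc D show ?case
    by (auto simp: differentiable_def)
qed

lemma C_k_add: "C_k k f \<Longrightarrow> C_k k g \<Longrightarrow> C_k k (\<lambda>x. f x + g x)"
proof (induction k arbitrary: f g)
  case 0
  then show ?case
    by (simp add: continuous_on_add)
next
  case (Suc k)
  then have D: "((\<lambda>x. f x + g x) has_derivative
      (\<lambda>v. frechet_derivative f (at x) v + frechet_derivative g (at x) v)) (at x)" for x
    by (intro has_derivative_add) (auto simp: frechet_derivative_works)
  then have "frechet_derivative (\<lambda>x. f x + g x) (at x) v
      = frechet_derivative f (at x) v + frechet_derivative g (at x) v" for x v
    by (metis frechet_derivative_at)
  with Suc D show ?case
    by (auto simp: differentiable_def)
qed

lemma C_k_zero: "C_k k (\<lambda>x. 0)"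
  by (induction k) (auto simp: frechet_derivative_const)

lemma smooth_compose_linear: "bounded_linear L \<Longrightarrow> smooth f \<Longrightarrow> smooth (\<lambda>x. f (L x))"
  by (simp add: smooth_def C_k_compose_linear)

lemma smooth_linear_compose: "bounded_linear L \<Longrightarrow> smooth f \<Longrightarrow> smooth (\<lambda>x. L (f x))"
  by (simp add: smooth_def C_k_linear_compose)

lemma smooth_add: "smooth f \<Longrightarrow> smooth g \<Longrightarrow> smooth (\<lambda>x. f x + g x)"
  by (simp add: smooth_def C_k_add)

lemma smooth_sum: "(\<And>i. i \<in> I \<Longrightarrow> smooth (f i)) \<Longrightarrow> smooth (\<lambda>x. \<Sum>i\<in>I. f i x)"
  by (induction I rule: infinite_finite_induct) (auto simp: smooth_add, auto simp: smooth_def C_k_zero)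

section \<open>Matrices and representations\<close>

lemma bounded_linear_euclidean: "linear (f :: 'a::euclidean_space \<Rightarrow> 'b::real_normed_vector) \<Longrightarrow> bounded_linear f"
  by (rule linear_conv_bounded_linear [THEN iffD1])

lemma Psi0_simps [simp]:
  "Psi0 0 = 0" "Psi0 (S + T) = Psi0 S + Psi0 T" "Psi0 (S - T) = Psi0 S - Psi0 T"
  "Psi0 (- T) = - Psi0 T" "Psi0 (c *\<^sub>C T) = c * Psi0 T" "Psi0 (r *\<^sub>R T) = of_real r * Psi0 T"
  by (simp_all add: Psi0_def cmul_def map_matrix_def sum.distrib sum_subtractf sum_negf sum_distrib_left
      vector_scaleR_component scaleR_conv_of_real [where 'a = complex])

lemma linear_Psi0: "linear Psi0"
  by (intro linearI) (auto simp: scaleR_conv_of_real [where 'a = complex])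

lemma Psi0_sum: "Psi0 (sum f A) = (\<Sum>i\<in>A. Psi0 (f i))"
  by (rule linear_sum [OF linear_Psi0])

lemma Psi0_commute: "Psi0 (A ** B) = Psi0 (B ** A)"
  unfolding Psi0_def matrix_matrix_mult_def
  by (simp, subst sum.swap) (simp add: mult.commute)

text \<open>
  Matrix products, complex multiples of matrices, the tensor product and the pairing are bilinear over
  the reals, which gives the product rule for jets and the manipulation of sums.
\<close>

lemma bounded_bilinear_matrix_mult: "bounded_bilinear ((**) :: complex^'s^'s \<Rightarrow> complex^'s^'s \<Rightarrow> complex^'s^'s)"
  unfolding bilinear_conv_bounded_bilinear [symmetric] bilinear_def
  by (auto intro!: linearI simp: matrix_matrix_mult_def
      vec_eq_iff scaleR_sum_right algebra_simps sum.distrib)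

interpretation mm: bounded_bilinear "(**) :: complex^'s^'s \<Rightarrow> complex^'s^'s \<Rightarrow> complex^'s^'s"
  by (rule bounded_bilinear_matrix_mult)

lemma bounded_bilinear_cmul: "bounded_bilinear ((*\<^sub>C) :: complex \<Rightarrow> complex^'s^'s \<Rightarrow> complex^'s^'s)"
  unfolding bilinear_conv_bounded_bilinear [symmetric] bilinear_def
  by (auto intro!: linearI simp: cmul_def map_matrix_def vec_eq_iff algebra_simps)

interpretation cm: bounded_bilinear "(*\<^sub>C) :: complex \<Rightarrow> complex^'s^'s \<Rightarrow> complex^'s^'s"
  by (rule bounded_bilinear_cmul)

lemma bounded_bilinear_tensor: "bounded_bilinear (tensor :: complex^'s \<Rightarrow> complex^'s \<Rightarrow> complex^'s^'s)"
  unfolding bilinear_conv_bounded_bilinear [symmetric] bilinear_def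
  by (auto intro!: linearI simp: tensor_def vec_eq_iff algebra_simps)

lemma bounded_bilinear_pairing: "bounded_bilinear (pairing :: complex^'s \<Rightarrow> complex^'s \<Rightarrow> complex)"
  unfolding bilinear_conv_bounded_bilinear [symmetric] bilinear_def
  by (auto intro!: linearI simp: pairing_def vec_eq_iff algebra_simps sum.distrib scaleR_sum_right)

interpretation pr: bounded_bilinear "pairing :: complex^'s \<Rightarrow> complex^'s \<Rightarrow> complex"
  by (rule bounded_bilinear_pairing)

lemma cmul_matrix_mult: "(c *\<^sub>C A) ** B = c *\<^sub>C (A ** B)" "A ** (c *\<^sub>C B) = c *\<^sub>C (A ** B)"
  by (simp_all add: cmul_def map_matrix_def matrix_matrix_mult_def vec_eq_iff sum_distrib_left mult_ac)

lemma cmul_cmul: "c *\<^sub>C d *\<^sub>C A = (c * d) *\<^sub>C A"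
  by (simp add: cmul_def map_matrix_def vec_eq_iff mult_ac)

lemma cmul_of_real: "of_real r *\<^sub>C A = r *\<^sub>R A"
  by (simp add: cmul_def map_matrix_def vec_eq_iff scaleR_conv_of_real [where 'a = complex])

lemma coef_sum: "coef (sum f A) I = (\<Sum>j\<in>A. coef (f j) I)"
  for f :: "'a \<Rightarrow> ('i::clifford_index, 'k::comm_ring_1) clifford"
  by (induction A rule: infinite_finite_induct) auto

lemma complexify_simps:
  "complexify (1 :: ('i::clifford_index, real) clifford) = 1"
  "complexify (a + b) = complexify a + complexify (b :: ('i::clifford_index, real) clifford)"
  "complexify (a * b) = complexify a * complexify b"
  "complexify (r *\<^sub>R a) = cl_scale (of_real r) (complexify a)"
  by (rule clifford_eqI, simp add: complexify_def cl_scale_def coef_times of_real_sum if_distrib [of complex_of_real] cong: if_cong)+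

text \<open>
  The restriction of the representation to the real Clifford algebra, where the spin group lives.
\<close>

definition crep :: "('n::{finite,linorder}, 's::finite) clifford_rep \<Rightarrow> ('n euclid, real) clifford \<Rightarrow> complex^'s^'s" where
  "crep \<rho> a = \<rho> (complexify a)"

lemma crep_vec: "crep \<rho> (euclid_vec x) = rep_vec \<rho> x"
  by (simp add: crep_def rep_vec_def)

lemma crep_hom:
  assumes "complex_algebra_hom \<rho>"
  shows "crep \<rho> 1 = mat 1" "crep \<rho> (a + b) = crep \<rho> a + crep \<rho> b"
    "crep \<rho> (a * b) = crep \<rho> a ** crep \<rho> b" "crep \<rho> (r *\<^sub>R a) = r *\<^sub>R crep \<rho> a"
  using assms by (auto simp: crep_def complex_algebra_hom_def complexify_simps cmul_of_real)

lemma linear_crep: "complex_algebra_hom \<rho> \<Longrightarrow> linear (crep \<rho>)"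
  by (intro linearI) (auto simp: crep_hom)

lemma linear_euclid_vec: "linear euclid_vec"
  by (intro linearI) (auto simp: euclid_vec_def scaleR_add_left sum.distrib scaleR_sum_right)

lemma linear_rep_vec: "complex_algebra_hom \<rho> \<Longrightarrow> linear (rep_vec \<rho>)"
  using linear_compose [OF linear_euclid_vec linear_crep] by (simp add: o_def crep_vec)

lemma rep_vec_anticommute:
  assumes "complex_algebra_hom \<rho>"
  shows "rep_vec \<rho> x ** rep_vec \<rho> y + rep_vec \<rho> y ** rep_vec \<rho> x = (- 2 * (x \<bullet> y)) *\<^sub>R mat 1"
  using arg_cong [OF euclid_vec_anticommute [of x y], of "crep \<rho>"]
  by (simp add: crep_hom [OF assms] crep_vec del: mult_minus_left scaleR_minus_left)

lemma euclid_vec_square: "euclid_vec x * euclid_vec x = (- (x \<bullet> x)) *\<^sub>R 1"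
proof -
  have "2 *\<^sub>R (euclid_vec x * euclid_vec x) = 2 *\<^sub>R ((- (x \<bullet> x)) *\<^sub>R (1 :: ('a euclid, real) clifford))"
    using euclid_vec_anticommute [of x x] by (simp add: scaleR_2)
  then show ?thesis
    using real_vector.scale_cancel_left [of 2] by (metis zero_neq_numeral)
qed

lemma rep_vec_square:
  assumes "complex_algebra_hom \<rho>"
  shows "rep_vec \<rho> x ** rep_vec \<rho> x = (- (x \<bullet> x)) *\<^sub>R mat 1"
  using arg_cong [OF euclid_vec_square [of x], of "crep \<rho>"]
  by (simp add: crep_hom [OF assms] crep_vec del: scaleR_minus_left)

lemma dual_rep_pairing: "dual_rep \<rho> \<rho>' \<Longrightarrow> pairing s (rep_vec \<rho>' x *v t) = - pairing (rep_vec \<rho> x *v s) t"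
  by (auto simp: dual_rep_def)

lemma pairing_axis: "pairing (axis i 1) t = t $ i" "pairing s (axis i 1) = s $ i"
  by (simp_all add: pairing_def axis_def if_distrib [of "\<lambda>a. a * _"] if_distrib [of "\<lambda>a. _ * a"] cong: if_cong)

lemma matrix_vector_axis: "(A *v axis i 1) $ j = A $ j $ i" for A :: "complex^'s^'s"
  by (simp add: matrix_vector_mult_def axis_def if_distrib [of "\<lambda>a. _ * a"] cong: if_cong)

text \<open>
  In coordinates the dual representation of a vector is minus the transpose.  Every term with
  \<open>\<rho>'\<close> thereby becomes a matrix product with \<open>\<rho>\<close>, and the pairing becomes a trace.
\<close>

lemma dual_rep_transpose:
  assumes "dual_rep \<rho> \<rho>'"
  shows "transpose (rep_vec \<rho>' x) = - rep_vec \<rho> x"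
  unfolding vec_eq_iff transpose_def
  using dual_rep_pairing [OF assms, of "axis _ 1" x "axis _ 1"]
  by (simp add: pairing_axis matrix_vector_axis)

lemma act_right_dual: "dual_rep \<rho> \<rho>' \<Longrightarrow> act_right (rep_vec \<rho>' x) T = - (T ** rep_vec \<rho> x)"
  by (simp add: act_right_def dual_rep_transpose mm.minus_right)

section \<open>The operator on second order jets\<close>

text \<open>
  The linear form in the second derivatives by which the operator acts at a diagonal point.  Of the
  six kinds of second order terms of the source operator the last three, which contain Dirac
  operators, all have the same trace up to a scalar and are collected in the last sum.
\<close>

definition jet_form :: "complex \<Rightarrow> complex \<Rightarrow> ('n::{finite,linorder}, 's::finite) clifford_rep \<Rightarrow>
    ((real, 'n) vec \<times> (real, 'n) vec \<Rightarrow> (real, 'n) vec \<times> (real, 'n) vec \<Rightarrow> complex^'s^'s) \<Rightarrow> complex" where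
  "jet_form lam mu \<rho> F2 = (let n = of_nat CARD('n) in
      (2 * mu - n + 1) * (2 * mu + 1) * (\<Sum>j\<in>UNIV. Psi0 (F2 (axis j 1, 0) (axis j 1, 0)))
    + (2 * lam - n + 1) * (2 * lam + 1) * (\<Sum>j\<in>UNIV. Psi0 (F2 (0, axis j 1) (0, axis j 1)))
    - 2 * (2 * lam - n + 1) * (2 * mu - n + 1) * (\<Sum>j\<in>UNIV. Psi0 (F2 (axis j 1, 0) (0, axis j 1)))
    + 2 * (2 * lam + 2 * mu - n + 2) * (\<Sum>j\<in>UNIV. \<Sum>k\<in>UNIV.
        Psi0 (rep_vec \<rho> (axis k 1) ** rep_vec \<rho> (axis j 1) ** F2 (axis j 1, 0) (0, axis k 1))))"

lemma partial_has_derivative: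
  assumes "(f has_derivative f') (at x)"
  shows "partial j f x = f' (axis j 1)"
proof -
  have "((\<lambda>t. f (x + t *\<^sub>R axis j 1)) has_derivative (\<lambda>t. f' (t *\<^sub>R axis j 1))) (at 0)"
    by (rule has_derivative_compose [where g = f]) (use assms in \<open>auto intro!: derivative_eq_intros\<close>)
  then have "((\<lambda>t. f (x + t *\<^sub>R axis j 1)) has_vector_derivative f' (axis j 1)) (at 0)"
    using has_derivative_linear [OF assms] by (simp add: has_vector_derivative_def linear_scale)
  then show ?thesis
    unfolding partial_def by (rule vector_derivative_at)
qed

lemma partial_x_has_derivative:
  assumes "(F has_derivative F') (at p)"
  shows "partial_x j F p = F' (axis j 1, 0)"
proof -
  have "((\<lambda>x. F (x, snd p)) has_derivative (\<lambda>v. F' (v, 0))) (at (fst p))"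
    by (rule has_derivative_compose [where g = F]) (use assms in \<open>auto intro!: derivative_eq_intros\<close>)
  from partial_has_derivative [OF this] show ?thesis
    by (simp add: partial_x_def split_beta)
qed

lemma partial_y_has_derivative:
  assumes "(F has_derivative F') (at p)"
  shows "partial_y j F p = F' (0, axis j 1)"
proof -
  have "((\<lambda>y. F (fst p, y)) has_derivative (\<lambda>v. F' (0, v))) (at (snd p))"
    by (rule has_derivative_compose [where g = F]) (use assms in \<open>auto intro!: derivative_eq_intros\<close>)
  from partial_has_derivative [OF this] show ?thesis
    by (simp add: partial_y_def split_beta)
qed

text \<open>
  The directional derivatives that define the operators agree near \<open>p\<close> with the values of the first
  derivative, so that they may be differentiated again.
\<close>

lemma has_jet2_partial:
  assumes "has_jet2 F p F1 F2"
  shows "(partial_x j F has_derivative (\<lambda>u. F2 u (axis j 1, 0))) (at p)"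
    and "(partial_y j F has_derivative (\<lambda>u. F2 u (0, axis j 1))) (at p)"
proof -
  obtain F' where F': "\<forall>\<^sub>F q in nhds p. (F has_derivative F' q) (at q)"
    and D: "\<And>v. ((\<lambda>q. F' q v) has_derivative (\<lambda>u. F2 u v)) (at p)"
    using assms unfolding has_jet2_def by blast
  have x: "\<forall>\<^sub>F q in nhds p. F' q (axis j 1, 0) = partial_x j F q"
    and y: "\<forall>\<^sub>F q in nhds p. F' q (0, axis j 1) = partial_y j F q"
    using F' by (auto elim!: eventually_mono simp: partial_x_has_derivative partial_y_has_derivative)
  show "(partial_x j F has_derivative (\<lambda>u. F2 u (axis j 1, 0))) (at p)"
    by (rule has_derivative_transform_eventually [OF D])
      (use x eventually_nhds_x_imp_x [OF x] in \<open>auto simp: eventually_at_filter elim: eventually_mono\<close>)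
  show "(partial_y j F has_derivative (\<lambda>u. F2 u (0, axis j 1))) (at p)"
    by (rule has_derivative_transform_eventually [OF D])
      (use y eventually_nhds_x_imp_x [OF y] in \<open>auto simp: eventually_at_filter elim: eventually_mono\<close>)
qed

lemma linear_act_right: "linear (act_right A)"
  unfolding act_right_def by (rule bounded_linear.linear [OF mm.bounded_linear_left])

text \<open>
  At a diagonal point the coefficients \<open>x - y\<close> vanish, and with them all terms of order three and
  four.  In the Dirac terms cyclicity of the trace moves the factor coming from \<open>\<rho>'\<close> to the front.
  In the term with \<open>\<rho>(e\<^sub>j) \<otimes> \<rho>'(e\<^sub>j)\<close> the factors \<open>e\<^sub>j\<close> then meet in \<open>e\<^sub>j\<^sup>2 = -1\<close>, so that each
  of the \<open>n\<close> summands gives the same value; this is where the coefficient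
  \<open>2(2\<lambda> + 2\<mu> - 2n + 2 + n)\<close> comes from.
\<close>

lemma B1_eq_jet_form:
  fixes F :: "('n::{finite,linorder}, 's::finite) two_var"
  assumes hom: "complex_algebra_hom \<rho>" and dual: "dual_rep \<rho> \<rho>'" and jet: "has_jet2 F (x, x) F1 F2"
  shows "B1 lam mu \<rho> \<rho>' F x = jet_form lam mu \<rho> F2"
proof -
  note px = partial_x_has_derivative and py = partial_y_has_derivative
  note jx = has_jet2_partial(1) [OF jet] and jy = has_jet2_partial(2) [OF jet]
  let ?E = "\<lambda>j. rep_vec \<rho> (axis j 1)"
  let ?n = "of_nat CARD('n) :: complex"
  let ?D = "\<Sum>j\<in>UNIV. \<Sum>k\<in>UNIV. Psi0 (?E k ** ?E j ** F2 (axis j 1, 0) (0, axis k 1))"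
  have lx: "laplace_x F (x, x) = (\<Sum>j\<in>UNIV. F2 (axis j 1, 0) (axis j 1, 0))"
    by (simp add: laplace_x_def px [OF jx])
  have ly: "laplace_y F (x, x) = (\<Sum>j\<in>UNIV. F2 (0, axis j 1) (0, axis j 1))"
    by (simp add: laplace_y_def py [OF jy])
  have xy: "partial_x i (partial_y j F) (x, x) = F2 (axis i 1, 0) (0, axis j 1)" for i j
    by (rule px [OF jy])
  have "(dirac_y \<rho>' F has_derivative (\<lambda>u. \<Sum>k\<in>UNIV. act_right (rep_vec \<rho>' (axis k 1)) (F2 u (0, axis k 1)))) (at (x, x))"
    unfolding dirac_y_def
    by (intro has_derivative_sum bounded_linear.has_derivative [OF bounded_linear_euclidean [OF linear_act_right]] jy)
  then have xdy: "partial_x i (dirac_y \<rho>' F) (x, x)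
      = - (\<Sum>k\<in>UNIV. F2 (axis i 1, 0) (0, axis k 1) ** ?E k)" for i
    by (simp add: px act_right_dual [OF dual] sum_negf)
  have dx: "dirac_x \<rho> G (x, x) = (\<Sum>k\<in>UNIV. ?E k ** partial_x k G (x, x))" for G
    by (simp add: dirac_x_def act_left_def)
  have z: "act_left (rep_vec \<rho> 0) T = 0" "act_right (rep_vec \<rho>' 0) T = 0" for T
    using linear_0 [OF linear_rep_vec [OF hom]]
    by (simp_all add: act_left_def mm.zero_left act_right_dual [OF dual] mm.zero_right)
  have t10: "(\<Sum>j\<in>UNIV. Psi0 (act_right (rep_vec \<rho>' (axis j 1)) (partial_x j (dirac_y \<rho>' F) (x, x)))) = ?D"
    unfolding act_right_dual [OF dual] xdy
    by (simp add: mm.minus_left mm.sum_left Psi0_sum matrix_mul_assoc [symmetric])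
      (intro sum.cong refl, subst Psi0_commute, simp add: matrix_mul_assoc)
  have t11: "(\<Sum>j\<in>UNIV. Psi0 (act_left (?E j) (dirac_x \<rho> (partial_y j F) (x, x)))) = ?D"
    unfolding act_left_def dx xy
    by (subst sum.swap) (simp add: mm.sum_right Psi0_sum matrix_mul_assoc)
  have "Psi0 (act_left (?E j) (act_right (rep_vec \<rho>' (axis j 1)) (dirac_x \<rho> (dirac_y \<rho>' F) (x, x)))) = - ?D" for j
  proof -
    have "Psi0 (act_left (?E j) (act_right (rep_vec \<rho>' (axis j 1)) T)) = Psi0 T" for T
    proof -
      have "Psi0 (act_left (?E j) (act_right (rep_vec \<rho>' (axis j 1)) T)) = - Psi0 (?E j ** (T ** ?E j))"
        by (simp add: act_right_dual [OF dual] act_left_def mm.minus_right)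
      also have "\<dots> = - Psi0 (T ** (?E j ** ?E j))"
        by (subst Psi0_commute) (simp add: matrix_mul_assoc)
      finally show ?thesis
        by (simp add: rep_vec_square [OF hom] mm.minus_right)
    qed
    moreover have "Psi0 (dirac_x \<rho> (dirac_y \<rho>' F) (x, x)) = - ?D"
      unfolding dx xdy
      by (simp add: mm.minus_right mm.sum_right Psi0_sum sum_negf)
       (intro sum.cong refl, subst Psi0_commute, simp add: matrix_mul_assoc,
         subst Psi0_commute, simp add: matrix_mul_assoc)
    ultimately show ?thesis by simp
  qed
  then have t12: "(\<Sum>j\<in>UNIV. Psi0 (act_left (?E j) (act_right (rep_vec \<rho>' (axis j 1))
      (dirac_x \<rho> (dirac_y \<rho>' F) (x, x))))) = - ?n * ?D"
    by simp
  show ?thesis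
    unfolding B1_def o_def Psi0_diag_def source_operator_def jet_form_def Let_def
    apply (simp add: z cm.zero_right Psi0_sum t10 t11 t12 del: sum_constant)
    apply (simp add: lx ly xy Psi0_sum)
    apply (simp add: algebra_simps)
    done
qed

lemma smooth_Psi0:
  fixes F :: "'a::real_normed_vector \<Rightarrow> complex^'s^'s"
  shows "smooth F \<Longrightarrow> smooth (\<lambda>x. c * Psi0 (A ** F x))"
proof (rule smooth_linear_compose [where L = "\<lambda>T. c * Psi0 (A ** T)"])
  show "bounded_linear (\<lambda>T :: complex^'s^'s. c * Psi0 (A ** T))"
    by (intro bounded_linear_euclidean linearI) (simp_all add: mm.add_right mm.scaleR_right algebra_simps scaleR_conv_of_real [where 'a = complex])
qed

lemma smooth_B1:
  fixes F :: "('n::{finite,linorder}, 's::finite) two_var"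
  assumes "complex_algebra_hom \<rho>" and "dual_rep \<rho> \<rho>'" and F: "smooth F"
  shows "smooth (B1 lam mu \<rho> \<rho>' F)"
proof -
  let ?F2 = "\<lambda>p u v. frechet_derivative (\<lambda>q. frechet_derivative F (at q) v) (at p) u"
  let ?n = "of_nat CARD('n) :: complex"
  have B1: "B1 lam mu \<rho> \<rho>' F = (\<lambda>x. jet_form lam mu \<rho> (?F2 (x, x)))"
    by (rule ext) (rule B1_eq_jet_form [OF assms(1,2) has_jet2_smooth [OF F]])
  have L: "bounded_linear (\<lambda>x. (x, x))"
    by (intro bounded_linear_Pair bounded_linear_ident)
  have s: "smooth (\<lambda>x. c * Psi0 (A ** ?F2 (x, x) u v))" for c A u v
    by (intro smooth_Psi0 smooth_compose_linear [OF L, where f = "\<lambda>p. ?F2 p u v"] smooth_frechet_derivative F)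
  have s1: "smooth (\<lambda>x. c * Psi0 (?F2 (x, x) u v))" for c u v
    using s [of c "mat 1" v u] by simp
  have e: "jet_form lam mu \<rho> G =
      (\<Sum>j\<in>UNIV. ((2 * mu - ?n + 1) * (2 * mu + 1)) * Psi0 (G (axis j 1, 0) (axis j 1, 0)))
    + (\<Sum>j\<in>UNIV. ((2 * lam - ?n + 1) * (2 * lam + 1)) * Psi0 (G (0, axis j 1) (0, axis j 1)))
    + (\<Sum>j\<in>UNIV. (- 2 * (2 * lam - ?n + 1) * (2 * mu - ?n + 1)) * Psi0 (G (axis j 1, 0) (0, axis j 1)))
    + (\<Sum>j\<in>UNIV. \<Sum>k\<in>UNIV. (2 * (2 * lam + 2 * mu - ?n + 2)) *
        Psi0 (rep_vec \<rho> (axis k 1) ** rep_vec \<rho> (axis j 1) ** G (axis j 1, 0) (0, axis k 1)))" for G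
    unfolding jet_form_def Let_def sum_distrib_left [symmetric] by (simp only: mult_minus_left diff_conv_add_uminus)
  show ?thesis
    unfolding B1 e by (intro smooth_add smooth_sum s s1)
qed

text \<open>
  The second derivative of \<open>v \<otimes> w'\<close> in one variable falls on one factor, the mixed one gives a
  tensor product of first derivatives, and \<open>tr(\<rho>(e\<^sub>k) \<rho>(e\<^sub>j) (s \<otimes> t)) = - (\<rho>(e\<^sub>j) s, \<rho>'(e\<^sub>k) t)\<close>.
\<close>

lemma B1_tensor:
  fixes v w :: "real^'n::{finite,linorder} \<Rightarrow> complex^'s::finite"
  assumes hom: "complex_algebra_hom \<rho>" and dual: "dual_rep \<rho> \<rho>'" and v: "smooth v" and w: "smooth w"
  shows "B1 lam mu \<rho> \<rho>' (\<lambda>(x, y). tensor (v x) (w y)) x =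
          (let n = of_nat CARD('n) in
             (2 * mu - n + 1) * (2 * mu + 1) * pairing (laplace v x) (w x)
           + (2 * lam - n + 1) * (2 * lam + 1) * pairing (v x) (laplace w x)
           - 2 * (2 * lam - n + 1) * (2 * mu - n + 1)
               * (\<Sum>j\<in>UNIV. pairing (partial j v x) (partial j w x))
           - 2 * (2 * lam + 2 * mu - n + 2) * pairing (dirac \<rho> v x) (dirac \<rho>' w x))"
proof -
  define v1 v2 w1 w2 where "v1 = frechet_derivative v (at x)"
    and "v2 = (\<lambda>a b. frechet_derivative (\<lambda>q. frechet_derivative v (at q) b) (at x) a)"
    and "w1 = frechet_derivative w (at x)"
    and "w2 = (\<lambda>a b. frechet_derivative (\<lambda>q. frechet_derivative w (at q) b) (at x) a)"
  have v12: "has_jet2 v x v1 v2" and w12: "has_jet2 w x w1 w2"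
    unfolding v1_def v2_def w1_def w2_def using v w by (auto intro: has_jet2_smooth)
  have pd: "partial j f = (\<lambda>x. frechet_derivative f (at x) (axis j 1))" if "smooth f" for j f
    using smooth_differentiable [OF that] partial_has_derivative by (fastforce simp: frechet_derivative_works)
  have vp: "partial j v x = v1 (axis j 1)" "partial j (partial j v) x = v2 (axis j 1) (axis j 1)"
    and wp: "partial j w x = w1 (axis j 1)" "partial j (partial j w) x = w2 (axis j 1) (axis j 1)" for j
    using pd [OF v] pd [OF w] pd [OF smooth_frechet_derivative [OF v]] pd [OF smooth_frechet_derivative [OF w]]
    by (simp_all add: v1_def v2_def w1_def w2_def)
  have v0: "v1 0 = 0" "\<And>b. v2 0 b = 0" "\<And>a. v2 a 0 = 0" and w0: "w1 0 = 0" "\<And>b. w2 0 b = 0" "\<And>a. w2 a 0 = 0"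
    using has_jet2_bounded_linear(1) [OF v12] has_jet2_bounded_linear(1) [OF w12]
      has_jet2_bilinear_second [OF v12] has_jet2_bilinear_second [OF w12]
    by (auto simp: bilinear_lzero bilinear_rzero dest: bounded_linear.linear linear_0)
  note tz = bounded_bilinear.zero_left [OF bounded_bilinear_tensor] bounded_bilinear.zero_right [OF bounded_bilinear_tensor]
  have "has_jet2 (\<lambda>q. tensor (v (fst q)) (w (snd q))) (x, x)
     (\<lambda>a. tensor (v1 (fst a)) (w x) + tensor (v x) (w1 (snd a)))
     (\<lambda>a b. tensor (v2 (fst a) (fst b)) (w x) + tensor (v1 (fst b)) (w1 (snd a))
       + tensor (v1 (fst a)) (w1 (snd b)) + tensor (v x) (w2 (snd a) (snd b)))"
    using has_jet2_bilinear [OF bounded_bilinear_tensor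
       has_jet2_compose [OF has_jet2_linear [OF bounded_linear_fst], of v "(x, x)" v1 v2]
       has_jet2_compose [OF has_jet2_linear [OF bounded_linear_snd], of w "(x, x)" w1 w2]] v12 w12 v0 w0
       has_jet2_bounded_linear(1)
    by (simp add: v0 w0)
  then have B1: "B1 lam mu \<rho> \<rho>' (\<lambda>(x, y). tensor (v x) (w y)) x = jet_form lam mu \<rho>
     (\<lambda>a b. tensor (v2 (fst a) (fst b)) (w x) + tensor (v1 (fst b)) (w1 (snd a))
       + tensor (v1 (fst a)) (w1 (snd b)) + tensor (v x) (w2 (snd a) (snd b)))"
    unfolding split_beta by (rule B1_eq_jet_form [OF hom dual])
  have "Psi0 (rep_vec \<rho> b ** rep_vec \<rho> a ** tensor s t)
      = - pairing (rep_vec \<rho> a *v s) (rep_vec \<rho>' b *v t)" for a b s t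
    by (simp add: act_left_tensor [unfolded act_left_def] Psi0_tensor dual_rep_pairing [OF dual]
        matrix_vector_mul_assoc flip: matrix_mul_assoc)
  then have "(\<Sum>j\<in>UNIV. \<Sum>k\<in>UNIV. Psi0 (rep_vec \<rho> (axis k 1) ** rep_vec \<rho> (axis j 1)
        ** tensor (v1 (axis j 1)) (w1 (axis k 1)))) = - pairing (dirac \<rho> v x) (dirac \<rho>' w x)"
    by (simp add: dirac_def vp wp pr.sum_left pr.sum_right sum_negf) (rule sum.swap)?
  then show ?thesis
    unfolding B1 jet_form_def Let_def
    by (simp add: v0 w0 tz Psi0_tensor laplace_def vp wp pr.sum_left pr.sum_right)
qed

section \<open>The factorization of a product of opposite unipotent elements\<close>

text \<open>
  The factorization of \<open>n(y) nbar(\<xi>)\<close>, isolated from the Clifford algebra: \<open>X\<close>, \<open>Y\<close> stand for two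
  vectors with \<open>X\<^sup>2 = -d\<close>, \<open>Y\<^sup>2 = -c\<close>, and \<open>p\<close>, \<open>q\<close> for the null vectors \<open>e\<^sub>0 \<plusminus> e\<^sub>n\<^sub>+\<^sub>1\<close>.  The
  elements \<open>k = qp/4\<close> and \<open>l = pq/4\<close> are complementary idempotents that commute with \<open>X\<close> and \<open>Y\<close>,
  and with \<open>T = 1 - YX\<close> everything follows from the three relations \<open>\<Phi>T = X\<close>, \<open>TY' = Y\<close> and
  \<open>T/P = 1 + XY'\<close>.
\<close>

lemma bruhat_ring_identity:
  fixes X Y p q :: "'a::real_algebra_1"
  assumes XX: "X * X = - (d *\<^sub>R 1)" and YY: "Y * Y = - (c *\<^sub>R 1)" and XY: "X * Y = (- 2 * e) *\<^sub>R 1 - Y * X"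
    and pp: "p * p = 0" and qq: "q * q = 0" and pq: "p * q + q * p = 4 *\<^sub>R 1"
    and pX: "p * X = - (X * p)" and pY: "p * Y = - (Y * p)" and qX: "q * X = - (X * q)" and qY: "q * Y = - (Y * q)"
    and P: "P = 1 + 2 * e + d * c" "P \<noteq> 0"
  defines "\<Phi> \<equiv> (1 / P) *\<^sub>R (X + d *\<^sub>R Y)" and "Y' \<equiv> (1 / P) *\<^sub>R (Y + c *\<^sub>R X)"
  shows "(1 + (1/2) *\<^sub>R (Y * q)) * (1 + (1/2) *\<^sub>R (X * p))
    = (1 + (1/2) *\<^sub>R (\<Phi> * p)) * (1 - Y * X) * ((1/4) *\<^sub>R (q * p) + (1 / P) *\<^sub>R (1/4) *\<^sub>R (p * q))
      * (1 + (1/2) *\<^sub>R (Y' * q))"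
proof -
  define k l where "k = (1/4) *\<^sub>R (q * p)" and "l = (1/4) *\<^sub>R (p * q)"
  define T where "T = 1 - Y * X"
  define K where "K = k + (1 / P) *\<^sub>R l"
  have kl: "k + l = 1"
    using arg_cong [OF pq, of "\<lambda>a. (1/4) *\<^sub>R a"] by (simp add: k_def l_def scaleR_add_right add.commute)
  have qp: "q * p = 4 *\<^sub>R 1 - p * q" using pq by (simp add: algebra_simps)
  have qpq: "q * (p * q) = 4 *\<^sub>R q" and pqp: "p * (q * p) = 4 *\<^sub>R p"
    using arg_cong [OF pq, of "\<lambda>a. q * a"] arg_cong [OF pq, of "\<lambda>a. p * a"]
    by (simp_all add: distrib_left pp qq mult.assoc [symmetric])
  have kq: "k * q = q" "l * q = 0" and pk: "p * k = p" "p * l = 0"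
    by (simp_all add: k_def l_def mult.assoc qpq pqp qq) (simp add: pp mult.assoc [symmetric])
  then have Kq: "K * q = q" and pK: "p * K = p"
    by (simp_all add: K_def distrib_left distrib_right)
  have kX: "k * X = X * k" "l * X = X * l" and kY: "k * Y = Y * k" "l * Y = Y * l"
    by (simp_all add: k_def l_def mult.assoc pX pY qX qY)
      (simp_all add: pX pY qX qY mult.assoc [symmetric])
  have KX: "K * X = X * K" and KY: "K * Y = Y * K"
    by (simp_all add: K_def distrib_left distrib_right kX kY)
  have KY': "K * Y' = Y' * K"
    by (simp add: Y'_def distrib_left distrib_right KX KY)
  have pY': "p * Y' = - (Y' * p)"
    by (simp add: Y'_def distrib_left distrib_right pX pY scaleR_add_right)
  have pT: "p * T = T * p"
    by (simp add: T_def right_diff_distrib left_diff_distrib mult.assoc [symmetric] pY)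
      (simp add: mult.assoc pX)
  have XYX: "X * Y * X = (- 2 * e) *\<^sub>R X + d *\<^sub>R Y"
    unfolding XY by (simp add: left_diff_distrib mult.assoc XX)
  have YXY: "Y * X * Y = (- 2 * e) *\<^sub>R Y + c *\<^sub>R X"
    by (simp add: mult.assoc XY right_diff_distrib) (simp add: YY mult.assoc [symmetric])
  have "(X + d *\<^sub>R Y) * T = P *\<^sub>R X"
    unfolding T_def using XYX YY
    by (simp add: P right_diff_distrib distrib_right mult.assoc [symmetric])
     (simp add: algebra_simps)
  then have \<Phi>T: "\<Phi> * T = X"
    using P by (simp add: \<Phi>_def)
  have "T * (Y + c *\<^sub>R X) = P *\<^sub>R Y"
    unfolding T_def using YXY
    by (simp add: P left_diff_distrib distrib_left mult.assoc [symmetric])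
      (simp add: mult.assoc XX algebra_simps)
  then have TY': "T * Y' = Y"
    using P by (simp add: Y'_def)
  \<comment> \<open>The left-hand side is \<open>1 - (XY + YX) + cd\<close>.\<close>
  have "T - X * (Y + c *\<^sub>R X) = P *\<^sub>R 1"
    unfolding T_def P(1) by (simp add: distrib_left XY XX scaleR_add_left mult.commute)
  then have "(1 / P) *\<^sub>R (T - X * (Y + c *\<^sub>R X)) = (1 / P) *\<^sub>R P *\<^sub>R 1" by simp
  then have TXY': "(1 / P) *\<^sub>R T = 1 + X * Y'"
    using P(2) by (simp add: Y'_def scaleR_diff_right algebra_simps)
  have "(1 + (1/2) *\<^sub>R (\<Phi> * p)) * T * K * (1 + (1/2) *\<^sub>R (Y' * q))
      = T * K + (1/2) *\<^sub>R (T * (K * Y') * q) + (1/2) *\<^sub>R (\<Phi> * (p * T) * K)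
        + (1/4) *\<^sub>R (\<Phi> * (p * T) * (K * Y') * q)"
    by (simp add: distrib_left distrib_right mult.assoc scaleR_add_right)
  also have "\<dots> = T * K + (1/2) *\<^sub>R ((T * Y') * (K * q)) + (1/2) *\<^sub>R ((\<Phi> * T) * (p * K))
        + (1/4) *\<^sub>R ((\<Phi> * T) * (p * Y') * (K * q))"
  proof -
    have "T * (K * Y') * q = (T * Y') * (K * q)" "\<Phi> * (p * T) * K = (\<Phi> * T) * (p * K)"
      "\<Phi> * (p * T) * (K * Y') * q = (\<Phi> * T) * (p * Y') * (K * q)"
      by (simp_all only: pT KY' mult.assoc)
    then show ?thesis by simp
  qed
  also have "\<dots> = T * K + (1/2) *\<^sub>R (Y * q) + (1/2) *\<^sub>R (X * p) - (1/4) *\<^sub>R (X * Y' * p * q)"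
    unfolding TY' \<Phi>T Kq pK pY' by (simp add: mult.assoc)
  also have "(1/4) *\<^sub>R (X * Y' * p * q) = X * Y' * l"
    by (simp add: l_def mult.assoc)
  also have "T * K = T * k + (1 + X * Y') * l"
    unfolding TXY' [symmetric] by (simp add: K_def distrib_left)
  also have "T * k + (1 + X * Y') * l + (1/2) *\<^sub>R (Y * q) + (1/2) *\<^sub>R (X * p) - X * Y' * l
      = (k + l) - Y * X * k + (1/2) *\<^sub>R (Y * q) + (1/2) *\<^sub>R (X * p)"
    by (simp add: T_def algebra_simps)
  also have "\<dots> = (1 + (1/2) *\<^sub>R (Y * q)) * (1 + (1/2) *\<^sub>R (X * p))"
  proof -
    have "(1/4) *\<^sub>R (Y * q * (X * p)) = - (Y * X * k)"
      unfolding k_def by (simp add: mult.assoc) (simp add: qX mult.assoc [symmetric])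
    then have "(1/4) *\<^sub>R (Y * (q * (X * p))) = - (Y * (X * k))"
      by (simp add: mult.assoc)
    then show ?thesis
      unfolding kl by (simp add: distrib_left distrib_right mult.assoc scaleR_add_right)
  qed
  finally show ?thesis
    unfolding T_def K_def k_def l_def by simp
qed

text \<open>
  The isotropic vectors on which \<open>A\<close> acts by scaling; \<open>N\<close> fixes the second one.
\<close>

definition null_plus :: "('n::{finite,linorder} lorentz, real) clifford" ("\<epsilon>\<^sub>+") where
  "\<epsilon>\<^sub>+ = gen Time + gen Last"

definition null_minus :: "('n::{finite,linorder} lorentz, real) clifford" ("\<epsilon>\<^sub>-") where
  "\<epsilon>\<^sub>- = gen Time - gen Last"

abbreviation space_vec :: "real^('n::{finite,linorder}) \<Rightarrow> ('n lorentz, real) clifford" where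
  "space_vec x \<equiv> cl_incl (euclid_vec x)"

lemma gen_time_last:
  "gen Time * gen Time = (1 :: ('n::{finite,linorder} lorentz, real) clifford)"
  "gen Last * gen Last = (- 1 :: ('n::{finite,linorder} lorentz, real) clifford)"
  "gen Last * gen Time = - (gen Time * gen Last :: ('n::{finite,linorder} lorentz, real) clifford)"
proof -
  have half: "a = b" if "a + a = b + b" for a b :: "('n lorentz, real) clifford"
    using that by (simp flip: scaleR_2)
  show "gen Time * gen Time = (1 :: ('n lorentz, real) clifford)"
    using gen_anticommute [of "Time :: 'n lorentz" Time, where 'k = real] by - (rule half, simp add: qform_lorentz_def)
  show "gen Last * gen Last = (- 1 :: ('n lorentz, real) clifford)"
    using gen_anticommute [of "Last :: 'n lorentz" Last, where 'k = real] by - (rule half, simp add: qform_lorentz_def)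
  show "gen Last * gen Time = - (gen Time * gen Last :: ('n lorentz, real) clifford)"
    using gen_anticommute [of "Last :: 'n lorentz" Time, where 'k = real] by (simp add: eq_neg_iff_add_eq_0)
qed

lemma null_vectors:
  "\<epsilon>\<^sub>+ * \<epsilon>\<^sub>+ = 0" "\<epsilon>\<^sub>- * \<epsilon>\<^sub>- = 0" "\<epsilon>\<^sub>+ * \<epsilon>\<^sub>- + \<epsilon>\<^sub>- * \<epsilon>\<^sub>+ = 4 *\<^sub>R 1"
  by (simp_all add: null_plus_def null_minus_def algebra_simps gen_time_last scaleR_conv_of_real)

lemma space_vec_gen:
  assumes "i = Time \<or> i = Last"
  shows "gen i * space_vec x = - (space_vec x * gen i)"
proof -
  have "gen i * gen (Space j) = - (gen (Space j) * gen i :: ('a lorentz, real) clifford)" for j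
    using gen_anticommute [of i "Space j", where 'k = real] assms by (auto simp: eq_neg_iff_add_eq_0)
  then show ?thesis
    by (simp add: cl_incl_euclid_vec sum_distrib_left sum_distrib_right sum_negf)
qed

lemma null_space_vec:
  "\<epsilon>\<^sub>+ * space_vec x = - (space_vec x * \<epsilon>\<^sub>+)" "\<epsilon>\<^sub>- * space_vec x = - (space_vec x * \<epsilon>\<^sub>-)"
  by (simp_all add: null_plus_def null_minus_def distrib_left distrib_right left_diff_distrib right_diff_distrib space_vec_gen)

lemma linear_cl_incl: "linear cl_incl"
  by (intro linearI) (simp_all add: cl_incl_def scaleR_add_left sum.distrib scaleR_sum_right)

lemma cl_incl_1: "cl_incl 1 = 1"
proof -
  have "cl_incl (1 :: ('a euclid, real) clifford) = (\<Sum>I\<in>UNIV. if I = {} then blade (space_index ` I) else 0)"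
    unfolding cl_incl_def by (intro sum.cong) auto
  moreover have "blade {} = (1 :: ('a lorentz, real) clifford)"
    by (rule clifford_eqI) simp
  ultimately show ?thesis
    by simp
qed

lemmas cl_incl_simps = cl_incl_1 cl_incl_mult linear_add [OF linear_cl_incl] linear_diff [OF linear_cl_incl]
  linear_scale [OF linear_cl_incl]

lemma inj_cl_incl: "inj cl_incl"
proof (rule injI)
  fix a b :: "('a euclid, real) clifford"
  assume eq: "cl_incl a = cl_incl b"
  have "coef (cl_incl c) (space_index ` I) = coef c I" for c :: "('a euclid, real) clifford" and I
  proof -
    have "coef (cl_incl c) (space_index ` I) = (\<Sum>J\<in>UNIV. if J = I then coef c J else 0)"
      unfolding cl_incl_def coef_sum
      by (intro sum.cong) (auto simp: inj_image_eq_iff [OF inj_space_index])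
    then show ?thesis by simp
  qed
  with eq show "a = b"
    by (metis clifford_eqI)
qed

text \<open>
  The difference of two vectors with the same image has square zero, and so length zero.
\<close>

lemma inj_euclid_vec: "inj euclid_vec"
proof (rule injI)
  fix x y :: "(real, 'a) vec"
  assume "euclid_vec x = euclid_vec y"
  then have "euclid_vec (x - y) = 0"
    by (simp add: linear_diff [OF linear_euclid_vec])
  then have "(- ((x - y) \<bullet> (x - y))) *\<^sub>R (1 :: ('a euclid, real) clifford) = 0"
    using euclid_vec_square [of "x - y"] by simp
  then show "x = y" by simp
qed

lemma space_vec_simps:
  "space_vec (x + y) = space_vec x + space_vec y" "space_vec (r *\<^sub>R x) = r *\<^sub>R space_vec x"
  "space_vec (- x) = - space_vec x" "space_vec 0 = 0"
  by (simp_all add: linear_add [OF linear_euclid_vec] linear_scale [OF linear_euclid_vec]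
      linear_neg [OF linear_euclid_vec] linear_0 [OF linear_euclid_vec]
      cl_incl_simps linear_neg [OF linear_cl_incl] linear_0 [OF linear_cl_incl])

text \<open>
  Written with the two idempotents, \<open>A\<close> becomes diagonal.
\<close>

lemma a_elem_null: "a_elem t = (exp t / 4) *\<^sub>R (\<epsilon>\<^sub>- * \<epsilon>\<^sub>+) + (exp (- t) / 4) *\<^sub>R (\<epsilon>\<^sub>+ * \<epsilon>\<^sub>-)"
proof -
  have e: "\<epsilon>\<^sub>- * \<epsilon>\<^sub>+ = 2 *\<^sub>R 1 + 2 *\<^sub>R (gen Time * gen Last :: ('a lorentz, real) clifford)"
    "\<epsilon>\<^sub>+ * \<epsilon>\<^sub>- = 2 *\<^sub>R 1 - 2 *\<^sub>R (gen Time * gen Last :: ('a lorentz, real) clifford)"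
    by (simp_all add: null_plus_def null_minus_def algebra_simps gen_time_last scaleR_2)
  show ?thesis
    unfolding e by (simp add: a_elem_def cosh_field_def sinh_field_def algebra_simps add_divide_distrib diff_divide_distrib)
qed

lemma null_triple: "\<epsilon>\<^sub>- * \<epsilon>\<^sub>+ * \<epsilon>\<^sub>- = 4 *\<^sub>R \<epsilon>\<^sub>-" "\<epsilon>\<^sub>+ * \<epsilon>\<^sub>- * \<epsilon>\<^sub>+ = 4 *\<^sub>R \<epsilon>\<^sub>+"
  using arg_cong [OF null_vectors(3), of "\<lambda>a. a * \<epsilon>\<^sub>-"] arg_cong [OF null_vectors(3), of "\<lambda>a. a * \<epsilon>\<^sub>+"]
  by (simp_all add: distrib_right null_vectors(1,2)) (simp_all add: mult.assoc null_vectors(1,2))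

section \<open>Uniqueness of the factorization\<close>

lemma nbar_elem_null: "nbar_elem x = 1 + (1/2) *\<^sub>R (space_vec x * \<epsilon>\<^sub>+)"
  and n_elem_null: "n_elem y = 1 + (1/2) *\<^sub>R (space_vec y * \<epsilon>\<^sub>-)"
  by (simp_all add: nbar_elem_def n_elem_def null_plus_def null_minus_def)

lemma null_mult_assoc:
  "\<epsilon>\<^sub>+ * (\<epsilon>\<^sub>+ * b) = 0" "\<epsilon>\<^sub>- * (\<epsilon>\<^sub>- * b) = 0"
  "\<epsilon>\<^sub>- * (\<epsilon>\<^sub>+ * \<epsilon>\<^sub>-) = 4 *\<^sub>R \<epsilon>\<^sub>-" "\<epsilon>\<^sub>+ * (\<epsilon>\<^sub>- * \<epsilon>\<^sub>+) = 4 *\<^sub>R \<epsilon>\<^sub>+"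
  "\<epsilon>\<^sub>- * (\<epsilon>\<^sub>+ * (\<epsilon>\<^sub>- * b)) = 4 *\<^sub>R (\<epsilon>\<^sub>- * b)" "\<epsilon>\<^sub>+ * (\<epsilon>\<^sub>- * (\<epsilon>\<^sub>+ * b)) = 4 *\<^sub>R (\<epsilon>\<^sub>+ * b)"
  by (simp_all add: null_vectors null_triple flip: mult.assoc)

lemma null_space_vec_assoc:
  "\<epsilon>\<^sub>+ * (space_vec x * b) = - (space_vec x * (\<epsilon>\<^sub>+ * b))"
  "\<epsilon>\<^sub>- * (space_vec x * b) = - (space_vec x * (\<epsilon>\<^sub>- * b))"
  by (simp_all add: null_space_vec flip: mult.assoc)

lemma a_elem_null_mult:
  "a_elem t * \<epsilon>\<^sub>- = exp t *\<^sub>R \<epsilon>\<^sub>-" "a_elem t * \<epsilon>\<^sub>+ = exp (- t) *\<^sub>R \<epsilon>\<^sub>+"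
  "\<epsilon>\<^sub>- * a_elem t = exp (- t) *\<^sub>R \<epsilon>\<^sub>-" "\<epsilon>\<^sub>+ * a_elem t = exp t *\<^sub>R \<epsilon>\<^sub>+"
  by (simp_all add: a_elem_null distrib_left distrib_right mult.assoc null_mult_assoc null_vectors)

lemma a_elem_add: "a_elem s * a_elem t = a_elem (s + t)"
proof -
  have "a_elem s * a_elem t = (exp t / 4) *\<^sub>R ((a_elem s * \<epsilon>\<^sub>-) * \<epsilon>\<^sub>+) + (exp (- t) / 4) *\<^sub>R ((a_elem s * \<epsilon>\<^sub>+) * \<epsilon>\<^sub>-)"
    unfolding a_elem_null [of t] by (simp add: distrib_left mult.assoc)
  also have "\<dots> = a_elem (s + t)"
    unfolding a_elem_null_mult a_elem_null [of "s + t"]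
    by (simp add: mult_exp_exp add.commute)
  finally show ?thesis .
qed

lemma a_elem_0 [simp]: "a_elem 0 = 1"
  by (simp add: a_elem_def)

lemma null_minus_nonzero: "(\<epsilon>\<^sub>- :: ('n::{finite,linorder} lorentz, real) clifford) \<noteq> 0"
proof
  assume "(\<epsilon>\<^sub>- :: ('n lorentz, real) clifford) = 0"
  then have "4 *\<^sub>R (1 :: ('n lorentz, real) clifford) = 0"
    by (simp flip: null_vectors(3))
  then show False by simp
qed

lemma inj_a_elem: "inj (a_elem :: real \<Rightarrow> ('n::{finite,linorder} lorentz, real) clifford)"
proof (rule injI)
  fix s t assume "a_elem s = (a_elem t :: ('n lorentz, real) clifford)"
  then have "exp s *\<^sub>R \<epsilon>\<^sub>- = exp t *\<^sub>R (\<epsilon>\<^sub>- :: ('n lorentz, real) clifford)"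
    by (metis a_elem_null_mult(1))
  then show "s = t"
    by (simp add: null_minus_nonzero)
qed

lemma chi_a_elem: "chi lam (a_elem t) = exp (2 * of_real t * lam)"
proof -
  have "(THE s. a_elem t = (a_elem s :: ('a::{finite,linorder} lorentz, real) clifford)) = t"
    by (simp add: inj_eq [OF inj_a_elem])
  then show ?thesis by (simp add: chi_def)
qed

lemma commute_euclid_products:
  assumes "\<And>x. p * space_vec x = - (space_vec x * p)"
  shows "p * cl_incl (prod_list (map euclid_vec us)) = (-1) ^ length us *\<^sub>R (cl_incl (prod_list (map euclid_vec us)) * p)"
proof (induction us)
  case (Cons u us)
  have "p * (space_vec u * b) = - (space_vec u * (p * b))" for b
    using assms by (simp flip: mult.assoc)
  with Cons show ?case
    by (simp add: cl_incl_simps mult.assoc)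
qed (simp add: cl_incl_simps)

lemma null_commute_spin:
  assumes "m \<in> Spin_n"
  shows "\<epsilon>\<^sub>+ * cl_incl m = cl_incl m * \<epsilon>\<^sub>+" "\<epsilon>\<^sub>- * cl_incl m = cl_incl m * \<epsilon>\<^sub>-"
    "\<epsilon>\<^sub>+ * (cl_incl m * b) = cl_incl m * (\<epsilon>\<^sub>+ * b)" "\<epsilon>\<^sub>- * (cl_incl m * b) = cl_incl m * (\<epsilon>\<^sub>- * b)"
proof -
  obtain us where "m = prod_list (map euclid_vec us)" "even (length us)"
    using assms by (auto simp: Spin_n_def)
  then show *: "\<epsilon>\<^sub>+ * cl_incl m = cl_incl m * \<epsilon>\<^sub>+" "\<epsilon>\<^sub>- * cl_incl m = cl_incl m * \<epsilon>\<^sub>-"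
    by (simp_all add: commute_euclid_products null_space_vec)
  then show "\<epsilon>\<^sub>+ * (cl_incl m * b) = cl_incl m * (\<epsilon>\<^sub>+ * b)" "\<epsilon>\<^sub>- * (cl_incl m * b) = cl_incl m * (\<epsilon>\<^sub>- * b)"
    by (simp_all flip: mult.assoc)
qed

lemma a_elem_commute_spin: "m \<in> Spin_n \<Longrightarrow> a_elem t * cl_incl m = cl_incl m * a_elem t"
  by (simp add: a_elem_null distrib_left distrib_right mult.assoc null_commute_spin)

lemma a_elem_commute_space: "a_elem t * space_vec x = space_vec x * a_elem t"
  by (simp add: a_elem_null distrib_left distrib_right mult.assoc null_space_vec null_space_vec_assoc)

lemma a_elem_nbar: "a_elem t * nbar_elem x = nbar_elem (exp (- 2 * t) *\<^sub>R x) * a_elem t"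
proof -
  have "a_elem t * (space_vec x * \<epsilon>\<^sub>+) = exp (- t) *\<^sub>R (space_vec x * \<epsilon>\<^sub>+)"
    by (simp add: a_elem_commute_space mult.assoc [symmetric]) (simp add: mult.assoc a_elem_null_mult)
  moreover have "exp (- 2 * t) * exp t = exp (- t)"
    by (simp flip: exp_add)
  ultimately show ?thesis
    by (simp add: nbar_elem_null distrib_left distrib_right space_vec_simps mult.assoc a_elem_null_mult(4))
qed

lemma n_elem_a: "n_elem y * a_elem t = a_elem t * n_elem (exp (- 2 * t) *\<^sub>R y)"
proof -
  have "a_elem t * (space_vec y * \<epsilon>\<^sub>-) = exp t *\<^sub>R (space_vec y * \<epsilon>\<^sub>-)"
    by (simp add: a_elem_commute_space mult.assoc [symmetric]) (simp add: mult.assoc a_elem_null_mult)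
  moreover have "exp (- 2 * t) * exp t = exp (- t)"
    by (simp flip: exp_add)
  ultimately show ?thesis
    by (simp add: n_elem_null distrib_left distrib_right space_vec_simps mult.assoc a_elem_null_mult(3))
qed

lemma nbar_elem_add: "nbar_elem x * nbar_elem y = nbar_elem (x + y)"
proof -
  have "space_vec x * \<epsilon>\<^sub>+ * (space_vec y * \<epsilon>\<^sub>+) = 0"
    by (simp add: mult.assoc null_space_vec_assoc null_vectors)
  then show ?thesis
    by (simp add: nbar_elem_null distrib_left distrib_right space_vec_simps scaleR_add_right add_ac)
qed

lemma n_elem_add: "n_elem x * n_elem y = n_elem (x + y)"
proof -
  have "space_vec x * \<epsilon>\<^sub>- * (space_vec y * \<epsilon>\<^sub>-) = 0"
    by (simp add: mult.assoc null_space_vec_assoc null_vectors)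
  then show ?thesis
    by (simp add: n_elem_null distrib_left distrib_right space_vec_simps scaleR_add_right add_ac)
qed

lemma elem_0 [simp]: "nbar_elem 0 = 1" "n_elem 0 = 1"
  by (simp_all add: nbar_elem_null n_elem_null space_vec_simps)

lemma reflection_orthogonal:
  assumes "norm u = 1"
  shows "orthogonal_transformation (\<lambda>x. x - (2 * (x \<bullet> u)) *\<^sub>R u)"
proof -
  have "u \<bullet> u = 1" using assms by (simp add: norm_eq_1)
  moreover have "linear (\<lambda>x. x - (2 * (x \<bullet> u)) *\<^sub>R u)"
    by (intro linearI) (simp_all add: algebra_simps inner_add_left)
  ultimately show ?thesis
    by (simp add: orthogonal_transformation_def inner_diff_left inner_diff_right inner_commute)
qed

text \<open>
  Conjugation by a unit vector is minus a reflection.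
\<close>

lemma euclid_products_rotate:
  assumes "\<forall>u\<in>set us. norm u = 1"
  shows "\<exists>R. orthogonal_transformation R \<and> (\<forall>x. prod_list (map euclid_vec us) * euclid_vec x
    = (-1) ^ length us *\<^sub>R (euclid_vec (R x) * prod_list (map euclid_vec us)))"
  using assms
proof (induction us)
  case Nil
  show ?case
    by (intro exI [where x = "\<lambda>x. x"]) simp
next
  case (Cons u us)
  then obtain R where R: "orthogonal_transformation R"
    and eq: "prod_list (map euclid_vec us) * euclid_vec x
      = (-1) ^ length us *\<^sub>R (euclid_vec (R x) * prod_list (map euclid_vec us))" for x
    by auto
  let ?S = "\<lambda>x. x - (2 * (x \<bullet> u)) *\<^sub>R u"
  have u: "norm u = 1" using Cons.prems by simp
  have "euclid_vec u * euclid_vec x = (- 2 * (x \<bullet> u)) *\<^sub>R 1 - euclid_vec x * euclid_vec u" for x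
    using euclid_vec_anticommute [of u x] by (simp only: eq_diff_eq inner_commute)
  then have "euclid_vec u * euclid_vec x = - (euclid_vec (?S x) * euclid_vec u)" for x
    using u by (simp add: linear_diff [OF linear_euclid_vec] linear_scale [OF linear_euclid_vec] norm_eq_1
        left_diff_distrib euclid_vec_square)
  then have "euclid_vec u * (euclid_vec x * b) = - (euclid_vec (?S x) * (euclid_vec u * b))" for x b
    by (simp flip: mult.assoc)
  then have "\<forall>x. prod_list (map euclid_vec (u # us)) * euclid_vec x
    = (-1) ^ length (u # us) *\<^sub>R (euclid_vec ((?S \<circ> R) x) * prod_list (map euclid_vec (u # us)))"
    by (simp add: mult.assoc eq)
  with orthogonal_transformation_compose [OF reflection_orthogonal [OF u] R] show ?case
    by blast
qed

lemma spin_rotation: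
  assumes "m \<in> Spin_n"
  obtains R where "orthogonal_transformation R" "\<And>x. m * euclid_vec x = euclid_vec (R x) * m"
  using assms euclid_products_rotate unfolding Spin_n_def by force

lemma spin_one: "1 \<in> Spin_n"
  unfolding Spin_n_def by (auto intro: exI [where x = "[]"])

lemma spin_mult: "m \<in> Spin_n \<Longrightarrow> m' \<in> Spin_n \<Longrightarrow> m * m' \<in> Spin_n"
  unfolding Spin_n_def
proof clarify
  fix us vs :: "((real, 'a) vec) list"
  assume "even (length us)" "even (length vs)" "\<forall>u\<in>set us. norm u = 1" "\<forall>u\<in>set vs. norm u = 1"
  then show "\<exists>ws. prod_list (map euclid_vec us) * prod_list (map euclid_vec vs) = prod_list (map euclid_vec ws)
      \<and> even (length ws) \<and> (\<forall>u\<in>set ws. norm u = 1)"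
    by (intro exI [where x = "us @ vs"]) auto
qed

lemma euclid_products_rev:
  assumes "\<forall>u\<in>set us. norm u = 1"
  shows "prod_list (map euclid_vec us) * prod_list (map euclid_vec (rev us)) = (-1) ^ length us *\<^sub>R 1"
  using assms
proof (induction us)
  case (Cons u us)
  have "prod_list (map euclid_vec (u # us)) * prod_list (map euclid_vec (rev (u # us)))
      = euclid_vec u * (prod_list (map euclid_vec us) * prod_list (map euclid_vec (rev us))) * euclid_vec u"
    by (simp add: mult.assoc)
  also have "\<dots> = (-1) ^ length us *\<^sub>R (euclid_vec u * euclid_vec u)"
    using Cons by simp
  finally show ?case
    using Cons.prems by (simp add: euclid_vec_square norm_eq_1)
qed simp

lemma spin_inverse:
  assumes "m \<in> Spin_n"
  obtains m' where "m' \<in> Spin_n" "m * m' = 1" "m' * m = 1"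
proof -
  obtain us where us: "m = prod_list (map euclid_vec us)" "even (length us)" "\<forall>u\<in>set us. norm u = 1"
    using assms by (auto simp: Spin_n_def)
  let ?m' = "prod_list (map euclid_vec (rev us))"
  have "?m' \<in> Spin_n"
    unfolding Spin_n_def using us by (auto intro!: exI [where x = "rev us"])
  with that [of ?m'] euclid_products_rev [of us] euclid_products_rev [of "rev us"] us show ?thesis
    by simp
qed

lemma det_scaleR_mat_1: "det (r *\<^sub>R mat 1 :: complex^'s^'s) = of_real r ^ CARD('s)"
  by (subst det_diagonal) (auto simp: mat_def scaleR_conv_of_real [where 'a = complex])

text \<open>
  Since \<open>\<rho>(u)\<^sup>2 = -1\<close> for a unit vector, the determinant of \<open>\<rho>(u)\<close> has absolute value one.  This
  separates the compact factor \<open>m\<close> from the scaling factor \<open>e\<^sup>t\<close>.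
\<close>

lemma spin_norm_det:
  assumes hom: "complex_algebra_hom \<rho>" and "m \<in> Spin_n"
  shows "norm (det (crep \<rho> m)) = 1"
proof -
  have "norm (det (crep \<rho> (prod_list (map euclid_vec us)))) = 1" if "\<forall>u\<in>set us. norm u = 1" for us
    using that
  proof (induction us)
    case (Cons u us)
    have "crep \<rho> (euclid_vec u) ** crep \<rho> (euclid_vec u) = (- 1) *\<^sub>R mat 1"
      using rep_vec_square [OF hom, of u] Cons.prems by (simp add: crep_vec norm_eq_1)
    then have "det (crep \<rho> (euclid_vec u)) * det (crep \<rho> (euclid_vec u)) = of_real (- 1) ^ CARD('b)"
      unfolding det_mul [symmetric] by (simp only: det_scaleR_mat_1)
    then have "norm (det (crep \<rho> (euclid_vec u))) * norm (det (crep \<rho> (euclid_vec u))) = 1"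
      unfolding norm_mult [symmetric] by (simp add: norm_power)
    then have "norm (det (crep \<rho> (euclid_vec u))) = 1"
      by (metis norm_ge_zero abs_of_nonneg real_sqrt_abs2 real_sqrt_one)
    with Cons show ?case
      by (simp add: crep_hom [OF hom] det_mul norm_mult)
  qed (simp add: crep_hom [OF hom])
  with assms(2) show ?thesis
    by (auto simp: Spin_n_def)
qed

text \<open>
  If \<open>b\<close> kills \<open>\<epsilon>\<^sub>-\<close> from the left and commutes with \<open>\<epsilon>\<^sub>+\<close> up to a scalar, then it kills both summands of
  \<open>\<epsilon>\<^sub>+ \<epsilon>\<^sub>- + \<epsilon>\<^sub>- \<epsilon>\<^sub>+ = 4\<close>.
\<close>

lemma null_cancel:
  assumes "\<epsilon>\<^sub>+ * b = s *\<^sub>R (b * \<epsilon>\<^sub>+)" "s \<noteq> 0" "b * \<epsilon>\<^sub>- = 0"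
  shows "b = 0"
proof -
  have "s *\<^sub>R (b * \<epsilon>\<^sub>+ * \<epsilon>\<^sub>-) = \<epsilon>\<^sub>+ * b * \<epsilon>\<^sub>-"
    by (simp add: assms(1))
  also have "\<dots> = 0"
    by (simp add: mult.assoc assms(3))
  finally have "b * (\<epsilon>\<^sub>+ * \<epsilon>\<^sub>-) = 0"
    using assms(2) by (simp add: mult.assoc)
  moreover have "b * (\<epsilon>\<^sub>- * \<epsilon>\<^sub>+) = 0"
    by (simp add: assms(3) flip: mult.assoc)
  ultimately have "b * (4 *\<^sub>R 1) = 0"
    unfolding null_vectors(3) [symmetric] by (simp only: distrib_left) simp
  then show ?thesis by simp
qed

text \<open>
  Right multiplication by \<open>\<epsilon>\<^sub>-\<close> removes the factor in \<open>N\<close> and turns \<open>a\<^sub>t\<close> into the number \<open>e\<^sup>t\<close>: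
  the product becomes \<open>e\<^sup>t (m \<epsilon>\<^sub>- + x' m \<epsilon>\<^sub>+ \<epsilon>\<^sub>- / 2)\<close>.  An even and an odd part of the Clifford
  algebra of Euclidean space are thereby separated, so that \<open>e\<^sup>t m\<close> and \<open>e\<^sup>t x' m\<close> are determined.
  Any representation \<open>\<rho>\<close> can then serve to measure the size of \<open>e\<^sup>t m\<close>.
\<close>

lemma factorization_unique:
  fixes g :: "('n::{finite,linorder} lorentz, real) clifford"
    and \<rho> :: "('n, 's::finite) clifford_rep"
  assumes hom: "complex_algebra_hom \<rho>"
    and "factorization g x x1 m1 a1" "factorization g x x2 m2 a2"
  shows "x1 = x2 \<and> m1 = m2 \<and> a1 = a2"
proof -
  have half: "\<exists>t. m \<in> Spin_n \<and> a = a_elem t \<and> g * nbar_elem x * \<epsilon>\<^sub>-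
      = exp t *\<^sub>R (cl_incl m * \<epsilon>\<^sub>-) + (exp t / 2) *\<^sub>R (space_vec x' * cl_incl m * \<epsilon>\<^sub>+ * \<epsilon>\<^sub>-)"
    if fact: "factorization g x x' m a" for x' m a
  proof -
    obtain t y where m: "m \<in> Spin_n" and a: "a = a_elem t"
      and eq: "g * nbar_elem x = nbar_elem x' * cl_incl m * a * n_elem y"
      using fact by (auto simp: factorization_def A_group_def N_group_def)
    have "n_elem y * \<epsilon>\<^sub>- = \<epsilon>\<^sub>-"
      by (simp add: n_elem_null distrib_right mult.assoc null_vectors)
    then have "g * nbar_elem x * \<epsilon>\<^sub>- = exp t *\<^sub>R (nbar_elem x' * cl_incl m * \<epsilon>\<^sub>-)"
      unfolding eq by (simp add: mult.assoc a a_elem_null_mult)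
    also have "\<dots> = exp t *\<^sub>R (cl_incl m * \<epsilon>\<^sub>-) + (exp t / 2) *\<^sub>R (space_vec x' * (\<epsilon>\<^sub>+ * cl_incl m) * \<epsilon>\<^sub>-)"
      by (simp add: nbar_elem_null distrib_right scaleR_add_right mult.assoc)
    finally show ?thesis
      using m a by (auto simp: null_commute_spin [OF m] mult.assoc)
  qed
  obtain s t where m: "m1 \<in> Spin_n" "m2 \<in> Spin_n" and a: "a1 = a_elem s" "a2 = a_elem t"
    and eq: "exp s *\<^sub>R (cl_incl m1 * \<epsilon>\<^sub>-) + (exp s / 2) *\<^sub>R (space_vec x1 * cl_incl m1 * \<epsilon>\<^sub>+ * \<epsilon>\<^sub>-)
      = exp t *\<^sub>R (cl_incl m2 * \<epsilon>\<^sub>-) + (exp t / 2) *\<^sub>R (space_vec x2 * cl_incl m2 * \<epsilon>\<^sub>+ * \<epsilon>\<^sub>-)"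
    using half [OF assms(2)] half [OF assms(3)] by metis
  define \<alpha> \<beta> where "\<alpha> = exp s *\<^sub>R cl_incl m1 - exp t *\<^sub>R cl_incl m2"
    and "\<beta> = (exp s / 2) *\<^sub>R (space_vec x1 * cl_incl m1) - (exp t / 2) *\<^sub>R (space_vec x2 * cl_incl m2)"
  have sum0: "\<alpha> * \<epsilon>\<^sub>- + \<beta> * \<epsilon>\<^sub>+ * \<epsilon>\<^sub>- = 0"
    using eq by (simp add: \<alpha>_def \<beta>_def left_diff_distrib algebra_simps)
  have \<alpha>: "\<epsilon>\<^sub>+ * \<alpha> = \<alpha> * \<epsilon>\<^sub>+" "\<epsilon>\<^sub>- * \<alpha> = \<alpha> * \<epsilon>\<^sub>-"
    by (simp_all add: \<alpha>_def left_diff_distrib right_diff_distrib null_commute_spin m)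
  have "\<epsilon>\<^sub>+ * (space_vec x * cl_incl m) = - (space_vec x * cl_incl m * \<epsilon>\<^sub>+)"
    "\<epsilon>\<^sub>- * (space_vec x * cl_incl m) = - (space_vec x * cl_incl m * \<epsilon>\<^sub>-)" if "m \<in> Spin_n"
      for x :: "(real, 'n) vec" and m
    using that by (simp_all add: null_space_vec_assoc null_commute_spin mult.assoc)
  then have \<beta>: "\<epsilon>\<^sub>+ * \<beta> = - (\<beta> * \<epsilon>\<^sub>+)" "\<epsilon>\<^sub>- * \<beta> = - (\<beta> * \<epsilon>\<^sub>-)"
    using m by (simp_all add: \<beta>_def left_diff_distrib right_diff_distrib)
  \<comment> \<open>Multiplication by \<open>\<epsilon>\<^sub>-\<close> from the left kills the even part \<open>\<alpha> \<epsilon>\<^sub>-\<close>.\<close>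
  have "0 = \<epsilon>\<^sub>- * (\<alpha> * \<epsilon>\<^sub>- + \<beta> * \<epsilon>\<^sub>+ * \<epsilon>\<^sub>-)"
    using sum0 by simp
  also have "\<dots> = (\<epsilon>\<^sub>- * \<alpha>) * \<epsilon>\<^sub>- + (\<epsilon>\<^sub>- * \<beta>) * (\<epsilon>\<^sub>+ * \<epsilon>\<^sub>-)"
    by (simp add: distrib_left mult.assoc)
  also have "\<dots> = (- 4) *\<^sub>R (\<beta> * \<epsilon>\<^sub>-)"
    unfolding \<alpha> \<beta> by (simp add: mult.assoc null_vectors null_mult_assoc)
  finally have "\<beta> * \<epsilon>\<^sub>- = 0" by simp
  then have \<beta>0: "\<beta> = 0"
    using null_cancel [of \<beta> "- 1"] \<beta> by simp
  with sum0 have "\<alpha> = 0"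
    using null_cancel [of \<alpha> 1] \<alpha> by simp
  then have "cl_incl (exp s *\<^sub>R m1) = cl_incl (exp t *\<^sub>R m2)"
    by (simp add: \<alpha>_def cl_incl_simps)
  then have em: "exp s *\<^sub>R m1 = exp t *\<^sub>R m2"
    by (rule injD [OF inj_cl_incl])
  have nd: "norm (det (crep \<rho> (exp r *\<^sub>R m))) = exp r ^ CARD('s)" if "m \<in> Spin_n" for r m
  proof -
    have "exp r *\<^sub>R m = (exp r *\<^sub>R 1) * m" by simp
    then have "crep \<rho> (exp r *\<^sub>R m) = (exp r *\<^sub>R mat 1) ** crep \<rho> m"
      by (metis crep_hom(1,3,4) [OF hom])
    then show ?thesis
      using spin_norm_det [OF hom that] by (simp add: det_mul norm_mult det_scaleR_mat_1 norm_power)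
  qed
  have "exp s ^ CARD('s) = exp t ^ CARD('s)"
    using nd [OF m(1), of s] nd [OF m(2), of t] em by simp
  then have "s = t"
    by (simp add: power_eq_iff_eq_base)
  with em have mm: "m1 = m2" by simp
  from \<open>s = t\<close> mm \<beta>0 have "space_vec x1 * cl_incl m1 = space_vec x2 * cl_incl m1"
    by (simp add: \<beta>_def)
  then have "euclid_vec x1 * m1 = euclid_vec x2 * m1"
    by (intro injD [OF inj_cl_incl]) (simp add: cl_incl_mult)
  moreover obtain m' where "m1 * m' = 1"
    using spin_inverse [OF m(1)] by blast
  then have "b * m1 * m' = b" for b
    by (simp add: mult.assoc)
  ultimately have "euclid_vec x1 = euclid_vec x2"
    by metis
  then have "x1 = x2"
    by (rule injD [OF inj_euclid_vec])
  with mm \<open>s = t\<close> a show ?thesis by simp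
qed

lemma factorization_act:
  fixes g :: "('n::{finite,linorder} lorentz, real) clifford"
    and \<rho> :: "('n, 's::finite) clifford_rep"
  assumes hom: "complex_algebra_hom \<rho>" and "factorization g x x' m a"
  shows "act_defined g x" "act_point g x = x'" "act_m g x = m" "act_a g x = a"
  using assms(2) factorization_unique [OF hom assms(2)]
  unfolding act_defined_def act_point_def act_m_def act_a_def by blast+

section \<open>The local form of the group action\<close>

text \<open>
  The Clifford norm \<open>(1 - y\<xi>)(1 - \<xi>y)\<close>, a real number.
\<close>

definition sct_denom :: "(real, 'n::{finite,linorder}) vec \<Rightarrow> (real, 'n) vec \<Rightarrow> real" where
  "sct_denom y \<xi> = 1 + 2 * (\<xi> \<bullet> y) + (\<xi> \<bullet> \<xi>) * (y \<bullet> y)"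

text \<open>
  The action of \<open>n(y)\<close> on \<open>\<xi>\<close>: the translation by \<open>y\<close> conjugated by the inversion, known as a special
  conformal transformation.
\<close>

definition sct :: "(real, 'n::{finite,linorder}) vec \<Rightarrow> (real, 'n) vec \<Rightarrow> (real, 'n) vec" where
  "sct y \<xi> = (1 / sct_denom y \<xi>) *\<^sub>R (\<xi> + (\<xi> \<bullet> \<xi>) *\<^sub>R y)"

text \<open>
  The \<open>Spin(n)\<close> part of \<open>n(y) nbar(\<xi>)\<close>.
\<close>

definition sct_spin :: "(real, 'n::{finite,linorder}) vec \<Rightarrow> (real, 'n) vec \<Rightarrow> ('n euclid, real) clifford" where
  "sct_spin y \<xi> = (1 / sqrt (sct_denom y \<xi>)) *\<^sub>R (1 - euclid_vec y * euclid_vec \<xi>)"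

text \<open>
  For \<open>\<xi> \<noteq> 0\<close> one has \<open>1 - y\<xi> = (\<xi>\<inverse> - y) \<xi>\<close>, a product of two vectors.
\<close>

lemma sct_spin_in_Spin_n:
  assumes "sct_denom y \<xi> > 0"
  shows "sct_spin y \<xi> \<in> Spin_n"
proof (cases "\<xi> = 0")
  case True
  then show ?thesis
    using spin_one by (simp add: sct_spin_def sct_denom_def linear_0 [OF linear_euclid_vec])
next
  case False
  \<comment> \<open>\<open>w = \<xi>\<inverse> - y\<close>, the inverse being taken in the Clifford algebra.\<close>
  define w where "w = - (1 / (\<xi> \<bullet> \<xi>)) *\<^sub>R \<xi> - y"
  have \<xi>0: "\<xi> \<bullet> \<xi> \<noteq> 0" using False by simp
  have P: "sct_denom y \<xi> = (w \<bullet> w) * (\<xi> \<bullet> \<xi>)"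
    using \<xi>0 by (simp add: sct_denom_def w_def inner_diff_left inner_diff_right inner_commute field_simps)
  with assms have w0: "w \<noteq> 0" by auto
  have "euclid_vec w * euclid_vec \<xi> = 1 - euclid_vec y * euclid_vec \<xi>"
    using \<xi>0 by (simp add: w_def linear_diff [OF linear_euclid_vec] linear_neg [OF linear_euclid_vec]
        linear_scale [OF linear_euclid_vec] left_diff_distrib euclid_vec_square)
  moreover have "sqrt (sct_denom y \<xi>) = norm w * norm \<xi>"
    by (simp add: P real_sqrt_mult norm_eq_sqrt_inner)
  ultimately have "sct_spin y \<xi> = prod_list (map euclid_vec [(1 / norm w) *\<^sub>R w, (1 / norm \<xi>) *\<^sub>R \<xi>])"
    by (simp add: sct_spin_def linear_scale [OF linear_euclid_vec])
  moreover have "\<forall>u\<in>set [(1 / norm w) *\<^sub>R w, (1 / norm \<xi>) *\<^sub>R \<xi>]. norm u = 1"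
    using w0 False by simp
  moreover have "even (length [(1 / norm w) *\<^sub>R w, (1 / norm \<xi>) *\<^sub>R \<xi>])"
    by simp
  ultimately show ?thesis
    unfolding Spin_n_def by blast
qed

lemma space_vec_square: "space_vec x * space_vec x = - ((x \<bullet> x) *\<^sub>R 1)"
  by (simp add: euclid_vec_square cl_incl_simps linear_neg [OF linear_cl_incl] flip: cl_incl_mult)

lemma space_vec_anticommute: "space_vec x * space_vec y = (- 2 * (x \<bullet> y)) *\<^sub>R 1 - space_vec y * space_vec x"
proof -
  have "cl_incl (euclid_vec x * euclid_vec y + euclid_vec y * euclid_vec x) = (- 2 * (x \<bullet> y)) *\<^sub>R 1"
    by (simp only: euclid_vec_anticommute cl_incl_1 linear_scale [OF linear_cl_incl])
  then show ?thesis
    by (simp only: cl_incl_mult linear_add [OF linear_cl_incl] eq_diff_eq)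
qed

text \<open>
  The instance of \<open>bruhat_ring_identity\<close> for vectors of Euclidean space.  The real factor
  \<open>1/\<surd>P\<close> of \<^const>\<open>sct_spin\<close> turns \<open>a\<^sub>t\<close>, \<open>e\<^bsup>2t\<^esup> = P\<close>, into the combination of idempotents there.
\<close>

lemma n_elem_nbar_elem:
  assumes P: "sct_denom y \<xi> > 0"
  shows "\<exists>z. n_elem y * nbar_elem \<xi> =
    nbar_elem (sct y \<xi>) * cl_incl (sct_spin y \<xi>) * a_elem (ln (sct_denom y \<xi>) / 2) * n_elem z"
proof -
  let ?P = "sct_denom y \<xi>" and ?c = "y \<bullet> y" and ?d = "\<xi> \<bullet> \<xi>"
  let ?z = "(1 / ?P) *\<^sub>R (y + ?c *\<^sub>R \<xi>)"
  have sq: "exp (ln ?P / 2) = sqrt ?P"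
    using P by (simp flip: ln_sqrt)
  have a: "(1 / sqrt ?P) *\<^sub>R a_elem (ln ?P / 2)
      = (1/4) *\<^sub>R (\<epsilon>\<^sub>- * \<epsilon>\<^sub>+) + (1 / ?P) *\<^sub>R (1/4) *\<^sub>R (\<epsilon>\<^sub>+ * \<epsilon>\<^sub>-)"
    using P by (simp add: a_elem_null sq exp_minus scaleR_add_right field_simps)
  have "n_elem y * nbar_elem \<xi> = (1 + (1/2) *\<^sub>R (space_vec y * \<epsilon>\<^sub>-)) * (1 + (1/2) *\<^sub>R (space_vec \<xi> * \<epsilon>\<^sub>+))"
    by (simp add: n_elem_null nbar_elem_null)
  also have "\<dots> = (1 + (1/2) *\<^sub>R ((1 / ?P) *\<^sub>R (space_vec \<xi> + ?d *\<^sub>R space_vec y) * \<epsilon>\<^sub>+))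
      * (1 - space_vec y * space_vec \<xi>)
      * ((1/4) *\<^sub>R (\<epsilon>\<^sub>- * \<epsilon>\<^sub>+) + (1 / ?P) *\<^sub>R (1/4) *\<^sub>R (\<epsilon>\<^sub>+ * \<epsilon>\<^sub>-))
      * (1 + (1/2) *\<^sub>R ((1 / ?P) *\<^sub>R (space_vec y + ?c *\<^sub>R space_vec \<xi>) * \<epsilon>\<^sub>-))"
    by (rule bruhat_ring_identity [OF space_vec_square space_vec_square space_vec_anticommute
        null_vectors null_space_vec(1) null_space_vec(1) null_space_vec(2) null_space_vec(2)])
      (use P in \<open>auto simp: sct_denom_def\<close>)
  also have "1 + (1/2) *\<^sub>R ((1 / ?P) *\<^sub>R (space_vec \<xi> + ?d *\<^sub>R space_vec y) * \<epsilon>\<^sub>+) = nbar_elem (sct y \<xi>)"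
    by (simp add: nbar_elem_null sct_def space_vec_simps)
  also have "1 + (1/2) *\<^sub>R ((1 / ?P) *\<^sub>R (space_vec y + ?c *\<^sub>R space_vec \<xi>) * \<epsilon>\<^sub>-) = n_elem ?z"
    by (simp add: n_elem_null space_vec_simps)
  also have "nbar_elem (sct y \<xi>) * (1 - space_vec y * space_vec \<xi>)
      * ((1/4) *\<^sub>R (\<epsilon>\<^sub>- * \<epsilon>\<^sub>+) + (1 / ?P) *\<^sub>R (1/4) *\<^sub>R (\<epsilon>\<^sub>+ * \<epsilon>\<^sub>-))
      = nbar_elem (sct y \<xi>) * cl_incl (sct_spin y \<xi>) * a_elem (ln ?P / 2)"
    unfolding a [symmetric] by (simp add: sct_spin_def cl_incl_simps)
  finally show ?thesis by blast
qed

text \<open>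
  From \<open>h nbar(x) = nbar(b) m a n(y)\<close> one gets \<open>h nbar(x + \<xi>) = nbar(b) m a (n(y) nbar(\<xi>))\<close>.  Once the last product is
  factored, \<open>a\<close> and \<open>m\<close> move to the right past \<open>nbar\<close>, scaling and rotating its argument.  Near any
  point the action is therefore a translation and a similarity composed with a special conformal
  transformation.
\<close>

lemma factorization_near:
  assumes "factorization h x0 b m a"
  obtains t y R where "a = a_elem t" "orthogonal_transformation R"
    "\<And>x. m * euclid_vec x = euclid_vec (R x) * m"
    "\<And>\<xi>. sct_denom y \<xi> > 0 \<Longrightarrow> factorization h (x0 + \<xi>) (b + exp (- 2 * t) *\<^sub>R R (sct y \<xi>))
        (m * sct_spin y \<xi>) (a_elem (t + ln (sct_denom y \<xi>) / 2))"
proof -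
  obtain t y where m: "m \<in> Spin_n" and a: "a = a_elem t"
    and h: "h * nbar_elem x0 = nbar_elem b * cl_incl m * a_elem t * n_elem y"
    using assms by (auto simp: factorization_def A_group_def N_group_def)
  obtain R where R: "orthogonal_transformation R" and mR: "\<And>x. m * euclid_vec x = euclid_vec (R x) * m"
    using spin_rotation [OF m] by blast
  have m_nbar: "cl_incl m * nbar_elem x = nbar_elem (R x) * cl_incl m" for x
  proof -
    have "cl_incl m * space_vec x = space_vec (R x) * cl_incl m"
      by (simp add: mR flip: cl_incl_mult)
    then have "cl_incl m * (space_vec x * \<epsilon>\<^sub>+) = space_vec (R x) * cl_incl m * \<epsilon>\<^sub>+"
      by (simp flip: mult.assoc)
    then show ?thesis
      by (simp add: nbar_elem_null distrib_left distrib_right mult.assoc null_commute_spin [OF m])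
  qed
  have "factorization h (x0 + \<xi>) (b + exp (- 2 * t) *\<^sub>R R (sct y \<xi>))
        (m * sct_spin y \<xi>) (a_elem (t + ln (sct_denom y \<xi>) / 2))" if P: "sct_denom y \<xi> > 0" for \<xi>
  proof -
    let ?t = "ln (sct_denom y \<xi>) / 2"
    obtain z where z: "n_elem y * nbar_elem \<xi> =
      nbar_elem (sct y \<xi>) * cl_incl (sct_spin y \<xi>) * a_elem ?t * n_elem z"
      using n_elem_nbar_elem [OF P] by blast
    have "h * nbar_elem (x0 + \<xi>) = nbar_elem b * cl_incl m * a_elem t * (n_elem y * nbar_elem \<xi>)"
      unfolding nbar_elem_add [symmetric] by (simp add: h flip: mult.assoc)
    also have "\<dots> = nbar_elem b * cl_incl m * (a_elem t * nbar_elem (sct y \<xi>))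
        * cl_incl (sct_spin y \<xi>) * a_elem ?t * n_elem z"
      unfolding z by (simp only: mult.assoc)
    also have "\<dots> = nbar_elem b * (cl_incl m * nbar_elem (exp (- 2 * t) *\<^sub>R sct y \<xi>))
        * (a_elem t * cl_incl (sct_spin y \<xi>)) * a_elem ?t * n_elem z"
      unfolding a_elem_nbar by (simp only: mult.assoc)
    also have "\<dots> = (nbar_elem b * nbar_elem (exp (- 2 * t) *\<^sub>R R (sct y \<xi>)))
        * cl_incl (m * sct_spin y \<xi>) * (a_elem t * a_elem ?t) * n_elem z"
      unfolding m_nbar a_elem_commute_spin [OF sct_spin_in_Spin_n [OF P]] cl_incl_mult
        orthogonal_transformation_scaleR [OF R] by (simp only: mult.assoc)
    finally show ?thesis
      unfolding nbar_elem_add a_elem_add factorization_def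
      using spin_mult [OF m sct_spin_in_Spin_n [OF P]] by (auto simp: A_group_def N_group_def)
  qed
  with that a R mR show ?thesis by blast
qed

text \<open>
  The product \<open>m a n\<close> lies in a group in which \<open>N\<close> is normalized by \<open>M\<close> and \<open>A\<close>, so its inverse
  can be brought into the same order.
\<close>

lemma factorization_inverse:
  assumes "h * g = 1" and "factorization g x x' m a"
  shows "\<exists>m' a'. factorization h x' x m' a'"
proof -
  obtain t y where m: "m \<in> Spin_n" and a: "a = a_elem t"
    and g: "g * nbar_elem x = nbar_elem x' * cl_incl m * a_elem t * n_elem y"
    using assms(2) by (auto simp: factorization_def A_group_def N_group_def)
  obtain m' where m': "m' \<in> Spin_n" "m * m' = 1" "m' * m = 1"
    using spin_inverse [OF m] by blast
  obtain R where R: "\<And>x. m' * euclid_vec x = euclid_vec (R x) * m'"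
      "orthogonal_transformation R"
    using spin_rotation [OF m'(1)] by blast
  define z where "z = exp (2 * t) *\<^sub>R (- y)"
  obtain z' where z': "z = R z'"
    using orthogonal_transformation_surj [OF R(2)] by (metis surjD)
  have "cl_incl m' * space_vec z' = space_vec z * cl_incl m'"
    by (simp add: R(1) z' flip: cl_incl_mult)
  then have "cl_incl m' * (space_vec z' * \<epsilon>\<^sub>-) = space_vec z * cl_incl m' * \<epsilon>\<^sub>-"
    by (simp flip: mult.assoc)
  then have nm: "n_elem z * cl_incl m' = cl_incl m' * n_elem z'"
    by (simp add: n_elem_null distrib_left distrib_right mult.assoc null_commute_spin [OF m'(1)])
  have mm: "cl_incl m * cl_incl m' = 1"
    by (simp add: m' cl_incl_1 flip: cl_incl_mult)
  have cancel: "n_elem y * (n_elem (- y) * b) = b" "a_elem t * (a_elem (- t) * b) = b" for b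
    by (simp_all add: n_elem_add a_elem_add flip: mult.assoc)
  have "h * nbar_elem x' = h * (nbar_elem x' * cl_incl m * a_elem t * n_elem y)
      * n_elem (- y) * a_elem (- t) * cl_incl m'"
    by (simp add: mult.assoc cancel mm)
  also have "\<dots> = nbar_elem x * (n_elem (- y) * a_elem (- t)) * cl_incl m'"
    unfolding g [symmetric] by (simp add: assms(1) flip: mult.assoc)
  also have "\<dots> = nbar_elem x * (a_elem (- t) * (n_elem z * cl_incl m'))"
    using n_elem_a [of "- y" "- t"] by (simp add: z_def mult.assoc)
  also have "\<dots> = nbar_elem x * (a_elem (- t) * cl_incl m') * n_elem z'"
    unfolding nm by (simp only: mult.assoc)
  also have "\<dots> = nbar_elem x * cl_incl m' * a_elem (- t) * n_elem z'"
    unfolding a_elem_commute_spin [OF m'(1)] by (simp only: mult.assoc)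
  finally show ?thesis
    unfolding factorization_def A_group_def N_group_def using m'(1) by blast
qed

text \<open>
  A vector with \<open>\<^bold>Q(v) = \<plusminus>1\<close> is its own inverse up to sign.
\<close>

lemma Spin0_inverse:
  assumes "g \<in> Spin0"
  shows "g * cl_inverse g = 1" "cl_inverse g * g = 1"
proof -
  have "\<exists>h. prod_list (map lorentz_vec vs) * h = 1 \<and> h * prod_list (map lorentz_vec vs) = 1"
    if "\<forall>v\<in>set vs. lorentz_form v v = 1 \<or> lorentz_form v v = -1" for vs :: "((real, 'a lorentz) vec) list"
    using that
  proof (induction vs)
    case (Cons v vs)
    then obtain h where h: "prod_list (map lorentz_vec vs) * h = 1" "h * prod_list (map lorentz_vec vs) = 1"
      by auto
    let ?r = "lorentz_form v v"
    have r: "?r * ?r = 1" using Cons.prems by auto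
    have "2 *\<^sub>R (lorentz_vec v * lorentz_vec v) = 2 *\<^sub>R (?r *\<^sub>R 1)"
      using lorentz_vec_anticommute [of v v] by (simp add: scaleR_2)
    then have v: "lorentz_vec v * lorentz_vec v = ?r *\<^sub>R 1"
      by (simp only: real_vector.scale_cancel_left) simp
    have 1: "prod_list (map lorentz_vec vs) * (h * b) = b" "lorentz_vec v * (lorentz_vec v * b) = ?r *\<^sub>R b" for b
      using h v by (simp_all flip: mult.assoc)
    have "prod_list (map lorentz_vec (v # vs)) * (h * (?r *\<^sub>R lorentz_vec v)) = 1"
      by (simp add: mult.assoc 1 v r)
    moreover have "(h * (?r *\<^sub>R lorentz_vec v)) * prod_list (map lorentz_vec (v # vs)) = 1"
      by (simp add: mult.assoc 1 h r)
    ultimately show ?case by blast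
  qed auto
  then obtain h where h: "g * h = 1 \<and> h * g = 1"
    using assms unfolding Spin0_def by blast
  moreover have "k = h" if "g * k = 1 \<and> k * g = 1" for k
    using that h by (metis mult.assoc mult.left_neutral mult.right_neutral)
  ultimately have "cl_inverse g = h"
    unfolding cl_inverse_def by blast
  with h show "g * cl_inverse g = 1" "cl_inverse g * g = 1" by auto
qed

lemma act_inverse:
  fixes g h :: "('n::{finite,linorder} lorentz, real) clifford"
    and \<rho> :: "('n, 's::finite) clifford_rep"
  assumes hom: "complex_algebra_hom \<rho>" and "h * g = 1" "act_defined g x"
  shows "act_defined h (act_point g x)" "act_point h (act_point g x) = x"
proof -
  obtain x' m a where f: "factorization g x x' m a"
    using assms(3) by (auto simp: act_defined_def)
  then obtain m' a' where f': "factorization h x' x m' a'"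
    using factorization_inverse [OF assms(2)] by blast
  show "act_defined h (act_point g x)" "act_point h (act_point g x) = x"
    using factorization_act [OF hom f] factorization_act [OF hom f'] by simp_all
qed

lemma eventually_sct_denom_pos: "\<forall>\<^sub>F z in nhds x0. sct_denom y (z - x0) > 0"
proof -
  have "isCont (\<lambda>z. sct_denom y (z - x0)) x0"
    unfolding sct_denom_def by (intro continuous_intros)
  then have "((\<lambda>z. sct_denom y (z - x0)) \<longlongrightarrow> sct_denom y (x0 - x0)) (nhds x0)"
    unfolding isCont_def by (rule tendsto_at_iff_tendsto_nhds [THEN iffD1])
  moreover have "sct_denom y (x0 - x0) = 1"
    by (simp add: sct_denom_def)
  ultimately show ?thesis
    by (auto elim: order_tendstoD)
qed

text \<open>
  Needed to transport compactness of the support by the group action.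
\<close>

lemma isCont_act_point:
  fixes g :: "('n::{finite,linorder} lorentz, real) clifford"
    and \<rho> :: "('n, 's::finite) clifford_rep"
  assumes hom: "complex_algebra_hom \<rho>" and "act_defined g x0"
  shows "isCont (act_point g) x0"
proof -
  obtain b m a where f: "factorization g x0 b m a"
    using assms(2) by (auto simp: act_defined_def)
  obtain t y R where R: "orthogonal_transformation R"
    and near: "\<And>\<xi>. sct_denom y \<xi> > 0 \<Longrightarrow> factorization g (x0 + \<xi>) (b + exp (- 2 * t) *\<^sub>R R (sct y \<xi>))
        (m * sct_spin y \<xi>) (a_elem (t + ln (sct_denom y \<xi>) / 2))"
    using factorization_near [OF f] by metis
  have ev: "\<forall>\<^sub>F z in nhds x0. act_point g z = b + exp (- 2 * t) *\<^sub>R R (sct y (z - x0))"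
    using eventually_sct_denom_pos [of y x0]
    by eventually_elim (use factorization_act(2) [OF hom near] in force)
  have "isCont (\<lambda>z. sct y (z - x0)) x0"
    unfolding sct_def sct_denom_def by (intro continuous_intros) simp
  then have "isCont (\<lambda>z. R (sct y (z - x0))) x0"
    by (rule linear_continuous_compose)
      (use R in \<open>auto simp: orthogonal_transformation_def\<close>)
  then have "isCont (\<lambda>z. b + exp (- 2 * t) *\<^sub>R R (sct y (z - x0))) x0"
    by (intro continuous_intros)
  then show ?thesis
    by (simp add: isCont_cong [OF ev])
qed

section \<open>Jets of special conformal transformations\<close>

lemma has_jet2_eq:
  assumes "has_jet2 f p f1 f2" "\<And>v. f1 v = g1 v" "\<And>u v. f2 u v = g2 u v"
  shows "has_jet2 f p g1 g2"
proof -
  have "f1 = g1" "f2 = g2" using assms(2,3) by (auto intro!: ext)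
  with assms(1) show ?thesis by simp
qed

text \<open>
  The conformal factor is this function of \<^const>\<open>sct_denom\<close>, which equals \<open>1\<close> at the origin.
\<close>

lemma has_jet2_power_factor:
  "has_jet2 (\<lambda>s. exp (- c * of_real (ln s)) :: complex) 1 (\<lambda>v. - c * of_real v)
     (\<lambda>u v. c * (c + 1) * of_real u * of_real v)"
  unfolding has_jet2_def
proof (intro exI conjI allI)
  let ?k = "\<lambda>s. exp (- c * of_real (ln s)) :: complex"
  let ?k' = "\<lambda>s v. - c * ?k s * of_real (inverse s * v)"
  have k: "(?k has_derivative ?k' s) (at s)" if "s > 0" for s :: real
  proof -
    have "((\<lambda>s. of_real (ln s) :: complex) has_derivative (\<lambda>v. of_real (v * inverse s))) (at s)"
      by (rule has_derivative_eq_rhs [OF has_derivative_of_real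
          [OF has_field_derivative_imp_has_derivative [OF DERIV_ln [OF that]]]]) (simp add: mult.commute)
    from has_derivative_compose [OF has_derivative_mult_right [OF this, of "- c"]
        DERIV_exp [THEN has_field_derivative_imp_has_derivative]]
    show ?thesis
      by (simp add: mult_ac)
  qed
  have "\<forall>\<^sub>F s in nhds (1::real). s > 0"
    by (rule eventually_nhds_in_open [of "{0<..}", simplified]) auto
  then show "\<forall>\<^sub>F s in nhds 1. (?k has_derivative ?k' s) (at s)"
    by eventually_elim (rule k)
  show "?k' 1 = (\<lambda>v. - c * of_real v)"
    by (auto simp: fun_eq_iff)
  show "((\<lambda>s. ?k' s v) has_derivative (\<lambda>u. c * (c + 1) * of_real u * of_real v)) (at 1)" for v
  proof -
    have "((\<lambda>s. of_real (inverse s * v) :: complex) has_derivative (\<lambda>u. of_real (- u * v))) (at 1)"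
      by (intro has_derivative_of_real) (auto intro!: derivative_eq_intros)
    from has_derivative_mult [OF has_derivative_mult_right [OF k [of 1], of "- c"] this]
    show ?thesis
      by (rule has_derivative_eq_rhs) (auto simp: fun_eq_iff algebra_simps)
  qed
qed

lemma has_jet2_inverse: "has_jet2 (\<lambda>s. 1 / s) (1::real) (\<lambda>v. - v) (\<lambda>u v. 2 * u * v)"
  unfolding has_jet2_def
proof (intro exI conjI allI)
  let ?k' = "\<lambda>s v. - (v / (s * s)) :: real"
  have "\<forall>\<^sub>F s in nhds (1::real). s > 0"
    by (rule eventually_nhds_in_open [of "{0<..}", simplified]) auto
  then show "\<forall>\<^sub>F s in nhds 1. ((\<lambda>s. 1 / s) has_derivative ?k' s) (at s)"
    by eventually_elim (auto intro!: derivative_eq_intros simp: divide_simps)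
  show "?k' 1 = (\<lambda>v. - v)" by simp
  show "((\<lambda>s. ?k' s v) has_derivative (\<lambda>u. 2 * u * v)) (at 1)" for v
    by (auto intro!: derivative_eq_intros simp: fun_eq_iff)
qed

lemma bounded_linear_inner: "bounded_linear (\<lambda>x. c * (x \<bullet> y))" for y :: "'a::real_inner"
  by (intro bounded_linear_mult_right [THEN bounded_linear_compose] bounded_linear_inner_left bounded_linear_ident)

lemma has_jet2_inner_self: "has_jet2 (\<lambda>x. x \<bullet> x) (0::'a::real_inner) (\<lambda>v. 0) (\<lambda>u v. 2 * (u \<bullet> v))"
  using has_jet2_bilinear [OF bounded_bilinear_inner has_jet2_linear [OF bounded_linear_ident]
      has_jet2_linear [OF bounded_linear_ident], of "0::'a"]
  by (rule has_jet2_eq) (auto simp: inner_commute)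

lemma sct_denom_0 [simp]: "sct_denom y 0 = 1" "sct y 0 = 0"
  by (simp_all add: sct_denom_def sct_def)

lemma has_jet2_sct_denom: "has_jet2 (sct_denom y) 0 (\<lambda>v. 2 * (v \<bullet> y)) (\<lambda>u v. 2 * (u \<bullet> v) * (y \<bullet> y))"
proof -
  have "has_jet2 (\<lambda>x. (1 + 2 * (x \<bullet> y)) + (x \<bullet> x) * (y \<bullet> y)) 0 (\<lambda>v. 2 * (v \<bullet> y)) (\<lambda>u v. 2 * (u \<bullet> v) * (y \<bullet> y))"
    by (rule has_jet2_eq [OF has_jet2_add [OF has_jet2_affine [OF bounded_linear_inner]
       has_jet2_bilinear [OF bounded_bilinear_mult has_jet2_inner_self has_jet2_const]]]) auto
  then show ?thesis
    by (simp add: sct_denom_def [abs_def])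
qed

text \<open>
  To first order a special conformal transformation is the identity at the origin; all of its effect on
  second order jets is in the quadratic term.
\<close>

lemma has_jet2_sct: "has_jet2 (sct y) 0 (\<lambda>v. v)
  (\<lambda>u v. (2 * (u \<bullet> v)) *\<^sub>R y - (2 * (v \<bullet> y)) *\<^sub>R u - (2 * (u \<bullet> y)) *\<^sub>R v)"
proof -
  have inv: "has_jet2 (\<lambda>x. 1 / sct_denom y x) 0 (\<lambda>v. - (2 * (v \<bullet> y)))
     (\<lambda>u v. 2 * (2 * (u \<bullet> y)) * (2 * (v \<bullet> y)) + - (2 * (u \<bullet> v) * (y \<bullet> y)))"
    by (rule has_jet2_compose [OF has_jet2_sct_denom]) (simp add: has_jet2_inverse)
  have "has_jet2 (\<lambda>x. x + (x \<bullet> x) *\<^sub>R y) 0 (\<lambda>v. v) (\<lambda>u v. (2 * (u \<bullet> v)) *\<^sub>R y)"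
    by (rule has_jet2_eq [OF has_jet2_add [OF has_jet2_linear [OF bounded_linear_ident]
       has_jet2_bilinear [OF bounded_bilinear_scaleR has_jet2_inner_self has_jet2_const]]]) auto
  then have "has_jet2 (\<lambda>x. (1 / sct_denom y x) *\<^sub>R (x + (x \<bullet> x) *\<^sub>R y)) 0 (\<lambda>v. v)
    (\<lambda>u v. (2 * (u \<bullet> v)) *\<^sub>R y - (2 * (v \<bullet> y)) *\<^sub>R u - (2 * (u \<bullet> y)) *\<^sub>R v)"
    by (rule has_jet2_eq [OF has_jet2_bilinear [OF bounded_bilinear_scaleR inv]]) auto
  then show ?thesis
    by (simp add: sct_def [abs_def])
qed

text \<open>
  The second derivative of \<^const>\<open>sct\<close> at the origin.
\<close>

definition sct2 :: "(real, 'n::{finite,linorder}) vec \<Rightarrow> (real, 'n) vec \<Rightarrow> (real, 'n) vec \<Rightarrow> (real, 'n) vec" where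
  "sct2 y u v = (2 * (u \<bullet> v)) *\<^sub>R y - (2 * (v \<bullet> y)) *\<^sub>R u - (2 * (u \<bullet> y)) *\<^sub>R v"

text \<open>
  The factors by which \<open>\<pi>\<^sub>\<lambda>(g)\<close> and \<open>\<pi>'\<^sub>\<mu>(g)\<close> multiply when \<open>g\<inverse> = n(y)\<close>, with \<open>p = 2\<lambda> + 1\<close> or \<open>p = 2\<mu> + 1\<close>:
  a power of \<^const>\<open>sct_denom\<close> times \<open>\<rho>(1 - xy)\<close> from the left, or \<open>\<rho>(1 - yx)\<close> from the right.
  The suffixes 1 and 2 denote the first and second derivative at the origin.
\<close>

context
  fixes \<rho> :: "('n::{finite,linorder}, 's::finite) clifford_rep" and p :: complex and y :: "(real, 'n) vec"
begin

definition conf_left :: "(real, 'n) vec \<Rightarrow> complex^'s^'s" where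
  "conf_left x = exp (- (p / 2) * of_real (ln (sct_denom y x))) *\<^sub>C crep \<rho> (1 - euclid_vec x * euclid_vec y)"

definition conf_left1 :: "(real, 'n) vec \<Rightarrow> complex^'s^'s" where
  "conf_left1 v = (- p * of_real (v \<bullet> y)) *\<^sub>C mat 1 - rep_vec \<rho> v ** rep_vec \<rho> y"

definition conf_left2 :: "(real, 'n) vec \<Rightarrow> (real, 'n) vec \<Rightarrow> complex^'s^'s" where
  "conf_left2 u v =
     (p * (p + 2) * of_real ((u \<bullet> y) * (v \<bullet> y)) - p * of_real ((u \<bullet> v) * (y \<bullet> y))) *\<^sub>C mat 1
     + (p * of_real (v \<bullet> y)) *\<^sub>C (rep_vec \<rho> u ** rep_vec \<rho> y)
     + (p * of_real (u \<bullet> y)) *\<^sub>C (rep_vec \<rho> v ** rep_vec \<rho> y)"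

definition conf_right :: "(real, 'n) vec \<Rightarrow> complex^'s^'s" where
  "conf_right x = exp (- (p / 2) * of_real (ln (sct_denom y x))) *\<^sub>C crep \<rho> (1 - euclid_vec y * euclid_vec x)"

definition conf_right1 :: "(real, 'n) vec \<Rightarrow> complex^'s^'s" where
  "conf_right1 v = (- p * of_real (v \<bullet> y)) *\<^sub>C mat 1 - rep_vec \<rho> y ** rep_vec \<rho> v"

definition conf_right2 :: "(real, 'n) vec \<Rightarrow> (real, 'n) vec \<Rightarrow> complex^'s^'s" where
  "conf_right2 u v =
     (p * (p + 2) * of_real ((u \<bullet> y) * (v \<bullet> y)) - p * of_real ((u \<bullet> v) * (y \<bullet> y))) *\<^sub>C mat 1
     + (p * of_real (v \<bullet> y)) *\<^sub>C (rep_vec \<rho> y ** rep_vec \<rho> u)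
     + (p * of_real (u \<bullet> y)) *\<^sub>C (rep_vec \<rho> y ** rep_vec \<rho> v)"

end

lemma crep_1_minus:
  assumes "complex_algebra_hom \<rho>"
  shows "crep \<rho> (1 - euclid_vec x * euclid_vec y) = mat 1 + - (rep_vec \<rho> x ** rep_vec \<rho> y)"
  using linear_diff [OF linear_crep [OF assms]] by (simp add: crep_hom [OF assms] crep_vec)

lemma has_jet2_sct_power:
  "has_jet2 (\<lambda>x. exp (- c * of_real (ln (sct_denom y x))) :: complex) 0 (\<lambda>v. - c * of_real (2 * (v \<bullet> y)))
     (\<lambda>u v. c * (c + 1) * of_real (2 * (u \<bullet> y)) * of_real (2 * (v \<bullet> y)) + - c * of_real (2 * (u \<bullet> v) * (y \<bullet> y)))"
  by (rule has_jet2_compose [OF has_jet2_sct_denom]) (simp only: sct_denom_0 has_jet2_power_factor)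

lemma has_jet2_conf_left:
  assumes hom: "complex_algebra_hom \<rho>"
  shows "has_jet2 (conf_left \<rho> p y) 0 (conf_left1 \<rho> p y) (conf_left2 \<rho> p y)"
proof -
  note lin = linear_rep_vec [OF hom]
  have L: "bounded_linear (\<lambda>x. - (rep_vec \<rho> x ** rep_vec \<rho> y))"
    by (intro bounded_linear_euclidean linearI)
      (simp_all add: linear_add [OF lin] linear_scale [OF lin] mm.add_left mm.scaleR_left)
  have "has_jet2 (\<lambda>x. exp (- (p / 2) * of_real (ln (sct_denom y x))) *\<^sub>C (mat 1 + - (rep_vec \<rho> x ** rep_vec \<rho> y))) 0
     (conf_left1 \<rho> p y) (conf_left2 \<rho> p y)"
    by (rule has_jet2_eq [OF has_jet2_bilinear [OF bounded_bilinear_cmul has_jet2_sct_power has_jet2_affine [OF L]]])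
      (simp_all add: conf_left1_def conf_left2_def linear_0 [OF lin] mm.zero_left cm.zero_right cm.minus_right cm.minus_left
        cmul_of_real [of 1, simplified] algebra_simps)
  then show ?thesis
    by (simp only: conf_left_def [abs_def] crep_1_minus [OF hom])
qed

lemma has_jet2_conf_right:
  assumes hom: "complex_algebra_hom \<rho>"
  shows "has_jet2 (conf_right \<rho> p y) 0 (conf_right1 \<rho> p y) (conf_right2 \<rho> p y)"
proof -
  note lin = linear_rep_vec [OF hom]
  have L: "bounded_linear (\<lambda>x. - (rep_vec \<rho> y ** rep_vec \<rho> x))"
    by (intro bounded_linear_euclidean linearI)
      (simp_all add: linear_add [OF lin] linear_scale [OF lin] mm.add_right mm.scaleR_right)
  have "has_jet2 (\<lambda>x. exp (- (p / 2) * of_real (ln (sct_denom y x))) *\<^sub>C (mat 1 + - (rep_vec \<rho> y ** rep_vec \<rho> x))) 0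
     (conf_right1 \<rho> p y) (conf_right2 \<rho> p y)"
    by (rule has_jet2_eq [OF has_jet2_bilinear [OF bounded_bilinear_cmul has_jet2_sct_power has_jet2_affine [OF L]]])
      (simp_all add: conf_right1_def conf_right2_def linear_0 [OF lin] mm.zero_right cm.zero_right cm.minus_right cm.minus_left
        cmul_of_real [of 1, simplified] algebra_simps)
  then show ?thesis
    by (simp only: conf_right_def [abs_def] crep_1_minus [OF hom])
qed

lemma has_jet2_Pair:
  assumes "has_jet2 f p f1 f2" and "has_jet2 g p g1 g2"
  shows "has_jet2 (\<lambda>q. (f q, g q)) p (\<lambda>v. (f1 v, g1 v)) (\<lambda>u v. (f2 u v, g2 u v))"
proof -
  obtain f' g' where "\<forall>\<^sub>F q in nhds p. (f has_derivative f' q) (at q)" "f' p = f1"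
    "\<And>v. ((\<lambda>q. f' q v) has_derivative (\<lambda>u. f2 u v)) (at p)"
    "\<forall>\<^sub>F q in nhds p. (g has_derivative g' q) (at q)" "g' p = g1"
    "\<And>v. ((\<lambda>q. g' q v) has_derivative (\<lambda>u. g2 u v)) (at p)"
    using assms unfolding has_jet2_def by blast
  then show ?thesis
    unfolding has_jet2_def
    by (intro exI [where x = "\<lambda>q v. (f' q v, g' q v)"])
      (auto intro!: has_derivative_Pair elim: eventually_elim2)
qed

text \<open>
  The three blocks of the second derivative.  The correction terms contain \<open>F\<close> and its first
  derivative at the origin; in the mixed block the quadratic term of the transformation is absent,
  because each variable is transformed separately.
\<close>

lemma has_jet2_twist:
  fixes F :: "('n::{finite,linorder}, 's::finite) two_var"
  assumes hom: "complex_algebra_hom \<rho>" and F: "has_jet2 F (0, 0) F1 F2"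
  obtains G1 G2 where
    "has_jet2 (\<lambda>r. conf_left \<rho> p y (fst r) ** F (sct y (fst r), sct y (snd r)) ** conf_right \<rho> q y (snd r)) (0, 0) G1 G2"
    "\<And>u v. G2 (u, 0) (v, 0) = conf_left2 \<rho> p y u v ** F (0, 0)
        + conf_left1 \<rho> p y v ** F1 (u, 0) + conf_left1 \<rho> p y u ** F1 (v, 0) + (F2 (u, 0) (v, 0) + F1 (sct2 y u v, 0))"
    "\<And>u v. G2 (0, u) (0, v) = F (0, 0) ** conf_right2 \<rho> q y u v
        + F1 (0, v) ** conf_right1 \<rho> q y u + F1 (0, u) ** conf_right1 \<rho> q y v + (F2 (0, u) (0, v) + F1 (0, sct2 y u v))"
    "\<And>u v. G2 (u, 0) (0, v) = conf_left1 \<rho> p y u ** F (0, 0) ** conf_right1 \<rho> q y v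
        + conf_left1 \<rho> p y u ** F1 (0, v) + F1 (u, 0) ** conf_right1 \<rho> q y v + F2 (u, 0) (0, v)"
proof -
  have L: "has_jet2 (\<lambda>r. conf_left \<rho> p y (fst r)) (0, 0) (\<lambda>v. conf_left1 \<rho> p y (fst v))
      (\<lambda>u v. conf_left2 \<rho> p y (fst u) (fst v) + conf_left1 \<rho> p y 0)"
    by (rule has_jet2_compose [OF has_jet2_linear [OF bounded_linear_fst]]) (simp add: has_jet2_conf_left [OF hom])
  have R: "has_jet2 (\<lambda>r. conf_right \<rho> q y (snd r)) (0, 0) (\<lambda>v. conf_right1 \<rho> q y (snd v))
      (\<lambda>u v. conf_right2 \<rho> q y (snd u) (snd v) + conf_right1 \<rho> q y 0)"
    by (rule has_jet2_compose [OF has_jet2_linear [OF bounded_linear_snd]]) (simp add: has_jet2_conf_right [OF hom])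
  have s1: "has_jet2 (\<lambda>r. sct y (fst r)) (0, 0) fst (\<lambda>u v. sct2 y (fst u) (fst v) + 0)"
    by (rule has_jet2_compose [OF has_jet2_linear [OF bounded_linear_fst]]) (simp add: has_jet2_sct sct2_def)
  have s2: "has_jet2 (\<lambda>r. sct y (snd r)) (0, 0) snd (\<lambda>u v. sct2 y (snd u) (snd v) + 0)"
    by (rule has_jet2_compose [OF has_jet2_linear [OF bounded_linear_snd]]) (simp add: has_jet2_sct sct2_def)
  have M: "has_jet2 (\<lambda>r. F (sct y (fst r), sct y (snd r))) (0, 0) F1
      (\<lambda>u v. F2 u v + F1 (sct2 y (fst u) (fst v), sct2 y (snd u) (snd v)))"
    using has_jet2_compose [OF has_jet2_Pair [OF s1 s2], of F F1 F2] F by simp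
  have z: "rep_vec \<rho> 0 = 0"
    by (rule linear_0 [OF linear_rep_vec [OF hom]])
  have c0: "0 *\<^sub>C T = 0" "1 *\<^sub>C T = T" for T :: "complex^'s^'s"
    using cmul_of_real [of 0 T] cmul_of_real [of 1 T] by simp_all
  have zero: "conf_left1 \<rho> p y 0 = 0" "conf_right1 \<rho> q y 0 = 0" "conf_left2 \<rho> p y 0 v = 0" "conf_left2 \<rho> p y v 0 = 0"
    "conf_right2 \<rho> q y 0 v = 0" "conf_right2 \<rho> q y v 0 = 0" "sct2 y 0 v = 0" "sct2 y v 0 = 0" for v
    by (simp_all add: conf_left1_def conf_left2_def conf_right1_def conf_right2_def sct2_def z c0
        mm.zero_left mm.zero_right cm.zero_right)
  have one: "conf_left \<rho> p y 0 = mat 1" "conf_right \<rho> q y 0 = mat 1"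
    by (simp_all add: conf_left_def conf_right_def linear_0 [OF linear_euclid_vec] crep_hom(1) [OF hom] c0)
  have F10: "F1 (0, 0) = 0"
    using linear_0 [OF bounded_linear.linear [OF has_jet2_bounded_linear(1) [OF F]]] by (simp add: zero_prod_def)
  show ?thesis
    by (rule that [OF has_jet2_bilinear [OF bounded_bilinear_matrix_mult has_jet2_bilinear [OF bounded_bilinear_matrix_mult L M] R]])
      (simp_all add: zero one F10 mm.zero_left mm.zero_right mm.add_left mm.add_right)
qed

section \<open>Invariance properties of the jet form\<close>

lemma rep_vec_basis:
  assumes "complex_algebra_hom \<rho>"
  shows "(\<Sum>j\<in>UNIV. (y $ j) *\<^sub>R rep_vec \<rho> (axis j 1)) = rep_vec \<rho> y"
proof -
  note lin = linear_rep_vec [OF assms]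
  have "rep_vec \<rho> (\<Sum>j\<in>UNIV. (y $ j) *\<^sub>R axis j 1) = rep_vec \<rho> y"
    using basis_expansion [of y] by (simp add: scalar_mult_eq_scaleR)
  then show ?thesis
    by (simp add: linear_sum [OF lin] linear_scale [OF lin])
qed

text \<open>
  The heart of the covariance.  The twist adds to the second derivative terms with \<open>F\<close> and \<open>F'\<close> at the
  origin.  Modulo the Clifford relations and cyclicity of the trace these reduce to the five numbers
  \<open>f\<close>, \<open>a1\<close>, \<open>a2\<close>, \<open>b1\<close>, \<open>b2\<close>.  With \<open>p = 2\<lambda> + 1\<close>, \<open>q = 2\<mu> + 1\<close>, the facts \<open>S1\<close> to \<open>S4\<close>
  below express the four sums of \<^const>\<open>jet_form\<close> in these numbers.  With the coefficients
  \<open>q(q - n)\<close>, \<open>p(p - n)\<close>, \<open>-2(p - n)(q - n)\<close>, \<open>2(p + q - n)\<close> of these sums, all five cancel.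
\<close>

lemma jet_form_twist:
  fixes F :: "('n::{finite,linorder}, 's::finite) two_var"
  assumes hom: "complex_algebra_hom \<rho>" and F: "has_jet2 F (0, 0) F1 F2"
  shows "\<exists>G1 G2. has_jet2 (\<lambda>r. conf_left \<rho> (2 * lam + 1) y (fst r) ** F (sct y (fst r), sct y (snd r))
        ** conf_right \<rho> (2 * mu + 1) y (snd r)) (0, 0) G1 G2
    \<and> jet_form lam mu \<rho> G2 = jet_form lam mu \<rho> F2"
proof -
  define n where "n = (of_nat CARD('n) :: complex)"
  define p q where "p = 2 * lam + 1" and "q = 2 * mu + 1"
  let ?E = "\<lambda>j. rep_vec \<rho> (axis j 1)" and ?Y = "rep_vec \<rho> y" and ?F0 = "F (0, 0)"
  define A B where "A = (\<lambda>j. F1 (axis j 1, 0))" and "B = (\<lambda>j. F1 (0, axis j 1))"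
  define a1 a2 b1 b2 f where "a1 = (\<Sum>j\<in>UNIV. of_real (y $ j) * Psi0 (A j))"
    and "a2 = (\<Sum>j\<in>UNIV. Psi0 (?Y ** ?E j ** A j))"
    and "b1 = (\<Sum>j\<in>UNIV. of_real (y $ j) * Psi0 (B j))"
    and "b2 = (\<Sum>j\<in>UNIV. Psi0 (?E j ** ?Y ** B j))"
    and "f = of_real (y \<bullet> y) * Psi0 ?F0"
  define \<alpha> \<beta> where "\<alpha> = (\<lambda>j. (- p * of_real (y $ j)) *\<^sub>C mat 1 - ?E j ** ?Y)"
    and "\<beta> = (\<lambda>j. (- q * of_real (y $ j)) *\<^sub>C mat 1 - ?Y ** ?E j)"
  have ax: "axis j 1 \<bullet> y = y $ j" "axis j 1 \<bullet> (axis j 1 :: (real, 'n) vec) = 1" for j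
    by (simp_all add: inner_axis inner_axis_axis inner_commute)
  have conf: "conf_left1 \<rho> p y (axis j 1) = \<alpha> j" "conf_right1 \<rho> q y (axis j 1) = \<beta> j"
    "conf_left2 \<rho> p y (axis j 1) (axis j 1) = (p * (p + 2) * of_real (y $ j * y $ j) - p * of_real (y \<bullet> y)) *\<^sub>C mat 1
        + (p * of_real (y $ j)) *\<^sub>C (?E j ** ?Y) + (p * of_real (y $ j)) *\<^sub>C (?E j ** ?Y)"
    "conf_right2 \<rho> q y (axis j 1) (axis j 1) = (q * (q + 2) * of_real (y $ j * y $ j) - q * of_real (y \<bullet> y)) *\<^sub>C mat 1
        + (q * of_real (y $ j)) *\<^sub>C (?Y ** ?E j) + (q * of_real (y $ j)) *\<^sub>C (?Y ** ?E j)"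
    for j
    by (simp_all add: conf_left1_def conf_right1_def conf_left2_def conf_right2_def \<alpha>_def \<beta>_def ax)
  have sct2: "sct2 y (axis j 1) (axis j 1) = 2 *\<^sub>R y - (4 * y $ j) *\<^sub>R axis j 1" for j
    by (simp add: sct2_def ax vec_eq_iff)
  obtain G1 G2 where
    G: "has_jet2 (\<lambda>r. conf_left \<rho> p y (fst r) ** F (sct y (fst r), sct y (snd r)) ** conf_right \<rho> q y (snd r)) (0, 0) G1 G2"
    and xx: "\<And>u v. G2 (u, 0) (v, 0) = conf_left2 \<rho> p y u v ** ?F0
        + conf_left1 \<rho> p y v ** F1 (u, 0) + conf_left1 \<rho> p y u ** F1 (v, 0) + (F2 (u, 0) (v, 0) + F1 (sct2 y u v, 0))"
    and yy: "\<And>u v. G2 (0, u) (0, v) = ?F0 ** conf_right2 \<rho> q y u v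
        + F1 (0, v) ** conf_right1 \<rho> q y u + F1 (0, u) ** conf_right1 \<rho> q y v + (F2 (0, u) (0, v) + F1 (0, sct2 y u v))"
    and xy: "\<And>u v. G2 (u, 0) (0, v) = conf_left1 \<rho> p y u ** ?F0 ** conf_right1 \<rho> q y v
        + conf_left1 \<rho> p y u ** F1 (0, v) + F1 (u, 0) ** conf_right1 \<rho> q y v + F2 (u, 0) (0, v)"
    using has_jet2_twist [OF hom F, of p y q] by blast
  have linF1: "linear F1"
    using has_jet2_bounded_linear(1) [OF F] by (rule bounded_linear.linear)
  have F1x: "F1 (2 *\<^sub>R y - c *\<^sub>R v, 0) = 2 *\<^sub>R F1 (y, 0) - c *\<^sub>R F1 (v, 0)"
    and F1y: "F1 (0, 2 *\<^sub>R y - c *\<^sub>R v) = 2 *\<^sub>R F1 (0, y) - c *\<^sub>R F1 (0, v)" for c v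
    using linear_diff [OF linF1, of "2 *\<^sub>R (y, 0)" "c *\<^sub>R (v, 0)"] linear_diff [OF linF1, of "2 *\<^sub>R (0, y)" "c *\<^sub>R (0, v)"]
    by (simp_all add: linear_scale [OF linF1, symmetric])
  have ysum: "y = (\<Sum>j\<in>UNIV. (y $ j) *\<^sub>R axis j 1)"
    using basis_expansion [of y] by (simp add: scalar_mult_eq_scaleR)
  have pair: "(\<Sum>j\<in>I. h j, 0) = (\<Sum>j\<in>I. (h j, 0))" "(0, \<Sum>j\<in>I. h j) = (\<Sum>j\<in>I. (0, h j))"
    for h :: "'n \<Rightarrow> (real, 'n) vec" and I
    by (simp_all add: prod_eq_iff fst_sum snd_sum)
  have sc: "(c *\<^sub>R v, 0 :: (real, 'n) vec) = c *\<^sub>R (v, 0)" "(0 :: (real, 'n) vec, c *\<^sub>R v) = c *\<^sub>R (0, v)" for c and v :: "(real, 'n) vec"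
    by simp_all
  have a1: "Psi0 (F1 (y, 0)) = a1" and b1: "Psi0 (F1 (0, y)) = b1"
    unfolding a1_def b1_def A_def B_def
    by (subst ysum, simp only: pair sc linear_sum [OF linF1] linear_scale [OF linF1] Psi0_sum Psi0_simps)+
  have y2: "(\<Sum>j\<in>UNIV. of_real (y $ j * y $ j)) = (of_real (y \<bullet> y) :: complex)"
    by (simp add: inner_vec_def)
  have YY: "?Y ** ?Y = - ((y \<bullet> y) *\<^sub>R mat 1)"
    using rep_vec_square [OF hom, of y] by simp
  have EE: "?E j ** ?E j = - mat 1" for j
    using rep_vec_square [OF hom, of "axis j 1"] by (simp add: ax)
  have EY: "?E j ** ?Y = (- 2 * y $ j) *\<^sub>R mat 1 - ?Y ** ?E j" for j
    using rep_vec_anticommute [OF hom, of "axis j 1" y] by (simp only: ax eq_diff_eq)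
  have tEY: "Psi0 (?E j ** ?Y ** X) = - 2 * (of_real (y $ j) * Psi0 X) - Psi0 (?Y ** ?E j ** X)" for j X
    unfolding EY by (simp add: mm.diff_left mm.scaleR_left mm.minus_left)
  have Ysum: "(\<Sum>j\<in>UNIV. of_real (y $ j) * Psi0 (?E j ** X)) = Psi0 (?Y ** X)" for X
    using arg_cong [OF rep_vec_basis [OF hom, of y], of "\<lambda>T. Psi0 (T ** X)"]
    by (simp add: mm.sum_left mm.scaleR_left Psi0_sum)
  have YYF: "Psi0 (?Y ** (?Y ** ?F0)) = - f"
    by (simp add: f_def matrix_mul_assoc YY mm.minus_left mm.scaleR_left)
  have Ysum2: "(\<Sum>j\<in>UNIV. of_real (y $ j) * Psi0 (?Y ** ?E j ** ?F0)) = - f"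
  proof -
    have "Psi0 (?Y ** ?E j ** ?F0) = Psi0 (?E j ** (?F0 ** ?Y))" for j
      by (metis Psi0_commute matrix_mul_assoc)
    moreover have "Psi0 (?Y ** (?F0 ** ?Y)) = Psi0 (?Y ** (?Y ** ?F0))"
      by (metis Psi0_commute matrix_mul_assoc)
    ultimately show ?thesis
      by (simp add: Ysum YYF)
  qed
  have t\<alpha>: "Psi0 (\<alpha> j ** X) = - p * (of_real (y $ j) * Psi0 X) - Psi0 (?E j ** ?Y ** X)" for j X
    by (simp add: \<alpha>_def mm.diff_left cmul_matrix_mult)
  have t\<beta>: "Psi0 (X ** \<beta> j) = - q * (of_real (y $ j) * Psi0 X) - Psi0 (?Y ** ?E j ** X)" for j X
    by (subst Psi0_commute) (simp add: \<beta>_def mm.diff_left cmul_matrix_mult)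
  have A: "F1 (axis j 1, 0) = A j" for j
    by (simp add: A_def)
  have B: "F1 (0, axis j 1) = B j" for j
    by (simp add: B_def)
  have tB: "Psi0 (B j ** \<beta> j) = - q * (of_real (y $ j) * Psi0 (B j)) + 2 * (of_real (y $ j) * Psi0 (B j)) + Psi0 (?E j ** ?Y ** B j)" for j
    by (simp add: t\<beta> tEY)
  have tA: "Psi0 (\<alpha> j ** A j) = - p * (of_real (y $ j) * Psi0 (A j)) + 2 * (of_real (y $ j) * Psi0 (A j)) + Psi0 (?Y ** ?E j ** A j)" for j
    by (simp add: t\<alpha> tEY)
  \<comment> \<open>In \<open>S1\<close> to \<open>S4\<close> the sums over \<open>j\<close> of \<open>y\<^sub>j\<^sup>2\<close>, \<open>y\<^sub>j e\<^sub>j\<close> and \<open>e\<^sub>j\<^sup>2\<close> are \<open>|y|\<^sup>2\<close>, \<open>y\<close> and \<open>-n\<close>.\<close>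
  have S1: "(\<Sum>j\<in>UNIV. Psi0 (G2 (axis j 1, 0) (axis j 1, 0)))
      = (\<Sum>j\<in>UNIV. Psi0 (F2 (axis j 1, 0) (axis j 1, 0))) + p * (p - n) * f - 2 * (p - n) * a1 + 2 * a2"
  proof -
    have "Psi0 (G2 (axis j 1, 0) (axis j 1, 0)) = (p * (p + 2) * Psi0 ?F0) * of_real (y $ j * y $ j) - p * f
        + (2 * p) * (of_real (y $ j) * Psi0 (?E j ** (?Y ** ?F0))) - (2 * p) * (of_real (y $ j) * Psi0 (A j))
        + 2 * Psi0 (?Y ** ?E j ** A j) + Psi0 (F2 (axis j 1, 0) (axis j 1, 0)) + 2 * a1" for j
      unfolding xx conf sct2 F1x A
      by (simp only: Psi0_simps mm.add_left cmul_matrix_mult matrix_mul_lid tA a1)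
        (simp add: f_def algebra_simps flip: matrix_mul_assoc)
    then show ?thesis
      by (simp add: sum.distrib sum_subtractf Ysum YYF y2 flip: sum_distrib_left a1_def a2_def del: of_real_mult)
        (simp add: f_def n_def algebra_simps)
  qed
  have S2: "(\<Sum>j\<in>UNIV. Psi0 (G2 (0, axis j 1) (0, axis j 1)))
      = (\<Sum>j\<in>UNIV. Psi0 (F2 (0, axis j 1) (0, axis j 1))) + q * (q - n) * f - 2 * (q - n) * b1 + 2 * b2"
  proof -
    have F0: "Psi0 (?F0 ** (?Y ** ?E j)) = Psi0 (?Y ** ?E j ** ?F0)" for j
      by (rule Psi0_commute)
    have "Psi0 (G2 (0, axis j 1) (0, axis j 1)) = (q * (q + 2) * Psi0 ?F0) * of_real (y $ j * y $ j) - q * f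
        + (2 * q) * (of_real (y $ j) * Psi0 (?Y ** ?E j ** ?F0)) - (2 * q) * (of_real (y $ j) * Psi0 (B j))
        + 2 * Psi0 (?E j ** ?Y ** B j) + Psi0 (F2 (0, axis j 1) (0, axis j 1)) + 2 * b1" for j
      unfolding yy conf sct2 F1y B
      by (simp only: Psi0_simps mm.add_right cmul_matrix_mult matrix_mul_rid tB b1 F0)
        (simp add: f_def algebra_simps)
    then show ?thesis
      by (simp add: sum.distrib sum_subtractf Ysum2 y2 flip: sum_distrib_left b1_def b2_def del: of_real_mult)
        (simp add: f_def n_def algebra_simps)
  qed
  have S3: "(\<Sum>j\<in>UNIV. Psi0 (G2 (axis j 1, 0) (0, axis j 1)))
      = (\<Sum>j\<in>UNIV. Psi0 (F2 (axis j 1, 0) (0, axis j 1))) + (p * q - p - q + n) * f - p * b1 - b2 - q * a1 - a2"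
  proof -
    have "Psi0 (\<alpha> j ** ?F0 ** \<beta> j) = (p * q * Psi0 ?F0) * of_real (y $ j * y $ j)
        + q * (of_real (y $ j) * Psi0 (?E j ** (?Y ** ?F0))) + p * (of_real (y $ j) * Psi0 (?Y ** ?E j ** ?F0)) + f" for j
    proof -
      have "Psi0 (?Y ** ?E j ** (?E j ** ?Y ** ?F0)) = f"
      proof -
        have "?Y ** ?E j ** (?E j ** ?Y ** ?F0) = ?Y ** (?E j ** ?E j) ** ?Y ** ?F0"
          by (simp add: matrix_mul_assoc)
        also have "\<dots> = (y \<bullet> y) *\<^sub>R ?F0"
          by (simp add: EE mm.minus_left mm.minus_right YY mm.scaleR_left)
        finally show ?thesis by (simp add: f_def)
      qed
      then show ?thesis
        by (simp add: t\<beta>) (simp add: \<alpha>_def mm.diff_left mm.diff_right cmul_matrix_mult algebra_simps flip: matrix_mul_assoc)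
    qed
    then have "Psi0 (G2 (axis j 1, 0) (0, axis j 1)) = (p * q * Psi0 ?F0) * of_real (y $ j * y $ j)
        + q * (of_real (y $ j) * Psi0 (?E j ** (?Y ** ?F0))) + p * (of_real (y $ j) * Psi0 (?Y ** ?E j ** ?F0)) + f
        - p * (of_real (y $ j) * Psi0 (B j)) - Psi0 (?E j ** ?Y ** B j) - q * (of_real (y $ j) * Psi0 (A j))
        - Psi0 (?Y ** ?E j ** A j) + Psi0 (F2 (axis j 1, 0) (0, axis j 1))" for j
      unfolding xy conf A B by (simp add: t\<alpha> t\<beta>)
    then show ?thesis
      by (simp add: sum.distrib sum_subtractf Ysum Ysum2 YYF y2
          flip: sum_distrib_left a1_def a2_def b1_def b2_def del: of_real_mult)
        (simp add: f_def n_def algebra_simps)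
  qed
  have SA: "(\<Sum>j\<in>UNIV. ?E j ** \<alpha> j) = (n - p) *\<^sub>C ?Y" and SB: "(\<Sum>j\<in>UNIV. \<beta> j ** ?E j) = (n - q) *\<^sub>C ?Y"
  proof -
    have c: "(c * of_real r) *\<^sub>C T = c *\<^sub>C (r *\<^sub>R T)" for c r and T :: "complex^'s^'s"
      by (simp add: cmul_cmul flip: cmul_of_real)
    have n: "of_nat CARD('n) *\<^sub>C T = (\<Sum>j\<in>(UNIV::'n set). T)" for T :: "complex^'s^'s"
      using cmul_of_real [of "real CARD('n)" T] by (simp add: sum_constant_scaleR del: sum_constant)
    have "?E j ** \<alpha> j = (- p) *\<^sub>C ((y $ j) *\<^sub>R ?E j) + ?Y" for j
      by (simp add: \<alpha>_def c mm.diff_right cmul_matrix_mult matrix_mul_assoc EE mm.minus_left mm.minus_right cm.minus_left cm.minus_right mm.scaleR_right)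
    then show "(\<Sum>j\<in>UNIV. ?E j ** \<alpha> j) = (n - p) *\<^sub>C ?Y"
      by (simp only: sum.distrib cm.sum_right [symmetric] rep_vec_basis [OF hom] n [symmetric] cm.add_left [symmetric] n_def) simp
    have "\<beta> j ** ?E j = (- q) *\<^sub>C ((y $ j) *\<^sub>R ?E j) + ?Y" for j
      by (simp add: \<beta>_def c mm.diff_left cmul_matrix_mult EE mm.minus_left cm.minus_left mm.minus_right mm.scaleR_left cm.minus_right flip: matrix_mul_assoc)
    then show "(\<Sum>j\<in>UNIV. \<beta> j ** ?E j) = (n - q) *\<^sub>C ?Y"
      by (simp only: sum.distrib cm.sum_right [symmetric] rep_vec_basis [OF hom] n [symmetric] cm.add_left [symmetric] n_def) simp
  qed
  have S4: "(\<Sum>j\<in>UNIV. \<Sum>k\<in>UNIV. Psi0 (?E k ** ?E j ** G2 (axis j 1, 0) (0, axis k 1)))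
      = (\<Sum>j\<in>UNIV. \<Sum>k\<in>UNIV. Psi0 (?E k ** ?E j ** F2 (axis j 1, 0) (0, axis k 1)))
        - (n - p) * ((n - q) * f) + (n - p) * b2 + (n - q) * a2"
  proof -
    have cyc: "Psi0 (?E k ** ?E j ** (X ** \<beta> k)) = Psi0 (\<beta> k ** ?E k ** (?E j ** X))" for j k X
      by (metis Psi0_commute matrix_mul_assoc)
    have "(\<Sum>j\<in>UNIV. \<Sum>k\<in>UNIV. Psi0 (?E k ** ?E j ** (\<alpha> j ** ?F0 ** \<beta> k))) = - ((n - p) * ((n - q) * f))"
    proof -
      have "(\<Sum>j\<in>UNIV. \<Sum>k\<in>UNIV. Psi0 (?E k ** ?E j ** (\<alpha> j ** ?F0 ** \<beta> k)))
          = Psi0 ((\<Sum>k\<in>UNIV. \<beta> k ** ?E k) ** ((\<Sum>j\<in>UNIV. ?E j ** \<alpha> j) ** ?F0))"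
        unfolding cyc by (simp add: mm.sum_left mm.sum_right Psi0_sum matrix_mul_assoc)
      then show ?thesis
        unfolding SA SB by (simp add: cmul_matrix_mult YYF)
    qed
    moreover have "(\<Sum>j\<in>UNIV. \<Sum>k\<in>UNIV. Psi0 (?E k ** ?E j ** (\<alpha> j ** B k))) = (n - p) * b2"
    proof -
      have "(\<Sum>j\<in>UNIV. \<Sum>k\<in>UNIV. Psi0 (?E k ** ?E j ** (\<alpha> j ** B k)))
          = (\<Sum>k\<in>UNIV. Psi0 (?E k ** ((\<Sum>j\<in>UNIV. ?E j ** \<alpha> j) ** B k)))"
        by (subst sum.swap) (simp add: mm.sum_left mm.sum_right Psi0_sum matrix_mul_assoc)
      then show ?thesis
        unfolding SA b2_def by (simp add: cmul_matrix_mult matrix_mul_assoc sum_distrib_left)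
    qed
    moreover have "(\<Sum>j\<in>UNIV. \<Sum>k\<in>UNIV. Psi0 (?E k ** ?E j ** (A j ** \<beta> k))) = (n - q) * a2"
    proof -
      have "(\<Sum>j\<in>UNIV. \<Sum>k\<in>UNIV. Psi0 (?E k ** ?E j ** (A j ** \<beta> k)))
          = (\<Sum>j\<in>UNIV. Psi0 ((\<Sum>k\<in>UNIV. \<beta> k ** ?E k) ** (?E j ** A j)))"
        unfolding cyc by (simp add: mm.sum_left Psi0_sum)
      then show ?thesis
        unfolding SB a2_def by (simp add: cmul_matrix_mult matrix_mul_assoc sum_distrib_left)
    qed
    ultimately show ?thesis
      unfolding xy conf A B
      by (simp add: mm.add_right sum.distrib mult.assoc)
  qed
  have jf: "jet_form lam mu \<rho> H = (q - n) * q * (\<Sum>j\<in>UNIV. Psi0 (H (axis j 1, 0) (axis j 1, 0)))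
    + (p - n) * p * (\<Sum>j\<in>UNIV. Psi0 (H (0, axis j 1) (0, axis j 1)))
    - 2 * (p - n) * (q - n) * (\<Sum>j\<in>UNIV. Psi0 (H (axis j 1, 0) (0, axis j 1)))
    + 2 * (p + q - n) * (\<Sum>j\<in>UNIV. \<Sum>k\<in>UNIV. Psi0 (?E k ** ?E j ** H (axis j 1, 0) (0, axis k 1)))" for H
    unfolding jet_form_def Let_def p_def q_def n_def by (simp add: algebra_simps)
  have "jet_form lam mu \<rho> G2 = jet_form lam mu \<rho> F2"
    unfolding jf S1 S2 S3 S4 by (simp add: algebra_simps)
  with G show ?thesis
    unfolding p_def q_def by blast
qed

text \<open>
  The trace of a bilinear form can be computed in any orthonormal basis.
\<close>

lemma sum_orthogonal:
  fixes R :: "(real, 'n::finite) vec \<Rightarrow> (real, 'n) vec"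
    and Q :: "(real, 'n) vec \<Rightarrow> (real, 'n) vec \<Rightarrow> 'b::real_vector"
  assumes R: "orthogonal_transformation R" and Q: "bilinear Q"
  shows "(\<Sum>j\<in>UNIV. Q (R (axis j 1)) (R (axis j 1))) = (\<Sum>j\<in>UNIV. Q (axis j 1) (axis j 1))"
proof -
  let ?M = "matrix R"
  have "orthogonal_matrix ?M"
    using R orthogonal_transformation_matrix by blast
  then have orth: "?M ** transpose ?M = mat 1"
    by (simp add: orthogonal_matrix_def)
  have Rj: "R (axis j 1) = (\<Sum>i\<in>UNIV. ?M $ i $ j *\<^sub>R axis i 1)" for j
    using basis_expansion [of "R (axis j 1)"] by (simp add: matrix_def scalar_mult_eq_scaleR)
  have "Q (R (axis j 1)) (R (axis j 1)) = (\<Sum>i\<in>UNIV. \<Sum>k\<in>UNIV. (?M $ i $ j * ?M $ k $ j) *\<^sub>R Q (axis i 1) (axis k 1))" for j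
    unfolding Rj by (subst bilinear_sum [OF Q]) (simp_all add: sum.cartesian_product bilinear_lmul [OF Q] bilinear_rmul [OF Q] split_beta mult.commute)
  then have "(\<Sum>j\<in>UNIV. Q (R (axis j 1)) (R (axis j 1)))
      = (\<Sum>i\<in>UNIV. \<Sum>k\<in>UNIV. (\<Sum>j\<in>UNIV. ?M $ i $ j * ?M $ k $ j) *\<^sub>R Q (axis i 1) (axis k 1))"
    by (simp add: scaleR_sum_left) (rule sum_rotate3 [symmetric])
  also have "(\<lambda>i k. \<Sum>j\<in>UNIV. ?M $ i $ j * ?M $ k $ j) = (\<lambda>i k. if i = k then 1 else 0)"
    using orth by (auto simp: matrix_matrix_mult_def transpose_def mat_def vec_eq_iff fun_eq_iff)
  finally show ?thesis
    by (simp add: if_distrib [of "\<lambda>a. a *\<^sub>R _"] cong: if_cong)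
qed

text \<open>
  The similarity multiplies second derivatives by \<open>r\<^sup>2\<close>.  Conjugation by \<open>M\<close> turns \<open>\<rho>(e\<^sub>j)\<close> into
  \<open>\<rho>(R e\<^sub>j)\<close>, so that all sums run over the orthonormal basis \<open>R e\<^sub>j\<close>.
\<close>

lemma jet_form_similarity:
  fixes F :: "('n::{finite,linorder}, 's::finite) two_var"
  assumes hom: "complex_algebra_hom \<rho>" and F: "has_jet2 F (b, b) F1 F2"
    and R: "orthogonal_transformation R"
    and M: "\<And>x. M ** rep_vec \<rho> x = rep_vec \<rho> (R x) ** M" "M' ** M = mat 1" "M ** M' = mat 1"
  shows "\<exists>G1 G2. has_jet2 (\<lambda>q. M' ** F (b + r *\<^sub>R R (fst q), b + r *\<^sub>R R (snd q)) ** M) (0, 0) G1 G2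
    \<and> jet_form lam mu \<rho> G2 = of_real (r ^ 2) * jet_form lam mu \<rho> F2"
proof -
  have linR: "linear R" using R by (simp add: orthogonal_transformation_def)
  have "linear (\<lambda>q. (r *\<^sub>R R (fst q), r *\<^sub>R R (snd q)))"
    by (intro linearI) (simp_all add: linear_add [OF linR] linear_scale [OF linR] scaleR_add_right)
  then have "has_jet2 (\<lambda>q. (b, b) + (r *\<^sub>R R (fst q), r *\<^sub>R R (snd q))) (0, 0)
      (\<lambda>q. (r *\<^sub>R R (fst q), r *\<^sub>R R (snd q))) (\<lambda>u v. 0)"
    by (intro has_jet2_affine bounded_linear_euclidean)
  then have Fc: "has_jet2 (\<lambda>q. F (b + r *\<^sub>R R (fst q), b + r *\<^sub>R R (snd q))) (0, 0)
     (\<lambda>v. F1 (r *\<^sub>R R (fst v), r *\<^sub>R R (snd v)))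
     (\<lambda>u v. F2 (r *\<^sub>R R (fst u), r *\<^sub>R R (snd u)) (r *\<^sub>R R (fst v), r *\<^sub>R R (snd v)) + F1 0)"
    using has_jet2_compose [where g = F and p = "(0, 0)"] F linear_0 [OF linR] by fastforce
  have F10: "F1 0 = 0"
    using linear_0 [OF bounded_linear.linear [OF has_jet2_bounded_linear(1) [OF F]]] .
  have bil: "bilinear F2" by (rule has_jet2_bilinear_second [OF F])
  let ?G2 = "\<lambda>u v. (r * r) *\<^sub>R (M' ** F2 (R (fst u), R (snd u)) (R (fst v), R (snd v)) ** M)"
  have sc: "(r *\<^sub>R x, r *\<^sub>R z) = r *\<^sub>R (x, z)" for x z :: "(real, 'n) vec"
    by simp
  have "has_jet2 (\<lambda>q. M' ** F (b + r *\<^sub>R R (fst q), b + r *\<^sub>R R (snd q)) ** M) (0, 0)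
      (\<lambda>v. M' ** F1 (r *\<^sub>R R (fst v), r *\<^sub>R R (snd v)) ** M) ?G2"
    by (rule has_jet2_eq [OF has_jet2_bilinear [OF bounded_bilinear_matrix_mult
          has_jet2_bilinear [OF bounded_bilinear_matrix_mult has_jet2_const Fc] has_jet2_const]])
      (simp_all only: sc F10 bilinear_lmul [OF bil] bilinear_rmul [OF bil] mm.zero_left mm.zero_right
        mm.scaleR_left mm.scaleR_right add_0_left add_0_right scaleR_scaleR)
  moreover have "jet_form lam mu \<rho> ?G2 = of_real (r ^ 2) * jet_form lam mu \<rho> F2"
  proof -
    have conj: "Psi0 (M' ** T ** M) = Psi0 T" for T
      by (subst Psi0_commute) (simp add: matrix_mul_assoc M)
    have MM: "Psi0 (rep_vec \<rho> x ** rep_vec \<rho> z ** (M' ** T ** M)) = Psi0 (rep_vec \<rho> (R x) ** rep_vec \<rho> (R z) ** T)" for x z T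
    proof -
      have "Psi0 (rep_vec \<rho> x ** rep_vec \<rho> z ** (M' ** T ** M)) = Psi0 (M ** rep_vec \<rho> x ** rep_vec \<rho> z ** M' ** T)"
        using Psi0_commute [of "rep_vec \<rho> x ** rep_vec \<rho> z ** M' ** T" M] by (simp add: matrix_mul_assoc)
      also have "\<dots> = Psi0 (rep_vec \<rho> (R x) ** (M ** rep_vec \<rho> z) ** M' ** T)"
        by (simp only: M(1) [of x] matrix_mul_assoc)
      also have "\<dots> = Psi0 (rep_vec \<rho> (R x) ** rep_vec \<rho> (R z) ** (M ** M') ** T)"
        unfolding M(1) by (simp only: matrix_mul_assoc)
      finally show ?thesis by (simp add: M)
    qed
    have pairs: "(u + v, 0 :: (real, 'n) vec) = (u, 0) + (v, 0)" "(0 :: (real, 'n) vec, u + v) = (0, u) + (0, v)"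
      "(c *\<^sub>R v, 0 :: (real, 'n) vec) = c *\<^sub>R (v, 0)" "(0 :: (real, 'n) vec, c *\<^sub>R v) = c *\<^sub>R (0, v)"
      for u v :: "(real, 'n) vec" and c
      by simp_all
    note lin = linear_rep_vec [OF hom]
    note rules = pairs bilinear_ladd [OF bil] bilinear_radd [OF bil] bilinear_lmul [OF bil] bilinear_rmul [OF bil]
      linear_add [OF lin] linear_scale [OF lin] mm.add_left mm.add_right mm.scaleR_left mm.scaleR_right
      Psi0_simps sum.distrib scaleR_conv_of_real [where 'a = complex] sum_distrib_left scaleR_sum_right
    have xx: "bilinear (\<lambda>u v. Psi0 (F2 (u, 0) (v, 0)))" and yy: "bilinear (\<lambda>u v. Psi0 (F2 (0, u) (0, v)))"
      and xy: "bilinear (\<lambda>u v. Psi0 (F2 (u, 0) (0, v)))"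
      and d1: "bilinear (\<lambda>u v. \<Sum>k\<in>UNIV. Psi0 (rep_vec \<rho> (R (axis k 1)) ** rep_vec \<rho> u ** F2 (v, 0) (0, R (axis k 1))))"
      and d2: "bilinear (\<lambda>u v. Psi0 (rep_vec \<rho> u ** rep_vec \<rho> (axis j 1) ** F2 (axis j 1, 0) (0, v)))" for j
      unfolding bilinear_def by (auto intro!: linearI simp only: rules)
    have D: "(\<Sum>j\<in>UNIV. \<Sum>k\<in>UNIV. Psi0 (rep_vec \<rho> (R (axis k 1)) ** rep_vec \<rho> (R (axis j 1)) ** F2 (R (axis j 1), 0) (0, R (axis k 1))))
        = (\<Sum>j\<in>UNIV. \<Sum>k\<in>UNIV. Psi0 (rep_vec \<rho> (axis k 1) ** rep_vec \<rho> (axis j 1) ** F2 (axis j 1, 0) (0, axis k 1)))"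
      unfolding sum_orthogonal [OF R d1] by (intro sum.cong refl sum_orthogonal [OF R d2])
    have R0: "R 0 = 0" by (rule linear_0 [OF linR])
    show ?thesis
      unfolding jet_form_def Let_def mm.scaleR_right Psi0_simps sum_distrib_left [symmetric] conj MM fst_conv snd_conv R0
        sum_orthogonal [OF R xx] sum_orthogonal [OF R yy] sum_orthogonal [OF R xy] D
      by (simp add: power2_eq_square algebra_simps)
  qed
  ultimately show ?thesis by blast
qed

section \<open>Covariance\<close>

lemma matrix_inv_eqI:
  fixes A B :: "complex^'s^'s"
  assumes "A ** B = mat 1" "B ** A = mat 1"
  shows "matrix_inv A = B"
proof -
  have "A ** matrix_inv A = mat 1 \<and> matrix_inv A ** A = mat 1"
    unfolding matrix_inv_def by (rule someI [of _ B]) (use assms in simp)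
  then show ?thesis
    by (metis assms(2) matrix_mul_assoc matrix_mul_lid matrix_mul_rid)
qed

text \<open>
  For vectors \<open>\<rho>'(u)\<^sup>T = -\<rho>(u) = \<rho>(u)\<inverse>\<close> if \<open>u\<close> has length one, and this is multiplicative.
\<close>

lemma dual_spin_inverse:
  assumes hom: "complex_algebra_hom \<rho>" and dual: "dual_rep \<rho> \<rho>'" and m: "m \<in> Spin_n"
  shows "transpose (matrix_inv (crep \<rho>' m)) = crep \<rho> m"
proof -
  have hom': "complex_algebra_hom \<rho>'" using dual by (simp add: dual_rep_def)
  have "transpose (crep \<rho>' (prod_list (map euclid_vec us))) ** crep \<rho> (prod_list (map euclid_vec us)) = mat 1"
    if "\<forall>u\<in>set us. norm u = 1" for us
    using that
  proof (induction us)
    case (Cons u us)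
    let ?b = "prod_list (map euclid_vec us)"
    have "transpose (crep \<rho>' (euclid_vec u * ?b)) ** crep \<rho> (euclid_vec u * ?b)
      = transpose (crep \<rho>' ?b) ** - (rep_vec \<rho> u ** rep_vec \<rho> u) ** crep \<rho> ?b"
      by (simp add: crep_hom [OF hom] crep_hom [OF hom'] crep_vec matrix_transpose_mul dual_rep_transpose [OF dual]
          matrix_mul_assoc mm.minus_left mm.minus_right)
    also have "\<dots> = mat 1"
      using Cons by (simp add: rep_vec_square [OF hom] norm_eq_1)
    finally show ?case by simp
  qed (simp add: crep_hom [OF hom] crep_hom [OF hom'] transpose_mat)
  then have "transpose (crep \<rho>' m) ** crep \<rho> m = mat 1"
    using m by (auto simp: Spin_n_def)
  from arg_cong [OF this, of transpose] have left: "transpose (crep \<rho> m) ** crep \<rho>' m = mat 1"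
    by (simp add: matrix_transpose_mul transpose_mat)
  then have "crep \<rho>' m ** transpose (crep \<rho> m) = mat 1"
    by (rule matrix_left_right_inverse [THEN iffD1])
  then have "matrix_inv (crep \<rho>' m) = transpose (crep \<rho> m)"
    using left by (rule matrix_inv_eqI)
  then show ?thesis by simp
qed

lemma power_factor_sqrt:
  assumes "s > 0"
  shows "exp (- c * of_real (ln s)) * of_real (1 / sqrt s) = (exp (- ((2 * c + 1) / 2) * of_real (ln s)) :: complex)"
proof -
  have "exp (ln s / 2) = sqrt s"
    using assms by (simp flip: ln_sqrt)
  then have "1 / sqrt s = exp (- (ln s / 2))"
    by (simp add: exp_minus inverse_eq_divide)
  then have "(of_real (1 / sqrt s) :: complex) = exp (of_real (- (ln s / 2)))"
    by (simp only: exp_of_real)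
  then show ?thesis
    by (simp only: mult_exp_exp, intro arg_cong [where f = exp]) (simp add: field_simps)
qed

text \<open>
  The inverse of \<open>1 - y\<xi>\<close> is \<open>1 - \<xi>y\<close> divided by \<^const>\<open>sct_denom\<close>; the square root in the
  normalization of the spin part raises the exponent \<open>\<lambda>\<close> to \<open>\<lambda> + 1/2\<close>.
\<close>

lemma conf_left_spin:
  assumes hom: "complex_algebra_hom \<rho>" and P: "sct_denom y x > 0" and M: "crep \<rho> m ** M' = mat 1" "M' ** crep \<rho> m = mat 1"
  shows "exp (- lam * of_real (ln (sct_denom y x))) *\<^sub>C matrix_inv (crep \<rho> (m * sct_spin y x))
    = conf_left \<rho> (2 * lam + 1) y x ** M'"
proof -
  let ?P = "sct_denom y x"
  let ?a = "1 - euclid_vec y * euclid_vec x" and ?b = "1 - euclid_vec x * euclid_vec y"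
  have P': "(1 / sqrt ?P) * (1 / sqrt ?P) * ?P = 1"
    using P by (simp add: field_simps)
  have yyb: "euclid_vec y * (euclid_vec y * b) = - ((y \<bullet> y) *\<^sub>R b)" for y :: "(real, 'a) vec" and b
    by (simp add: euclid_vec_square flip: mult.assoc)
  have xyyx: "euclid_vec x * (euclid_vec y * (euclid_vec y * euclid_vec x)) = ((x \<bullet> x) * (y \<bullet> y)) *\<^sub>R 1"
    "euclid_vec y * (euclid_vec x * (euclid_vec x * euclid_vec y)) = ((x \<bullet> x) * (y \<bullet> y)) *\<^sub>R 1"
    by (simp_all add: yyb euclid_vec_square mult.commute)
  have "?a * ?b = 1 - (euclid_vec x * euclid_vec y + euclid_vec y * euclid_vec x) + ((x \<bullet> x) * (y \<bullet> y)) *\<^sub>R 1"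
    "?b * ?a = 1 - (euclid_vec x * euclid_vec y + euclid_vec y * euclid_vec x) + ((x \<bullet> x) * (y \<bullet> y)) *\<^sub>R 1"
    by (simp_all add: left_diff_distrib right_diff_distrib mult.assoc xyyx)
  then have ab: "?a * ?b = ?P *\<^sub>R 1" "?b * ?a = ?P *\<^sub>R 1"
    by (simp_all add: euclid_vec_anticommute sct_denom_def scaleR_add_left)
  let ?S = "crep \<rho> (sct_spin y x)" and ?S' = "crep \<rho> ((1 / sqrt ?P) *\<^sub>R ?b)"
  have "sct_spin y x * ((1 / sqrt ?P) *\<^sub>R ?b) = 1" "((1 / sqrt ?P) *\<^sub>R ?b) * sct_spin y x = 1"
    using P' by (simp_all only: sct_spin_def mult_scaleR_left mult_scaleR_right ab scaleR_scaleR) simp_all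
  then have S: "?S ** ?S' = mat 1" "?S' ** ?S = mat 1"
    by (simp_all flip: crep_hom [OF hom])
  have "matrix_inv (crep \<rho> (m * sct_spin y x)) = ?S' ** M'"
  proof (rule matrix_inv_eqI)
    have "crep \<rho> m ** ?S ** (?S' ** M') = crep \<rho> m ** (?S ** ?S') ** M'"
      "?S' ** M' ** (crep \<rho> m ** ?S) = ?S' ** (M' ** crep \<rho> m) ** ?S"
      by (simp_all only: matrix_mul_assoc)
    then show "crep \<rho> (m * sct_spin y x) ** (?S' ** M') = mat 1" "?S' ** M' ** crep \<rho> (m * sct_spin y x) = mat 1"
      by (simp_all add: S M crep_hom(3) [OF hom])
  qed
  moreover have "exp (- lam * of_real (ln ?P)) * of_real (1 / sqrt ?P) = (exp (- ((2 * lam + 1) / 2) * of_real (ln ?P)) :: complex)"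
    by (rule power_factor_sqrt [OF P])
  ultimately show ?thesis
    by (simp add: conf_left_def crep_hom(4) [OF hom] cmul_matrix_mult cmul_cmul flip: cmul_of_real)
qed

lemma conf_right_spin:
  assumes hom: "complex_algebra_hom \<rho>" and P: "sct_denom y x > 0"
  shows "exp (- mu * of_real (ln (sct_denom y x))) *\<^sub>C crep \<rho> (m * sct_spin y x)
    = crep \<rho> m ** conf_right \<rho> (2 * mu + 1) y x"
proof -
  let ?P = "sct_denom y x"
  have "exp (- mu * of_real (ln ?P)) * of_real (1 / sqrt ?P) = (exp (- ((2 * mu + 1) / 2) * of_real (ln ?P)) :: complex)"
    by (rule power_factor_sqrt [OF P])
  then show ?thesis
    by (simp add: conf_right_def sct_spin_def crep_hom(3,4) [OF hom] cmul_matrix_mult cmul_cmul mm.scaleR_right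
        flip: cmul_of_real)
qed

lemma chi_sct:
  assumes "sct_denom y x > 0"
  shows "inverse (chi lam (a_elem (t + ln (sct_denom y x) / 2) :: ('n::{finite,linorder} lorentz, real) clifford)) = exp (- 2 * of_real t * lam) * exp (- lam * of_real (ln (sct_denom y x)))"
  by (simp add: chi_a_elem mult_exp_exp algebra_simps flip: exp_minus)

lemma eventually_nhds_pair:
  assumes "\<forall>\<^sub>F x in nhds a. P x" "\<forall>\<^sub>F y in nhds b. Q y"
  shows "\<forall>\<^sub>F q in nhds (a, b). P (fst q) \<and> Q (snd q)"
proof -
  have "filterlim fst (nhds a) (nhds (a, b))" "filterlim snd (nhds b) (nhds (a, b))"
    using tendsto_fst [of "\<lambda>q. q" "(a, b)" "nhds (a, b)"] tendsto_snd [of "\<lambda>q. q" "(a, b)" "nhds (a, b)"]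
    by (simp_all add: filterlim_ident)
  then show ?thesis
    using assms by (intro eventually_conj) (auto intro: eventually_compose_filterlim)
qed

lemma jet_form_cmul: "jet_form lam mu \<rho> (\<lambda>u v. c *\<^sub>C F2 u v) = c * jet_form lam mu \<rho> F2"
  by (simp add: jet_form_def Let_def cmul_matrix_mult algebra_simps flip: sum_distrib_left)

lemma jet_form_zero: "jet_form lam mu \<rho> (\<lambda>u v. 0) = 0"
  by (simp add: jet_form_def Let_def mm.zero_right)

text \<open>
  By \<open>factorization_near\<close> the transformed function is, near \<open>(x\<^sub>0, x\<^sub>0)\<close>, a constant multiple of a
  twist of a similarity transform of \<open>F\<close>, translated to \<open>x\<^sub>0\<close>.  With \<open>a = a\<^sub>t\<close> the constant is
  \<open>e\<^bsup>-2t(\<lambda> + \<mu>)\<^esup>\<close>, and the similarity contributes the factor \<open>e\<^bsup>-4t\<^esup>\<close>, which shifts the weight by two.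
\<close>

lemma B1_pi_tensor_defined:
  fixes F :: "('n::{finite,linorder}, 's::finite) two_var"
  assumes hom: "complex_algebra_hom \<rho>" and dual: "dual_rep \<rho> \<rho>'" and F: "smooth F"
    and def: "act_defined (cl_inverse g) x0"
  shows "B1 lam mu \<rho> \<rho>' (pi_tensor lam mu \<rho> \<rho>' g F) x0 = pi_scalar (lam + mu + 2) g (B1 lam mu \<rho> \<rho>' F) x0"
proof -
  define h where "h = cl_inverse g"
  obtain b m a where fac: "factorization h x0 b m a"
    using def by (auto simp: act_defined_def h_def)
  obtain t y R where a: "a = a_elem t" and R: "orthogonal_transformation R"
    and mR: "\<And>x. m * euclid_vec x = euclid_vec (R x) * m"
    and near: "\<And>\<xi>. sct_denom y \<xi> > 0 \<Longrightarrow> factorization h (x0 + \<xi>) (b + exp (- 2 * t) *\<^sub>R R (sct y \<xi>))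
        (m * sct_spin y \<xi>) (a_elem (t + ln (sct_denom y \<xi>) / 2))"
    using factorization_near [OF fac] by metis
  have m: "m \<in> Spin_n"
    using fac by (simp add: factorization_def)
  obtain m' where m': "m * m' = 1" "m' * m = 1"
    using spin_inverse [OF m] by blast
  define M M' where "M = crep \<rho> m" and "M' = crep \<rho> m'"
  have MM: "M ** M' = mat 1" "M' ** M = mat 1"
    using m' by (simp_all add: M_def M'_def flip: crep_hom [OF hom])
  have MR: "M ** rep_vec \<rho> x = rep_vec \<rho> (R x) ** M" for x
    using arg_cong [OF mR [of x], of "crep \<rho>"] by (simp add: M_def crep_hom [OF hom] crep_vec)
  define r where "r = exp (- 2 * t)"
  define c where "c = exp (- 2 * of_real t * lam) * exp (- 2 * of_real t * mu)"
  let ?H = "\<lambda>q. M' ** F (b + r *\<^sub>R R (fst q), b + r *\<^sub>R R (snd q)) ** M"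
  let ?K = "\<lambda>q. conf_left \<rho> (2 * lam + 1) y (fst q) ** ?H (sct y (fst q), sct y (snd q))
      ** conf_right \<rho> (2 * mu + 1) y (snd q)"
  have germ: "pi_tensor lam mu \<rho> \<rho>' g F q = c *\<^sub>C ?K (- (x0, x0) + q)"
    if "sct_denom y (fst q - x0) > 0" "sct_denom y (snd q - x0) > 0" for q
  proof -
    have fx: "factorization h (fst q) (b + r *\<^sub>R R (sct y (fst q - x0))) (m * sct_spin y (fst q - x0))
        (a_elem (t + ln (sct_denom y (fst q - x0)) / 2))"
      using near [OF that(1)] by (simp add: r_def)
    have fy: "factorization h (snd q) (b + r *\<^sub>R R (sct y (snd q - x0))) (m * sct_spin y (snd q - x0))
        (a_elem (t + ln (sct_denom y (snd q - x0)) / 2))"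
      using near [OF that(2)] by (simp add: r_def)
    note dspin = dual_spin_inverse [OF hom dual spin_mult [OF m sct_spin_in_Spin_n [OF that(2)]]]
    let ?T = "F (b + r *\<^sub>R R (sct y (fst q - x0)), b + r *\<^sub>R R (sct y (snd q - x0)))"
    have "pi_tensor lam mu \<rho> \<rho>' g F q =
      (exp (- 2 * of_real t * lam) * exp (- lam * of_real (ln (sct_denom y (fst q - x0))))
        * (exp (- 2 * of_real t * mu) * exp (- mu * of_real (ln (sct_denom y (snd q - x0)))))) *\<^sub>C
        (matrix_inv (crep \<rho> (m * sct_spin y (fst q - x0))) ** (?T ** crep \<rho> (m * sct_spin y (snd q - x0))))"
      unfolding pi_tensor_def Let_def split_beta h_def [symmetric]
      by (simp add: factorization_act [OF hom fx] factorization_act [OF hom fy] chi_sct [OF that(1)] chi_sct [OF that(2)]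
          act_left_def act_right_def dspin flip: crep_def)
    also have "\<dots> = c *\<^sub>C ((exp (- lam * of_real (ln (sct_denom y (fst q - x0)))) *\<^sub>C matrix_inv (crep \<rho> (m * sct_spin y (fst q - x0))))
        ** ?T ** (exp (- mu * of_real (ln (sct_denom y (snd q - x0)))) *\<^sub>C crep \<rho> (m * sct_spin y (snd q - x0))))"
      by (simp add: c_def cmul_matrix_mult cmul_cmul mult_ac matrix_mul_assoc)
    also have "\<dots> = c *\<^sub>C ?K (- (x0, x0) + q)"
      unfolding conf_left_spin [OF hom that(1) MM [unfolded M_def]] conf_right_spin [OF hom that(2)]
      by (simp add: M_def matrix_mul_assoc)
    finally show ?thesis .
  qed
  obtain H1 H2 where H: "has_jet2 ?H (0, 0) H1 H2"
    and H2: "jet_form lam mu \<rho> H2 = of_real (r\<^sup>2) * jet_form lam mu \<rho>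
        (\<lambda>u v. frechet_derivative (\<lambda>q. frechet_derivative F (at q) v) (at (b, b)) u)"
    using jet_form_similarity [OF hom has_jet2_smooth [OF F] R MR MM(2,1)] by blast
  obtain K1 K2 where K: "has_jet2 ?K (0, 0) K1 K2" and K2: "jet_form lam mu \<rho> K2 = jet_form lam mu \<rho> H2"
    using jet_form_twist [OF hom H] by blast
  have "has_jet2 (\<lambda>q. ?K (- (x0, x0) + q)) (x0, x0) K1 (\<lambda>u v. K2 u v + K1 0)"
    by (rule has_jet2_compose [where g = ?K, OF has_jet2_affine [OF bounded_linear_ident]])
      (use K in \<open>simp add: zero_prod_def\<close>)
  moreover have "K1 0 = 0"
    using linear_0 [OF bounded_linear.linear [OF has_jet2_bounded_linear(1) [OF K]]] .
  ultimately have "has_jet2 (\<lambda>q. c *\<^sub>C ?K (- (x0, x0) + q)) (x0, x0) (\<lambda>v. c *\<^sub>C K1 v) (\<lambda>u v. c *\<^sub>C K2 u v)"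
    by (intro has_jet2_eq [OF has_jet2_bilinear [OF bounded_bilinear_cmul has_jet2_const]])
      (auto simp: cm.zero_left)
  moreover have "\<forall>\<^sub>F q in nhds (x0, x0). c *\<^sub>C ?K (- (x0, x0) + q) = pi_tensor lam mu \<rho> \<rho>' g F q"
    using eventually_nhds_pair [OF eventually_sct_denom_pos [of y x0] eventually_sct_denom_pos [of y x0]]
    by eventually_elim (simp only: germ)
  ultimately have "has_jet2 (pi_tensor lam mu \<rho> \<rho>' g F) (x0, x0) (\<lambda>v. c *\<^sub>C K1 v) (\<lambda>u v. c *\<^sub>C K2 u v)"
    by (rule has_jet2_cong)
  from B1_eq_jet_form [OF hom dual this, of lam mu]
  have "B1 lam mu \<rho> \<rho>' (pi_tensor lam mu \<rho> \<rho>' g F) x0 = c * (of_real (r\<^sup>2) * B1 lam mu \<rho> \<rho>' F b)"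
    unfolding jet_form_cmul K2 H2 B1_eq_jet_form [OF hom dual has_jet2_smooth [OF F], of lam mu] .
  also have "c * (of_real (r\<^sup>2) * B1 lam mu \<rho> \<rho>' F b) = inverse (chi (lam + mu + 2) (a_elem t :: ('n lorentz, real) clifford)) * B1 lam mu \<rho> \<rho>' F b"
  proof -
    have "of_real (r\<^sup>2) = (exp (- 4 * of_real t) :: complex)"
      by (simp add: r_def power2_eq_square mult_exp_exp flip: exp_of_real)
    then show ?thesis
      by (simp add: c_def chi_a_elem mult_exp_exp algebra_simps flip: exp_minus)
  qed
  also have "\<dots> = pi_scalar (lam + mu + 2) g (B1 lam mu \<rho> \<rho>' F) x0"
    unfolding pi_scalar_def Let_def h_def [symmetric]
    using factorization_act [OF hom fac] by (simp add: a)
  finally show ?thesis .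
qed

text \<open>
  If \<open>g\<inverse>\<close> is not defined at \<open>x\<^sub>0\<close>, then \<open>x\<^sub>0\<close> is outside the image under \<open>g\<close> of the first projection
  of the support of \<open>F\<close>.  This image is compact, so the transformed function vanishes near
  \<open>(x\<^sub>0, x\<^sub>0)\<close>.
\<close>

lemma B1_pi_tensor_undefined:
  fixes F :: "('n::{finite,linorder}, 's::finite) two_var"
  assumes hom: "complex_algebra_hom \<rho>" and dual: "dual_rep \<rho> \<rho>'" and g: "g \<in> Spin0"
    and compact: "compact (supp F)" and def: "\<forall>(x, y)\<in>supp F. act_defined g x \<and> act_defined g y"
    and undef: "\<not> act_defined (cl_inverse g) x0"
  shows "B1 lam mu \<rho> \<rho>' (pi_tensor lam mu \<rho> \<rho>' g F) x0 = pi_scalar (lam + mu + 2) g (B1 lam mu \<rho> \<rho>' F) x0"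
proof -
  define K where "K = fst ` supp F"
  have "compact K"
    unfolding K_def by (intro compact_continuous_image compact continuous_intros)
  have defK: "act_defined g x" if "x \<in> K" for x
    using that def by (auto simp: K_def)
  have "continuous_on K (act_point g)"
    by (intro continuous_at_imp_continuous_on ballI isCont_act_point [OF hom] defK)
  then have "closed (act_point g ` K)"
    using \<open>compact K\<close> by (intro compact_imp_closed compact_continuous_image)
  moreover have "x0 \<notin> act_point g ` K"
    using undef act_inverse(1) [OF hom Spin0_inverse(2) [OF g] defK] by auto
  ultimately have "\<forall>\<^sub>F x in nhds x0. x \<in> - act_point g ` K"
    by (intro eventually_nhds_in_open) auto
  then have "\<forall>\<^sub>F q in nhds (x0, x0). fst q \<in> - act_point g ` K \<and> True"
    by (rule eventually_nhds_pair) simp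
  then have "\<forall>\<^sub>F q in nhds (x0, x0). 0 = pi_tensor lam mu \<rho> \<rho>' g F q"
  proof eventually_elim
    case (elim q)
    let ?h = "cl_inverse g"
    show ?case
    proof (cases "act_defined ?h (fst q) \<and> act_defined ?h (snd q)")
      case True
      have "act_point ?h (fst q) \<notin> K"
      proof
        assume "act_point ?h (fst q) \<in> K"
        then have "act_point g (act_point ?h (fst q)) \<in> act_point g ` K"
          by (rule imageI)
        moreover have "act_point g (act_point ?h (fst q)) = fst q"
          using True by (intro act_inverse(2) [OF hom Spin0_inverse(1) [OF g]]) simp
        ultimately show False
          using elim by simp
      qed
      then have "(act_point ?h (fst q), act_point ?h (snd q)) \<notin> supp F"
        using imageI [of "(act_point ?h (fst q), act_point ?h (snd q))" "supp F" fst] by (auto simp: K_def)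
      then have "F (act_point ?h (fst q), act_point ?h (snd q)) = 0"
        using subsetD [OF closure_subset, of "(act_point ?h (fst q), act_point ?h (snd q))" "{x. F x \<noteq> 0}"]
        by (auto simp: supp_def)
      then show ?thesis
        by (simp add: pi_tensor_def split_beta Let_def act_left_def act_right_def mm.zero_left mm.zero_right cm.zero_right)
    next
      case False
      then show ?thesis
        by (auto simp: pi_tensor_def split_beta Let_def)
    qed
  qed
  from has_jet2_cong [OF has_jet2_const this]
  have "B1 lam mu \<rho> \<rho>' (pi_tensor lam mu \<rho> \<rho>' g F) x0 = jet_form lam mu \<rho> (\<lambda>u v. 0)"
    by (rule B1_eq_jet_form [OF hom dual])
  then show ?thesis
    using undef by (simp add: jet_form_zero pi_scalar_def)
qed

theorem theorem5p4:
  fixes lam mu :: complex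
    and \<rho> \<rho>' :: "('n::{finite,linorder}, 's::finite) clifford_rep"
  assumes "complex_algebra_hom \<rho>" and "dual_rep \<rho> \<rho>'"
  shows
    "(\<forall>F. smooth F \<longrightarrow> smooth (B1 lam mu \<rho> \<rho>' F)) \<and>
     (\<forall>v w x. smooth v \<longrightarrow> smooth w \<longrightarrow>
        B1 lam mu \<rho> \<rho>' (\<lambda>(x, y). tensor (v x) (w y)) x =
          (let n = of_nat CARD('n) in
             (2 * mu - n + 1) * (2 * mu + 1) * pairing (laplace v x) (w x)
           + (2 * lam - n + 1) * (2 * lam + 1) * pairing (v x) (laplace w x)
           - 2 * (2 * lam - n + 1) * (2 * mu - n + 1)
               * (\<Sum>j\<in>UNIV. pairing (partial j v x) (partial j w x))
           - 2 * (2 * lam + 2 * mu - n + 2) * pairing (dirac \<rho> v x) (dirac \<rho>' w x))) \<and>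
     (\<forall>g\<in>Spin0. \<forall>F. smooth F \<longrightarrow> compact (supp F) \<longrightarrow>
        (\<forall>(x, y)\<in>supp F. act_defined g x \<and> act_defined g y) \<longrightarrow>
        B1 lam mu \<rho> \<rho>' (pi_tensor lam mu \<rho> \<rho>' g F)
          = pi_scalar (lam + mu + 2) g (B1 lam mu \<rho> \<rho>' F))"
proof (intro conjI allI ballI impI)
  show "smooth (B1 lam mu \<rho> \<rho>' F)" if "smooth F" for F
    by (rule smooth_B1 [OF assms that])
next
  fix g :: "('n lorentz, real) clifford" and F :: "('n, 's) two_var"
  assume "g \<in> Spin0" "smooth F" "compact (supp F)" "\<forall>(x, y)\<in>supp F. act_defined g x \<and> act_defined g y"
  then show "B1 lam mu \<rho> \<rho>' (pi_tensor lam mu \<rho> \<rho>' g F) = pi_scalar (lam + mu + 2) g (B1 lam mu \<rho> \<rho>' F)"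
    using B1_pi_tensor_defined [OF assms] B1_pi_tensor_undefined [OF assms] by (intro ext) blast
qed (rule B1_tensor [OF assms])

end
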